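(* Let $\tau>0$. Each user $k\in\{1,\dots,K\}$ starts from an arbitrary Hermitian matrix $\mathbf{Y}_k$ with $\mathbf{X}_k=\exp(\mathbf{Y}_k)/\operatorname{tr}[\exp(\mathbf{Y}_k)]$ and, independently of the other users, performs at the $j$-th tick ($j=1,2,\dots$) of their own update timer the update $$\mathbf{Y}_k\leftarrow\mathbf{Y}_k+\frac{1}{j+1}\big(\hat{\mathbf{V}}_k-\tau\mathbf{Y}_k\big),\qquad \mathbf{X}_k\leftarrow\frac{\exp(\mathbf{Y}_k)}{\operatorname{tr}[\exp(\mathbf{Y}_k)]},\qquad \hat{\mathbf{V}}_k=\mathbf{H}_k^\dagger\mathbf{W}^{-1}\mathbf{H}_k,$$ where $\mathbf{H}_k$ is user $k$'s currently measured channel matrix and $\mathbf{W}$ is the latest broadcast of the receiver; $\mathbf{X}_k$ is constant between two consecutive ticks of user $k$'s timer. Assume that all timers have positive finite rate. Then there is a function $\varepsilon(\tau)$ with $\varepsilon(\tau)\to0$ as $\tau\to0^+$ such that, for every $\tau>0$, the iterates $\mathbf{X}=(\mathbf{X}_1,\dots,\mathbf{X}_K)$ converge almost surely to a point within distance $\varepsilon(\tau)$ of a Nash equilibrium of the rate maximization game.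
   Context: There are $K$ users; user $k$ has $M_k$ transmit antennas and transmit power $P_k>0$, and the receiver has $N$ antennas. The channel matrices $\mathbf{H}=(\mathbf{H}_1,\dots,\mathbf{H}_K)$, $\mathbf{H}_k(t)\in\mathbb{C}^{N\times M_k}$, evolve over time as a bounded stationary ergodic process; $\mathbb{E}$ without conditioning, applied to functions of $\mathbf{H}$, is expectation over its stationary law. Set $\mathbf{W}(\mathbf{X};\mathbf{H})=\mathbf{I}+\sum_\ell P_\ell\mathbf{H}_\ell\mathbf{X}_\ell\mathbf{H}_\ell^\dagger$. User $k$'s action set is $\mathcal{X}_k=\{\mathbf{X}_k\in\mathbb{C}^{M_k\times M_k}\text{ Hermitian}:\mathbf{X}_k\succeq0,\ \operatorname{tr}(\mathbf{X}_k)=1\}$. The rate maximization game has utilities $$u_k(\mathbf{X})=\mathbb{E}\Big[\log\det\Big(\mathbf{I}+\sum_\ell P_\ell\mathbf{H}_\ell\mathbf{X}_\ell\mathbf{H}_\ell^\dagger\Big)-\log\det\Big(\mathbf{I}+\sum_{\ell\ne k}P_\ell\mathbf{H}_\ell\mathbf{X}_\ell\mathbf{H}_\ell^\dagger\Big)\Big],$$ each user $k$ unilaterally maximizing $u_k$ over $\mathcal{X}_k$. A Nash equilibrium is a profile $\mathbf{X}^*\in\prod_k\mathcal{X}_k$ with $u_k(\mathbf{X}^* )\ge u_k(\mathbf{X}_k;\mathbf{X}^*_{-k})$ for all $k$ and all $\mathbf{X}_k\in\mathcal{X}_k$, where $(\mathbf{X}_k;\mathbf{X}^*_{-k})$ replaces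 the $k$-th component of $\mathbf{X}^*$ by $\mathbf{X}_k$. Timers: $\tau_k:\mathbb{N}\to\mathbb{R}_+$ is an increasing (possibly random) sequence, $\tau_k(j)$ being the time of the $j$-th update of user $k$; $\tau_0$ is the receiver's timer, and at each tick of $\tau_0$ (time $t$) the receiver measures and broadcasts $\mathbf{W}(t)=\mathbf{W}(\mathbf{X}(t);\mathbf{H}(t))$. A timer has positive finite rate if $\lim_{j\to\infty}\tau_k(j)/j$ exists and is positive and finite. Overall update epochs $n=1,2,\dots$ are the successive times at which at least one user updates; $\mathcal{K}_n$ is the set of users updating at epoch $n$; $\mathbf{X}(n)$ is the profile in force just before epoch $n$; $\hat{\mathbf{V}}_k(n)$ is the matrix used by user $k\in\mathcal{K}_n$ at epoch $n$; and $d(n)\ge0$ is the number of overall update epochs by which the latest broadcast available at epoch $n$ is out of date (so that broadcast was measured at profile $\mathbf{X}(n-d(n))$). Standing assumptions: the delays $d(n)$ are bounded almost surely, and the asynchronous gradient estimates are unbiased, i.e. $\mathbb{E}[\hat{\mathbf{V}}_k(n)\mid\mathcal{F}_n]=\mathbf{V}_k(\mathbf{X}(n-d(n)))$ for $k\in\mathcal{K}_n$, where $\mathcal{F}_n$ is the filtration of the history (iterates, update sets and delays) at epoch $n$ and $\mathbf{V}_k(\mathbf{X})=\mathbb{E}[\mathbf{H}_k^\dagger\mathbf{W}(\mathbf{X};\mathbf{H})^{-1}\mathbf{H}_k]$ (the gradient of user $k$'s rate with respect to $P_k\mathbf{X}_k$). *)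

theory Defs
  imports "HOL-Probability.Probability"
begin

section \<open>Matrices\<close>

text \<open>
  The users are the elements of a finite type \<open>'k\<close>, the receive antennas those of a finite
  type \<open>'n\<close>. The numbers of transmit antennas may differ between the users, so user \<open>k\<close> has a
  nonempty set \<open>A k\<close> of antennas inside a common finite type \<open>'m\<close>, i.e. M_k = card (A k).
  An M_k \<times> M_k matrix is a matrix over \<open>'m\<close> that vanishes outside \<open>A k \<times> A k\<close>, and an N \<times> M_k
  matrix is one whose columns outside \<open>A k\<close> vanish. Products, adjoints, traces, Frobenius norms
  and positive semidefiniteness are the same for a matrix and for its zero-padded version.
\<close>

type_synonym ('k, 'm) profile = "complex^'m^'m^'k"
type_synonym ('k, 'n, 'm) channel = "complex^'m^'n^'k"

definition adj :: "complex^'m^'n \<Rightarrow> complex^'n^'m" where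
  "adj B = (\<chi> i j. cnj (B $ j $ i))"

definition hermitian :: "complex^'m^'m \<Rightarrow> bool" where
  "hermitian B \<longleftrightarrow> adj B = B"

text \<open>To be used for Hermitian \<open>B\<close>, for which the quadratic form is real.\<close>

definition psd :: "complex^'m^'m \<Rightarrow> bool" where
  "psd B \<longleftrightarrow> (\<forall>v. Re (\<Sum>i\<in>UNIV. cnj (v $ i) * (B *v v) $ i) \<ge> 0)"

definition supported :: "'r set \<Rightarrow> 'c set \<Rightarrow> complex^'c^'r \<Rightarrow> bool" where
  "supported R C B \<longleftrightarrow> (\<forall>i j. B $ i $ j \<noteq> 0 \<longrightarrow> i \<in> R \<and> j \<in> C)"

text \<open>
  Powers and exponential in the algebra of matrices supported on \<open>S \<times> S\<close>. Its unit is the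
  identity matrix on \<open>S\<close>, so \<open>mexp S B\<close> is the zero-padded exponential of the \<open>S \<times> S\<close> block
  of \<open>B\<close>. (The operations \<open>*\<close> and \<open>^\<close> of type \<open>vec\<close> are componentwise and cannot be used.)
\<close>

primrec mpow :: "'m set \<Rightarrow> complex^'m^'m \<Rightarrow> nat \<Rightarrow> complex^'m^'m" where
  "mpow S B 0 = (\<chi> i j. if i = j \<and> i \<in> S then 1 else 0)"
| "mpow S B (Suc n) = B ** mpow S B n"

definition mexp :: "'m set \<Rightarrow> complex^'m^'m \<Rightarrow> complex^'m^'m" where
  "mexp S B = (\<Sum>n. (1 / fact n) *\<^sub>R mpow S B n)"

definition exp_normalized :: "'m set \<Rightarrow> complex^'m^'m \<Rightarrow> complex^'m^'m" where
  "exp_normalized S B = (\<chi> i j. mexp S B $ i $ j / trace (mexp S B))"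


section \<open>The rate maximization game\<close>

text \<open>\<open>L\<close> is the stationary law of the channels.\<close>

definition action_set :: "('k \<Rightarrow> 'm set) \<Rightarrow> 'k \<Rightarrow> (complex^'m^'m) set" where
  "action_set A k = {X. supported (A k) (A k) X \<and> hermitian X \<and> psd X \<and> trace X = 1}"

definition W_on :: "'k::finite set \<Rightarrow> ('k \<Rightarrow> real) \<Rightarrow> ('k, 'm::finite) profile
    \<Rightarrow> ('k, 'n::finite, 'm) channel \<Rightarrow> complex^'n^'n" where
  "W_on U P X H = mat 1 + (\<Sum>l\<in>U. P l *\<^sub>R (H $ l ** X $ l ** adj (H $ l)))"

abbreviation W :: "('k::finite \<Rightarrow> real) \<Rightarrow> ('k, 'm::finite) profile
    \<Rightarrow> ('k, 'n::finite, 'm) channel \<Rightarrow> complex^'n^'n" where "W \<equiv> W_on UNIV"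

text \<open>The determinants are those of positive definite matrices, hence real and positive.\<close>

definition utility :: "('k::finite \<Rightarrow> real) \<Rightarrow> ('k, 'n::finite, 'm::finite) channel measure \<Rightarrow> 'k
    \<Rightarrow> ('k, 'm) profile \<Rightarrow> real" where
  "utility P L k X =
     (\<integral>H. ln (Re (det (W P X H))) - ln (Re (det (W_on (UNIV - {k}) P X H))) \<partial>L)"

definition deviate :: "('k::finite, 'm::finite) profile \<Rightarrow> 'k \<Rightarrow> complex^'m^'m \<Rightarrow> ('k, 'm) profile" where
  "deviate X k Z = (\<chi> l. if l = k then Z else X $ l)"

definition nash_equilibrium :: "('k::finite \<Rightarrow> 'm::finite set) \<Rightarrow> ('k \<Rightarrow> real)
    \<Rightarrow> ('k, 'n::finite, 'm) channel measure \<Rightarrow> ('k, 'm) profile \<Rightarrow> bool" where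
  "nash_equilibrium A P L X \<longleftrightarrow>
     (\<forall>k. X $ k \<in> action_set A k) \<and>
     (\<forall>k. \<forall>Z\<in>action_set A k. utility P L k X \<ge> utility P L k (deviate X k Z))"

definition V_mean :: "('k::finite \<Rightarrow> real) \<Rightarrow> ('k, 'n::finite, 'm::finite) channel measure \<Rightarrow> 'k
    \<Rightarrow> ('k, 'm) profile \<Rightarrow> complex^'m^'m" where
  "V_mean P L k X = (\<integral>H. adj (H $ k) ** matrix_inv (W P X H) ** H $ k \<partial>L)"


section \<open>The channel process\<close>

definition path_space :: "(real \<Rightarrow> 'h::topological_space) measure" where
  "path_space = PiM {0..} (\<lambda>_. borel)"

definition path_law :: "'w measure \<Rightarrow> (real \<Rightarrow> 'w \<Rightarrow> 'h::topological_space)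
    \<Rightarrow> (real \<Rightarrow> 'h) measure" where
  "path_law M H = distr M path_space (\<lambda>w. \<lambda>t\<in>{0..}. H t w)"

definition time_shift :: "real \<Rightarrow> (real \<Rightarrow> 'h) \<Rightarrow> real \<Rightarrow> 'h" where
  "time_shift s f = (\<lambda>t\<in>{0..}. f (t + s))"

text \<open>
  Ergodicity refers to events that are invariant up to null sets under every shift: an event of
  \<^const>\<open>path_space\<close> only depends on countably many coordinates, so the strictly shift-invariant
  events are trivial for any process in continuous time.
\<close>

definition stationary_ergodic :: "'w measure \<Rightarrow> (real \<Rightarrow> 'w \<Rightarrow> 'h::topological_space) \<Rightarrow> bool"
  where
  "stationary_ergodic M H \<longleftrightarrow>
     (\<forall>t\<ge>0. H t \<in> borel_measurable M) \<and>
     (\<forall>s\<ge>0. distr (path_law M H) path_space (time_shift s) = path_law M H) \<and>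
     (\<forall>E\<in>sets path_space.
        (\<forall>s\<ge>0. AE f in path_law M H. f \<in> E \<longleftrightarrow> time_shift s f \<in> E) \<longrightarrow>
        measure (path_law M H) E \<in> {0, 1})"

definition channel_process :: "('k::finite \<Rightarrow> 'm::finite set) \<Rightarrow> ('k, 'n::finite, 'm) channel measure
    \<Rightarrow> 'w measure \<Rightarrow> (real \<Rightarrow> 'w \<Rightarrow> ('k, 'n, 'm) channel) \<Rightarrow> bool" where
  "channel_process A L M H \<longleftrightarrow>
     (\<forall>t\<ge>0. \<forall>w\<in>space M. \<forall>k. supported UNIV (A k) (H t w $ k)) \<and>
     (\<exists>B. AE w in M. \<forall>t\<ge>0. norm (H t w) \<le> B) \<and>
     stationary_ergodic M H \<and>
     (\<forall>t\<ge>0. distr M borel (H t) = L)"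


section \<open>Timers and update epochs\<close>

text \<open>
  \<open>T0 i w\<close> and \<open>T k j w\<close> (with \<open>i, j \<ge> 1\<close>; index 0 is unused) are the times of the ticks of the
  receiver and of user \<open>k\<close>.
\<close>

definition timer :: "'w measure \<Rightarrow> (nat \<Rightarrow> 'w \<Rightarrow> real) \<Rightarrow> bool" where
  "timer M T \<longleftrightarrow>
     (\<forall>j\<ge>1. T j \<in> borel_measurable M) \<and>
     (\<forall>w\<in>space M. strict_mono_on {1..} (\<lambda>j. T j w) \<and> (\<forall>j\<ge>1. T j w \<ge> 0))"

definition positive_finite_rate :: "'w measure \<Rightarrow> (nat \<Rightarrow> 'w \<Rightarrow> real) \<Rightarrow> bool" where
  "positive_finite_rate M T \<longleftrightarrow>
     (AE w in M. \<exists>c>0. (\<lambda>j. T j w / real j) \<longlonglongrightarrow> c)"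

text \<open>The time of the latest broadcast available at time \<open>t\<close> (a maximum, as the ticks of the
  receiver do not accumulate when its timer has a positive rate).\<close>

definition latest_broadcast :: "(nat \<Rightarrow> 'w \<Rightarrow> real) \<Rightarrow> real \<Rightarrow> 'w \<Rightarrow> real" where
  "latest_broadcast T0 t w = Sup {T0 i w | i. i \<ge> 1 \<and> T0 i w \<le> t}"

definition update_times :: "('k \<Rightarrow> nat \<Rightarrow> 'w \<Rightarrow> real) \<Rightarrow> 'w \<Rightarrow> real set" where
  "update_times T w = {T k j w | k j. j \<ge> 1}"

text \<open>The epochs are numbered from 1; as the ticks are nonnegative, the value -1 at index 0 makes
  epoch 1 the first update. A union of finitely many increasing sequences is well-ordered, so
  the infimum is attained.\<close>

primrec epoch :: "('k \<Rightarrow> nat \<Rightarrow> 'w \<Rightarrow> real) \<Rightarrow> nat \<Rightarrow> 'w \<Rightarrow> real" where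
  "epoch T 0 w = -1"
| "epoch T (Suc n) w = Inf {t \<in> update_times T w. epoch T n w < t}"

definition update_set :: "('k \<Rightarrow> nat \<Rightarrow> 'w \<Rightarrow> real) \<Rightarrow> nat \<Rightarrow> 'w \<Rightarrow> 'k set" where
  "update_set T n w = {k. \<exists>j\<ge>1. T k j w = epoch T n w}"

text \<open>The number of epochs before \<open>n\<close> whose updates are not reflected in the latest broadcast.\<close>

definition delay :: "(nat \<Rightarrow> 'w \<Rightarrow> real) \<Rightarrow> ('k \<Rightarrow> nat \<Rightarrow> 'w \<Rightarrow> real) \<Rightarrow> nat \<Rightarrow> 'w \<Rightarrow> nat" where
  "delay T0 T n w =
     card {m. 1 \<le> m \<and> m < n \<and> latest_broadcast T0 (epoch T n w) w \<le> epoch T m w}"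

definition bounded_delays :: "'w measure \<Rightarrow> (nat \<Rightarrow> 'w \<Rightarrow> real) \<Rightarrow> ('k \<Rightarrow> nat \<Rightarrow> 'w \<Rightarrow> real)
    \<Rightarrow> bool" where
  "bounded_delays M T0 T \<longleftrightarrow> (AE w in M. \<exists>D. \<forall>n\<ge>1. delay T0 T n w \<le> D)"


section \<open>Asynchronous exponential learning\<close>

text \<open>
  \<open>Y k j w\<close> is the score matrix of user \<open>k\<close> after \<open>j\<close> ticks of their timer.
  \<open>profile_before A T Y t w\<close> is the profile in force just before time \<open>t\<close>. If the receiver and
  some users tick simultaneously, the receiver measures the profile in force before these
  updates, and the users already have this broadcast when they update.
\<close>

definition profile_before :: "('k::finite \<Rightarrow> 'm::finite set) \<Rightarrow> ('k \<Rightarrow> nat \<Rightarrow> 'w \<Rightarrow> real)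
    \<Rightarrow> ('k \<Rightarrow> nat \<Rightarrow> 'w \<Rightarrow> complex^'m^'m) \<Rightarrow> real \<Rightarrow> 'w \<Rightarrow> ('k, 'm) profile" where
  "profile_before A T Y t w =
     (\<chi> k. exp_normalized (A k) (Y k (card {j. j \<ge> 1 \<and> T k j w < t}) w))"

definition iterate :: "('k::finite \<Rightarrow> 'm::finite set) \<Rightarrow> ('k \<Rightarrow> nat \<Rightarrow> 'w \<Rightarrow> real)
    \<Rightarrow> ('k \<Rightarrow> nat \<Rightarrow> 'w \<Rightarrow> complex^'m^'m) \<Rightarrow> nat \<Rightarrow> 'w \<Rightarrow> ('k, 'm) profile" where
  "iterate A T Y n w = profile_before A T Y (epoch T n w) w"

definition broadcast :: "('k::finite \<Rightarrow> 'm::finite set) \<Rightarrow> ('k \<Rightarrow> real)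
    \<Rightarrow> (real \<Rightarrow> 'w \<Rightarrow> ('k, 'n::finite, 'm) channel) \<Rightarrow> ('k \<Rightarrow> nat \<Rightarrow> 'w \<Rightarrow> real)
    \<Rightarrow> ('k \<Rightarrow> nat \<Rightarrow> 'w \<Rightarrow> complex^'m^'m) \<Rightarrow> real \<Rightarrow> 'w \<Rightarrow> complex^'n^'n" where
  "broadcast A P H T Y s w = W P (profile_before A T Y s w) (H s w)"

definition V_hat :: "('k::finite \<Rightarrow> 'm::finite set) \<Rightarrow> ('k \<Rightarrow> real)
    \<Rightarrow> (real \<Rightarrow> 'w \<Rightarrow> ('k, 'n::finite, 'm) channel) \<Rightarrow> (nat \<Rightarrow> 'w \<Rightarrow> real) \<Rightarrow> ('k \<Rightarrow> nat \<Rightarrow> 'w \<Rightarrow> real)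
    \<Rightarrow> ('k \<Rightarrow> nat \<Rightarrow> 'w \<Rightarrow> complex^'m^'m) \<Rightarrow> 'k \<Rightarrow> real \<Rightarrow> 'w \<Rightarrow> complex^'m^'m" where
  "V_hat A P H T0 T Y k t w =
     adj (H t w $ k) ** matrix_inv (broadcast A P H T Y (latest_broadcast T0 t w) w)
       ** H t w $ k"

definition learning_run :: "('k::finite \<Rightarrow> 'm::finite set) \<Rightarrow> ('k \<Rightarrow> real) \<Rightarrow> real \<Rightarrow> 'w measure
    \<Rightarrow> (real \<Rightarrow> 'w \<Rightarrow> ('k, 'n::finite, 'm) channel) \<Rightarrow> (nat \<Rightarrow> 'w \<Rightarrow> real) \<Rightarrow> ('k \<Rightarrow> nat \<Rightarrow> 'w \<Rightarrow> real)
    \<Rightarrow> ('k \<Rightarrow> complex^'m^'m) \<Rightarrow> ('k \<Rightarrow> nat \<Rightarrow> 'w \<Rightarrow> complex^'m^'m) \<Rightarrow> bool" where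
  "learning_run A P \<tau> M H T0 T Y0 Y \<longleftrightarrow>
     (\<forall>k. hermitian (Y0 k) \<and> supported (A k) (A k) (Y0 k)) \<and>
     (\<forall>k j. Y k j \<in> borel_measurable M) \<and>
     (\<forall>w\<in>space M. \<forall>k.
        T0 1 w \<le> T k 1 w \<and>
        Y k 0 w = Y0 k \<and>
        (\<forall>j\<ge>1. Y k j w = Y k (j - 1) w + (1 / (real j + 1)) *\<^sub>R
           (V_hat A P H T0 T Y k (T k j w) w - \<tau> *\<^sub>R Y k (j - 1) w)))"


section \<open>Unbiased gradient estimates\<close>

text \<open>The history at epoch \<open>n\<close> consists of the iterates, update sets and delays of the epochs
  \<open>1, \<dots>, n\<close>.\<close>

definition history :: "('k::finite \<Rightarrow> 'm::finite set) \<Rightarrow> 'w measure \<Rightarrow> (nat \<Rightarrow> 'w \<Rightarrow> real)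
    \<Rightarrow> ('k \<Rightarrow> nat \<Rightarrow> 'w \<Rightarrow> real) \<Rightarrow> ('k \<Rightarrow> nat \<Rightarrow> 'w \<Rightarrow> complex^'m^'m) \<Rightarrow> nat \<Rightarrow> 'w measure" where
  "history A M T0 T Y n =
     vimage_algebra (space M)
       (\<lambda>w. \<lambda>m\<in>{1..n}. (iterate A T Y m w, update_set T m w, delay T0 T m w))
       (PiM {1..n} (\<lambda>_. borel \<Otimes>\<^sub>M count_space UNIV \<Otimes>\<^sub>M count_space UNIV))"

definition matrix_cond_exp :: "'w measure \<Rightarrow> 'w measure \<Rightarrow> ('w \<Rightarrow> complex^'m^'m)
    \<Rightarrow> 'w \<Rightarrow> complex^'m^'m" where
  "matrix_cond_exp M F Z w =
     (\<chi> i j. Complex (real_cond_exp M F (\<lambda>w. Re (Z w $ i $ j)) w)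
                    (real_cond_exp M F (\<lambda>w. Im (Z w $ i $ j)) w))"

text \<open>An estimate only exists for the users updating at epoch \<open>n\<close>; it is set to 0 for the
  others.\<close>

definition V_hat_epoch :: "('k::finite \<Rightarrow> 'm::finite set) \<Rightarrow> ('k \<Rightarrow> real)
    \<Rightarrow> (real \<Rightarrow> 'w \<Rightarrow> ('k, 'n::finite, 'm) channel) \<Rightarrow> (nat \<Rightarrow> 'w \<Rightarrow> real) \<Rightarrow> ('k \<Rightarrow> nat \<Rightarrow> 'w \<Rightarrow> real)
    \<Rightarrow> ('k \<Rightarrow> nat \<Rightarrow> 'w \<Rightarrow> complex^'m^'m) \<Rightarrow> 'k \<Rightarrow> nat \<Rightarrow> 'w \<Rightarrow> complex^'m^'m" where
  "V_hat_epoch A P H T0 T Y k n w =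
     (if k \<in> update_set T n w then V_hat A P H T0 T Y k (epoch T n w) w else 0)"

definition unbiased_estimates :: "('k::finite \<Rightarrow> 'm::finite set) \<Rightarrow> ('k \<Rightarrow> real)
    \<Rightarrow> ('k, 'n::finite, 'm) channel measure \<Rightarrow> 'w measure \<Rightarrow> (real \<Rightarrow> 'w \<Rightarrow> ('k, 'n, 'm) channel)
    \<Rightarrow> (nat \<Rightarrow> 'w \<Rightarrow> real) \<Rightarrow> ('k \<Rightarrow> nat \<Rightarrow> 'w \<Rightarrow> real)
    \<Rightarrow> ('k \<Rightarrow> nat \<Rightarrow> 'w \<Rightarrow> complex^'m^'m) \<Rightarrow> bool" where
  "unbiased_estimates A P L M H T0 T Y \<longleftrightarrow>
     (\<forall>n\<ge>1. \<forall>k. AE w in M. k \<in> update_set T n w \<longrightarrow>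
        matrix_cond_exp M (history A M T0 T Y n) (V_hat_epoch A P H T0 T Y k n) w
          = V_mean P L k (iterate A T Y (n - delay T0 T n w) w))"

end

theory Submission
  imports Defs "HOL-Library.Discrete_Functions"
begin

text \<open>
  The expected log-determinant \<open>rate X\<close> is concave on the profiles, its partial gradient in \<open>X\<^sub>k\<close> is
  \<open>P\<^sub>k V\<^sub>k(X)\<close>, and the utility of user \<open>k\<close> differs from it by a term that does not depend on \<open>X\<^sub>k\<close>.
  Hence its maximizers are Nash equilibria (lemmas \<open>rate_concave\<close> and \<open>nash_if_maximizes_rate\<close>).

  If the updates were synchronous and noiseless, the scores would follow \<open>Y' = V(X) - \<tau> Y\<close>. A rest
  point is a profile with \<open>X\<^sub>k\<close> proportional to \<open>exp(V\<^sub>k(X) / \<tau>)\<close>. Such an entropic equilibrium exists by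
  Brouwer's theorem, and by the variational principle for the free energy \<open>ln tr exp Y\<close> it maximizes
  the rate up to \<open>\<tau> \<Sum>\<^sub>k P\<^sub>k ln M\<^sub>k\<close>. By compactness, entropic equilibria approach the maximizers as
  \<open>\<tau>\<close> tends to 0 (\<open>entropic_equilibria_approach_nash\<close>). It remains to show that for each \<open>\<tau>\<close> the
  iterates converge almost surely to an entropic equilibrium that is fixed in advance.

  With the step sizes \<open>1 / (j + 1)\<close>, a user whose timer has a positive finite rate spends a total
  step of about \<open>ln a\<close> between the times \<open>t\<close> and \<open>a t\<close>, whatever the rate
  (\<open>window_weight_tendsto\<close>). So all users move at the same speed on the logarithmic time scale,
  and over a short window the scores follow the dynamics above up to a small relative error
  (\<open>window_follows_drift\<close>); a bounded delay only causes a vanishing error, as single updates become small. The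
  Bregman divergence of the free energy between the scores and those of the entropic equilibrium
  decays at rate \<open>\<tau>\<close> along the dynamics, because the gradient field of a concave function is
  monotone. This decay survives the errors (\<open>lyapunov_tendsto_0\<close>, \<open>iterates_converge\<close>).

  The noise is removed by a law of large numbers. The profiles only determine the scores up to
  multiples of the identity, but these do not influence the profiles. The traceless part of the
  scores is bounded and is a measurable function of the profile, so the traceless errors of the
  gradient estimates are bounded martingale differences with respect to the history, hence
  orthogonal, and their averages over the ticks of a user vanish (\<open>noise_term_adapted\<close>,
  \<open>AE_tick_noise_average\<close>). Summation by parts carries this over to the windows
  (\<open>abel_window_bound\<close>).
\<close>


section \<open>Hermitian matrices and their spectral decomposition\<close>

text \<open>The unqualified name refers to a fact on Euclidean spaces.\<close>

lemmas vec_norm_nth_le = Finite_Cartesian_Product.norm_nth_le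

definition cinner :: "complex^'n \<Rightarrow> complex^'n \<Rightarrow> complex" where
  "cinner u v = (\<Sum>i\<in>UNIV. cnj (u $ i) * v $ i)"

definition ketbra :: "complex^'n \<Rightarrow> complex^'m \<Rightarrow> complex^'m^'n" where
  "ketbra u v = (\<chi> a b. u $ a * cnj (v $ b))"

lemma Re_cinner: "Re (cinner u v) = u \<bullet> v"
  by (simp add: cinner_def inner_vec_def inner_complex_def)

lemma psd_iff: "psd B \<longleftrightarrow> (\<forall>v. v \<bullet> (B *v v) \<ge> 0)"
  by (simp add: psd_def cinner_def flip: Re_cinner)

lemma cinner_commute: "cinner v u = cnj (cinner u v)"
  by (simp add: cinner_def mult.commute)

lemma cinner_self: "cinner u u = of_real ((norm u)\<^sup>2)"
proof -
  have "Im (cinner u u) = 0"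
    by (simp add: cinner_def)
  moreover have "Re (cinner u u) = (norm u)\<^sup>2"
    by (simp add: Re_cinner power2_norm_eq_inner)
  ultimately show ?thesis by (simp add: complex_eq_iff)
qed

lemma cinner_diff_right: "cinner u (v - w) = cinner u v - cinner u w"
  and cinner_add_right: "cinner u (v + w) = cinner u v + cinner u w"
  and cinner_scale_right: "cinner u (c *s v) = c * cinner u v"
  and cinner_scaleR_right: "cinner u (r *\<^sub>R v) = r *\<^sub>R cinner u v"
  and cinner_zero_right: "cinner u 0 = 0"
  by (simp_all add: cinner_def algebra_simps sum_subtractf sum.distrib sum_distrib_left scaleR_sum_right)

lemma cinner_adj: "cinner (adj B *v u) v = cinner u (B *v v)"
proof -
  have "cinner (adj B *v u) v = (\<Sum>i\<in>UNIV. \<Sum>j\<in>UNIV. B $ j $ i * cnj (u $ j) * v $ i)"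
    by (simp add: cinner_def adj_def matrix_vector_mult_def sum_distrib_right)
  also have "\<dots> = (\<Sum>j\<in>UNIV. \<Sum>i\<in>UNIV. B $ j $ i * cnj (u $ j) * v $ i)"
    by (rule sum.swap)
  also have "\<dots> = cinner u (B *v v)"
    by (simp add: cinner_def matrix_vector_mult_def sum_distrib_left mult_ac)
  finally show ?thesis .
qed

lemma inner_adj: "(adj B *v u) \<bullet> v = u \<bullet> (B *v v)"
  using cinner_adj[of B u v] by (simp flip: Re_cinner)

lemma adj_mult: "adj (A ** B) = adj B ** adj A"
  by (simp add: vec_eq_iff adj_def matrix_matrix_mult_def mult.commute)

lemma adj_adj [simp]: "adj (adj A) = A"
  by (simp add: vec_eq_iff adj_def)

lemma adj_add: "adj (A + B) = adj A + adj B"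
  and adj_diff: "adj (A - B) = adj A - adj B"
  and adj_scaleR: "adj (r *\<^sub>R A) = r *\<^sub>R adj A"
  and adj_zero [simp]: "adj 0 = 0"
  and adj_mat_1 [simp]: "adj (mat 1) = mat 1"
  by (simp_all add: vec_eq_iff adj_def mat_def)

lemma adj_sum: "adj (\<Sum>i\<in>I. f i) = (\<Sum>i\<in>I. adj (f i))"
  by (induct I rule: infinite_finite_induct) (auto simp: adj_add)

lemma norm_adj: "norm (adj B) = norm B"
proof -
  have "adj B \<bullet> adj B = B \<bullet> B"
    unfolding inner_vec_def adj_def inner_complex_def
    by simp (rule sum.swap)
  then show ?thesis by (simp add: norm_eq_sqrt_inner)
qed

lemma linear_adj: "linear adj"
  by (rule linearI) (simp_all add: adj_add adj_scaleR)

lemma bounded_bilinear_matrix_mult: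
  "bounded_bilinear (\<lambda>(A::complex^'m^'n) (B::complex^'l^'m). A ** B)"
  by (subst bilinear_conv_bounded_bilinear[symmetric])
    (auto simp: bilinear_def vec_eq_iff matrix_matrix_mult_def algebra_simps sum.distrib
      scaleR_sum_right intro!: linearI)

lemma bounded_bilinear_matrix_vector:
  "bounded_bilinear (\<lambda>(A::complex^'m^'n) (x::complex^'m). A *v x)"
  by (subst bilinear_conv_bounded_bilinear[symmetric])
    (auto simp: bilinear_def vec_eq_iff matrix_vector_mult_def algebra_simps sum.distrib
      scaleR_sum_right intro!: linearI)

interpretation mm: bounded_bilinear "\<lambda>(A::complex^'m^'n) (B::complex^'l^'m). A ** B"
  by (rule bounded_bilinear_matrix_mult)

interpretation mv: bounded_bilinear "\<lambda>(A::complex^'m^'n) (x::complex^'m). A *v x"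
  by (rule bounded_bilinear_matrix_vector)

lemmas matmul = mm.add_left mm.add_right mm.diff_left mm.diff_right mm.scaleR_left mm.scaleR_right
  mm.zero_left mm.zero_right
lemmas matmul_sum = mm.sum_left mm.sum_right
lemmas matvec = mv.add_left mv.add_right mv.diff_left mv.diff_right mv.scaleR_left mv.scaleR_right
  mv.zero_left mv.zero_right
lemmas matvec_sum = mv.sum_left mv.sum_right

lemma ketbra_mult: "ketbra u v ** ketbra x y = (\<chi> a b. cinner v x * ketbra u y $ a $ b)"
  by (simp add: vec_eq_iff ketbra_def matrix_matrix_mult_def cinner_def sum_distrib_left
      sum_distrib_right mult_ac)

lemma ketbra_vec: "ketbra u v *v x = cinner v x *s u"
  by (simp add: vec_eq_iff ketbra_def matrix_vector_mult_def cinner_def sum_distrib_left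
      sum_distrib_right mult_ac)

lemma matrix_ketbra: "B ** ketbra u v = ketbra (B *v u) v"
  by (simp add: vec_eq_iff ketbra_def matrix_matrix_mult_def matrix_vector_mult_def
      sum_distrib_left sum_distrib_right mult_ac)

lemma adj_ketbra: "adj (ketbra u v) = ketbra v u"
  by (simp add: vec_eq_iff ketbra_def adj_def mult.commute)

lemma trace_ketbra: "trace (ketbra u v) = cinner v u"
  by (simp add: trace_def ketbra_def cinner_def mult.commute)

lemma ketbra_scaleR: "ketbra (r *\<^sub>R u) v = r *\<^sub>R ketbra u v"
  by (simp add: vec_eq_iff ketbra_def)

lemma ketbra_inner: "ketbra u v \<bullet> G = Re (cinner u (G *v v))"
  by (simp add: ketbra_def inner_vec_def inner_complex_def cinner_def matrix_vector_mult_def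
      sum_distrib_left sum_distrib_right algebra_simps sum.distrib)

lemma supported_add: "supported R C A \<Longrightarrow> supported R C B \<Longrightarrow> supported R C (A + B)"
  and supported_scaleR: "supported R C A \<Longrightarrow> supported R C (r *\<^sub>R A)"
  and supported_zero: "supported R C 0"
  by (auto simp: supported_def) (metis add_0)+

lemma supported_sum: "(\<And>i. i \<in> I \<Longrightarrow> supported R C (f i)) \<Longrightarrow> supported R C (\<Sum>i\<in>I. f i)"
  by (induct I rule: infinite_finite_induct) (auto simp: supported_zero supported_add)

lemma hermitian_add: "hermitian A \<Longrightarrow> hermitian B \<Longrightarrow> hermitian (A + B)"
  and hermitian_scaleR: "hermitian A \<Longrightarrow> hermitian (r *\<^sub>R A)"
  and hermitian_zero: "hermitian 0"
  by (simp_all add: hermitian_def adj_add adj_diff adj_scaleR)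

lemma hermitian_sum: "(\<And>i. i \<in> I \<Longrightarrow> hermitian (f i)) \<Longrightarrow> hermitian (\<Sum>i\<in>I. f i)"
  by (induct I rule: infinite_finite_induct) (auto simp: hermitian_zero hermitian_add)

lemma hermitian_cinner: "hermitian B \<Longrightarrow> cinner (B *v u) v = cinner u (B *v v)"
  using cinner_adj[of B u v] by (simp add: hermitian_def)

lemma hermitian_inner: "hermitian B \<Longrightarrow> (B *v u) \<bullet> v = u \<bullet> (B *v v)"
  using inner_adj[of B u v] by (simp add: hermitian_def)

text \<open>A maximizer of the quadratic form on the unit sphere of an invariant subspace is an eigenvector,
  since the first variation vanishes there.\<close>

lemma eigenvector_in_invariant_subspace:
  fixes B :: "complex^'n^'n"
  assumes B: "hermitian B" and V: "subspace V" "\<And>v. v \<in> V \<Longrightarrow> B *v v \<in> V"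
    and nz: "v \<in> V" "v \<noteq> 0"
  obtains x l where "x \<in> V" "norm x = 1" "B *v x = l *\<^sub>R x"
proof -
  let ?K = "V \<inter> sphere 0 1"
  have "compact ?K"
    using V(1) by (intro closed_Int_compact closed_subspace) auto
  moreover have "(1 / norm v) *\<^sub>R v \<in> ?K"
    using nz V(1) by (auto simp: subspace_scale)
  moreover have "continuous_on ?K (\<lambda>x. x \<bullet> (B *v x))"
    by (intro continuous_intros bounded_bilinear.continuous_on[OF bounded_bilinear_matrix_vector])
  ultimately obtain x where x: "x \<in> ?K" and max: "\<And>y. y \<in> ?K \<Longrightarrow> y \<bullet> (B *v y) \<le> x \<bullet> (B *v x)"
    using continuous_attains_sup[of ?K "\<lambda>x. x \<bullet> (B *v x)"] by blast
  define l where "l = x \<bullet> (B *v x)"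
  have xx: "x \<bullet> x = 1" and xV: "x \<in> V" using x by (auto simp: dot_square_norm)
  have le: "y \<bullet> (B *v y) \<le> l * (y \<bullet> y)" if y: "y \<in> V" for y
  proof (cases "y = 0")
    case False
    have "(1 / norm y) *\<^sub>R y \<in> ?K" using False y V(1) by (auto simp: subspace_scale)
    from max[OF this] have "(y \<bullet> (B *v y)) / (norm y)\<^sup>2 \<le> l"
      by (simp add: matvec l_def power2_eq_square field_simps)
    then show ?thesis using False by (simp add: field_simps power2_norm_eq_inner)
  qed (simp add: matvec)
  define w where "w = B *v x - l *\<^sub>R x"
  have wV: "w \<in> V" unfolding w_def using V xV by (auto intro: subspace_diff subspace_scale)
  have "w \<bullet> w = 0"
  proof (rule ccontr)
    assume nw: "w \<bullet> w \<noteq> 0"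
    define q where "q = \<bar>w \<bullet> (B *v w)\<bar> + \<bar>l\<bar> * (w \<bullet> w)"
    have q: "q \<ge> 0" by (simp add: q_def)
    define t where "t = (w \<bullet> w) / (q + 1)"
    have ww: "w \<bullet> w > 0" using nw by (simp add: less_le)
    have t: "t > 0" using ww q by (simp add: t_def)
    have "x + t *\<^sub>R w \<in> V" using xV wV V(1) by (auto intro: subspace_add subspace_scale)
    from le[OF this]
    have "2 * t * (w \<bullet> (B *v x) - l * (w \<bullet> x)) + t\<^sup>2 * (w \<bullet> (B *v w) - l * (w \<bullet> w)) \<le> 0"
      using hermitian_inner[OF B, of w x] xx
      by (simp add: matvec inner_add inner_commute l_def algebra_simps power2_eq_square)
    moreover have "w \<bullet> (B *v x) - l * (w \<bullet> x) = w \<bullet> w"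
      unfolding w_def by (simp add: inner_diff)
    moreover have "t\<^sup>2 * (w \<bullet> (B *v w) - l * (w \<bullet> w)) \<ge> t\<^sup>2 * (- q)"
    proof (rule mult_left_mono)
      have "l * (w \<bullet> w) \<le> \<bar>l\<bar> * (w \<bullet> w)" by (rule mult_right_mono) auto
      then show "- q \<le> w \<bullet> (B *v w) - l * (w \<bullet> w)" unfolding q_def by linarith
    qed simp
    ultimately have "2 * t * (w \<bullet> w) \<le> t\<^sup>2 * q" by simp
    then have "2 * (w \<bullet> w) \<le> t * q" using t by (simp add: power2_eq_square)
    moreover have "t * q \<le> w \<bullet> w" using q ww by (simp add: t_def field_simps)
    ultimately show False using ww by linarith
  qed
  then have "B *v x = l *\<^sub>R x" by (simp add: w_def)
  then show ?thesis using that[of x l] x by auto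
qed

definition orthonormal_eigenset :: "'n set \<Rightarrow> complex^'n^'n \<Rightarrow> (complex^'n) set \<Rightarrow> bool" where
  "orthonormal_eigenset S B E \<longleftrightarrow>
     (\<forall>u\<in>E. \<forall>v\<in>E. cinner u v = (if u = v then 1 else 0)) \<and>
     (\<forall>u\<in>E. (\<forall>a. a \<notin> S \<longrightarrow> u $ a = 0) \<and> (\<exists>l::real. B *v u = l *\<^sub>R u))"

lemma supported_mult_vec: "supported R C B \<Longrightarrow> a \<notin> R \<Longrightarrow> (B *v v) $ a = 0"
  unfolding supported_def matrix_vector_mult_def by (auto intro!: sum.neutral) blast

text \<open>The vectors supported on \<open>S\<close> that are orthogonal to all members of \<open>E\<close> form a subspace that
  is invariant under the Hermitian matrix, and it is nonzero by counting equations.\<close>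

lemma orthonormal_eigenset_extend:
  fixes B :: "complex^'n^'n"
  assumes B: "hermitian B" "supported S S B"
    and E: "orthonormal_eigenset S B E" "finite E" "card E < card S"
  obtains x where "x \<notin> E" "orthonormal_eigenset S B (insert x E)"
proof -
  define V where "V = {v. (\<forall>a. a \<notin> S \<longrightarrow> v $ a = 0) \<and> (\<forall>e\<in>E. cinner e v = 0)}"
  have sub: "subspace V"
    by (auto simp: subspace_def V_def cinner_zero_right cinner_add_right cinner_scaleR_right)
  have inv: "B *v v \<in> V" if v: "v \<in> V" for v
  proof -
    have "cinner e (B *v v) = 0" if e: "e \<in> E" for e
    proof -
      obtain l :: real where "B *v e = l *\<^sub>R e"
        using E(1) e unfolding orthonormal_eigenset_def by blast
      then have "cinner (B *v e) v = cnj (l *\<^sub>R cinner v e)"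
        by (subst cinner_commute) (simp add: cinner_scaleR_right)
      also have "cinner v e = 0"
        using v e by (subst cinner_commute) (simp add: V_def)
      finally show ?thesis by (simp add: hermitian_cinner[OF B(1)])
    qed
    then show ?thesis using supported_mult_vec[OF B(2)] by (simp add: V_def)
  qed
  \<comment> \<open>A square homogeneous system with a zero row has a nonzero solution; its rows are the
    vectors of \<open>E\<close>, spread over some of the indices in \<open>S\<close>, and the unit vectors outside \<open>S\<close>.\<close>
  obtain g where g: "g ` E \<subseteq> S" "inj_on g E"
    using card_le_inj[OF E(2), of S] E(3) by auto
  obtain a0 where a0: "a0 \<in> S" "a0 \<notin> g ` E"
    using E(3) card_image[OF g(2)] g(1) by (metis finite subsetI subset_antisym less_irrefl)
  define C :: "complex^'n^'n" where
    "C = (\<chi> a b. if a \<in> g ` E then cnj (inv_into E g a $ b)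
                 else if a \<notin> S then (if a = b then 1 else 0) else 0)"
  have Cv: "(C *v v) $ a = (if a \<in> g ` E then cinner (inv_into E g a) v
                            else if a \<notin> S then v $ a else 0)" for v a
  proof -
    have "(\<Sum>b\<in>UNIV. (if a = b then 1 else 0) * v $ b) = v $ a"
      by (simp add: if_distrib[of "\<lambda>x. x * _"] cong: if_cong)
    then show ?thesis
      by (simp add: C_def matrix_vector_mult_def cinner_def)
  qed
  have "\<not> surj (\<lambda>v. C *v v)"
  proof
    assume "surj (\<lambda>v. C *v v)"
    then obtain v where "C *v v = axis a0 1" by (metis surjD)
    then show False using Cv[of v a0] a0 by (simp add: axis_def)
  qed
  then have "\<not> (\<forall>v. C *v v = 0 \<longrightarrow> v = 0)"
    using matrix_right_invertible_surjective[of C] matrix_left_invertible_ker[of C]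
      matrix_left_right_inverse by blast
  then obtain v where v: "C *v v = 0" "v \<noteq> 0" by blast
  have "v \<in> V"
  proof -
    have "v $ a = 0" if "a \<notin> S" for a
    proof -
      have "a \<notin> g ` E" using that g(1) by blast
      then show ?thesis using that Cv[of v a] by (simp add: v(1))
    qed
    moreover have "cinner e v = 0" if "e \<in> E" for e
      using that Cv[of v "g e"] v(1) g(2) by simp
    ultimately show ?thesis by (simp add: V_def)
  qed
  then obtain x l where x: "x \<in> V" "norm x = 1" "B *v x = l *\<^sub>R x"
    using eigenvector_in_invariant_subspace[OF B(1) sub inv _ v(2)] by blast
  have xx: "cinner x x = 1" by (simp add: cinner_self x(2))
  have xe: "cinner e x = 0" "cinner x e = 0" if "e \<in> E" for e
    using that x(1) cinner_commute[of x e] by (auto simp: V_def)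
  have "x \<notin> E" using xx xe by fastforce
  moreover have "orthonormal_eigenset S B (insert x E)"
    using E(1) xx xe x \<open>x \<notin> E\<close> unfolding orthonormal_eigenset_def V_def by auto
  ultimately show ?thesis using that by blast
qed

text \<open>An orthonormal basis of the vectors supported on \<open>S\<close>, indexed by \<open>S\<close> itself to avoid
  enumerations. Completeness follows from orthonormality by counting; it is part of the definition
  because most computations start from it.\<close>

definition onb :: "'n set \<Rightarrow> ('n \<Rightarrow> complex^'n) \<Rightarrow> bool" where
  "onb S u \<longleftrightarrow> (\<forall>i\<in>S. \<forall>a. a \<notin> S \<longrightarrow> u i $ a = 0) \<and>
     (\<forall>i\<in>S. \<forall>j\<in>S. cinner (u i) (u j) = (if i = j then 1 else 0)) \<and>
     (\<Sum>i\<in>S. ketbra (u i) (u i)) = mpow S 0 0"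

text \<open>The functional calculus: for \<open>B = specmat S u d\<close>, the powers and the exponential of \<open>B\<close> arise by
  applying the same function to every eigenvalue \<open>d i\<close>.\<close>

definition specmat :: "'n set \<Rightarrow> ('n \<Rightarrow> complex^'n) \<Rightarrow> ('n \<Rightarrow> real) \<Rightarrow> complex^'n^'n" where
  "specmat S u d = (\<Sum>i\<in>S. d i *\<^sub>R ketbra (u i) (u i))"

lemma supported_mpow_0: "supported R S B \<Longrightarrow> B ** mpow S G 0 = B"
proof -
  assume "supported R S B"
  moreover have "(\<Sum>k\<in>UNIV. B $ i $ k * (if k = j \<and> k \<in> S then 1 else 0)) = (if j \<in> S then B $ i $ j else 0)" for i j
  proof -
    have "(\<Sum>k\<in>UNIV. B $ i $ k * (if k = j \<and> k \<in> S then 1 else 0)) = (\<Sum>k\<in>UNIV. if k = j then (if j \<in> S then B $ i $ j else 0) else 0)"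
      by (rule sum.cong) auto
    then show ?thesis by simp
  qed
  ultimately show ?thesis
    by (auto simp: vec_eq_iff matrix_matrix_mult_def supported_def)
qed

lemma orthonormal_complete:
  fixes u :: "'n \<Rightarrow> complex^'n"
  assumes supp: "\<And>i a. i \<in> S \<Longrightarrow> a \<notin> S \<Longrightarrow> u i $ a = 0"
    and orth: "\<And>i j. i \<in> S \<Longrightarrow> j \<in> S \<Longrightarrow> cinner (u i) (u j) = (if i = j then 1 else 0)"
  shows "onb S u"
proof -
  \<comment> \<open>Complete the family to a square unitary matrix by the unit vectors outside \<open>S\<close>.\<close>
  define x where "x i = (if i \<in> S then u i else axis i 1)" for i
  define U :: "complex^'n^'n" where "U = (\<chi> a i. x i $ a)"
  have axis_right: "cinner v (axis j 1) = cnj (v $ j)" for v :: "complex^'n" and j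
  proof -
    have "cinner v (axis j 1) = (\<Sum>k\<in>UNIV. if k = j then cnj (v $ j) else 0)"
      unfolding cinner_def by (rule sum.cong) (auto simp: axis_def)
    then show ?thesis by simp
  qed
  have axis_left: "cinner (axis j 1) v = v $ j" for v :: "complex^'n" and j
    by (subst cinner_commute) (simp add: axis_right)
  have ox: "cinner (x i) (x j) = (if i = j then 1 else 0)" for i j
    using orth[of i j] supp[of i j] supp[of j i]
    by (auto simp: x_def axis_right axis_left) (auto simp: axis_def)
  have "adj U ** U = mat 1"
    using ox by (simp add: vec_eq_iff matrix_matrix_mult_def adj_def U_def cinner_def mat_def)
  then have "U ** adj U = mat 1" using matrix_left_right_inverse by blast
  then have full: "(\<Sum>i\<in>UNIV. x i $ a * cnj (x i $ b)) = (if a = b then 1 else 0)" for a b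
    by (simp add: vec_eq_iff matrix_matrix_mult_def adj_def U_def mat_def)
  have "(\<Sum>i\<in>S. u i $ a * cnj (u i $ b)) = (if a = b \<and> a \<in> S then 1 else 0)" for a b
  proof -
    have "(\<Sum>i\<in>UNIV. x i $ a * cnj (x i $ b)) =
        (\<Sum>i\<in>S. x i $ a * cnj (x i $ b)) + (\<Sum>i\<in>UNIV - S. x i $ a * cnj (x i $ b))"
      by (subst sum.subset_diff[of S UNIV]) auto
    moreover have "(\<Sum>i\<in>S. x i $ a * cnj (x i $ b)) = (\<Sum>i\<in>S. u i $ a * cnj (u i $ b))"
      by (rule sum.cong) (auto simp: x_def)
    moreover have "(\<Sum>i\<in>UNIV - S. x i $ a * cnj (x i $ b)) = (\<Sum>i\<in>UNIV - S. if i = a then (if a = b then 1 else 0) else 0)"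
      by (rule sum.cong) (auto simp: x_def axis_def)
    moreover have "\<dots> = (if a = b \<and> a \<notin> S then 1 else 0)" by (simp add: sum.delta)
    ultimately show ?thesis using full[of a b] by (auto split: if_splits)
  qed
  then have "(\<Sum>i\<in>S. ketbra (u i) (u i)) = mpow S 0 0"
    by (simp add: vec_eq_iff ketbra_def)
  then show ?thesis using supp orth by (auto simp: onb_def)
qed

text \<open>Orthonormal sets of eigenvectors can be extended until they have as many members as \<open>S\<close>.\<close>

theorem spectral_decomposition:
  fixes B :: "complex^'n^'n"
  assumes B: "hermitian B" "supported S S B"
  obtains u d where "onb S u" "B = specmat S u d"
proof -
  have "\<exists>E. orthonormal_eigenset S B E \<and> finite E \<and> card E = n" if "n \<le> card S" for n
    using that
  proof (induct n)
    case 0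
    show ?case by (rule exI[of _ "{}"]) (auto simp: orthonormal_eigenset_def)
  next
    case (Suc n)
    then obtain E where E: "orthonormal_eigenset S B E" "finite E" "card E = n" by auto
    obtain x where "x \<notin> E" "orthonormal_eigenset S B (insert x E)"
      by (rule orthonormal_eigenset_extend[OF B E(1,2)]) (use E Suc in auto)
    then show ?case using E by (intro exI[of _ "insert x E"]) auto
  qed
  then obtain E where E: "orthonormal_eigenset S B E" "finite E" "card E = card S" by blast
  then obtain u where u: "bij_betw u S E"
    using finite_same_card_bij[of S E] by auto
  then have uE: "u i \<in> E" if "i \<in> S" for i using that by (auto simp: bij_betw_def)
  have eq: "u i = u j \<longleftrightarrow> i = j" if "i \<in> S" "j \<in> S" for i j
    using that u by (auto simp: bij_betw_def inj_on_def)
  have onb: "onb S u"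
  proof (rule orthonormal_complete)
    show "u i $ a = 0" if "i \<in> S" "a \<notin> S" for i a
      using E(1) uE that unfolding orthonormal_eigenset_def by blast
    show "cinner (u i) (u j) = (if i = j then 1 else 0)" if "i \<in> S" "j \<in> S" for i j
      using E(1) uE[OF that(1)] uE[OF that(2)] eq[OF that] unfolding orthonormal_eigenset_def by simp
  qed
  have "\<forall>i\<in>S. \<exists>l::real. B *v u i = l *\<^sub>R u i"
    using E(1) uE unfolding orthonormal_eigenset_def by blast
  then obtain d :: "'n \<Rightarrow> real" where d: "\<And>i. i \<in> S \<Longrightarrow> B *v u i = d i *\<^sub>R u i" by metis
  have "B = B ** mpow S 0 0" using supported_mpow_0[OF B(2)] by simp
  also have "\<dots> = B ** (\<Sum>i\<in>S. ketbra (u i) (u i))" using onb by (simp add: onb_def)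
  also have "\<dots> = specmat S u d"
    by (simp add: matmul_sum specmat_def matrix_ketbra d ketbra_scaleR)
  finally show ?thesis using that onb by blast
qed

lemma onbD:
  assumes "onb S u"
  shows "\<And>i a. i \<in> S \<Longrightarrow> a \<notin> S \<Longrightarrow> u i $ a = 0"
    and "\<And>i j. i \<in> S \<Longrightarrow> j \<in> S \<Longrightarrow> cinner (u i) (u j) = (if i = j then 1 else 0)"
    and "(\<Sum>i\<in>S. ketbra (u i) (u i)) = mpow S G 0"
  using assms by (auto simp: onb_def)

lemma onb_norm: "onb S u \<Longrightarrow> i \<in> S \<Longrightarrow> norm (u i) = 1"
proof -
  assume "onb S u" "i \<in> S"
  then have "of_real ((norm (u i))\<^sup>2) = (1::complex)"
    using onbD(2)[of S u i i] by (simp add: cinner_self)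
  then have "(norm (u i))\<^sup>2 = 1" by (simp only: of_real_eq_1_iff)
  then show ?thesis using norm_ge_zero[of "u i"] by (simp add: power2_eq_1_iff)
qed

lemma onb_ketbra_mult:
  assumes "onb S u" "i \<in> S" "j \<in> S"
  shows "ketbra (u i) (u i) ** ketbra (u j) (u j) = (if i = j then ketbra (u i) (u i) else 0)"
  by (simp add: ketbra_mult onbD(2)[OF assms] vec_eq_iff)

lemma specmat_mult:
  assumes "onb S u"
  shows "specmat S u f ** specmat S u g = specmat S u (\<lambda>i. f i * g i)"
proof -
  have "specmat S u f ** specmat S u g =
      (\<Sum>i\<in>S. \<Sum>j\<in>S. f i *\<^sub>R g j *\<^sub>R (ketbra (u i) (u i) ** ketbra (u j) (u j)))"
    unfolding specmat_def matmul_sum matmul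
    by (subst sum.swap) (simp add: matmul scaleR_sum_right mult.commute)
  also have "\<dots> = (\<Sum>i\<in>S. \<Sum>j\<in>S. if i = j then (f i * g j) *\<^sub>R ketbra (u i) (u i) else 0)"
    using onb_ketbra_mult[OF assms] by (intro sum.cong refl) auto
  also have "\<dots> = specmat S u (\<lambda>i. f i * g i)"
    by (simp add: specmat_def sum.delta)
  finally show ?thesis .
qed

lemma specmat_1: "onb S u \<Longrightarrow> specmat S u (\<lambda>_. 1) = mpow S G 0"
  using onbD(3)[of S u G] by (simp add: specmat_def)

lemma specmat_add: "specmat S u f + specmat S u g = specmat S u (\<lambda>i. f i + g i)"
  by (simp add: specmat_def sum.distrib scaleR_add_left)

lemma specmat_scaleR: "c *\<^sub>R specmat S u f = specmat S u (\<lambda>i. c * f i)"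
  by (simp add: specmat_def scaleR_sum_right)

lemma mpow_specmat: "onb S u \<Longrightarrow> mpow S (specmat S u d) n = specmat S u (\<lambda>i. d i ^ n)"
proof (induct n)
  case 0
  then show ?case using specmat_1[of S u "specmat S u d"] by simp
next
  case (Suc n)
  then show ?case by (simp add: specmat_mult)
qed

lemma mexp_specmat:
  assumes "onb S u"
  shows "mexp S (specmat S u d) = specmat S u (\<lambda>i. exp (d i))"
proof -
  have "(\<lambda>n. ((1 / fact n) * d i ^ n) *\<^sub>R ketbra (u i) (u i)) sums (exp (d i) *\<^sub>R ketbra (u i) (u i))" for i
    using sums_scaleR_left[OF exp_converges[of "d i"]] by (simp add: field_simps)
  then have "(\<lambda>n. \<Sum>i\<in>S. ((1 / fact n) * d i ^ n) *\<^sub>R ketbra (u i) (u i)) sums specmat S u (\<lambda>i. exp (d i))"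
    unfolding specmat_def by (intro sums_sum) auto
  then have "(\<lambda>n. (1 / fact n) *\<^sub>R mpow S (specmat S u d) n) sums specmat S u (\<lambda>i. exp (d i))"
    unfolding mpow_specmat[OF assms] by (simp add: specmat_def scaleR_sum_right)
  then show ?thesis by (simp add: mexp_def sums_iff)
qed

lemma trace_sum: "trace (\<Sum>i\<in>I. f i) = (\<Sum>i\<in>I. trace (f i :: complex^'n^'n))"
  by (simp add: trace_def) (rule sum.swap)

lemma trace_scaleR: "trace (r *\<^sub>R B) = r *\<^sub>R trace (B::complex^'n^'n)"
  by (simp add: trace_def scaleR_sum_right)

lemma trace_specmat: "onb S u \<Longrightarrow> trace (specmat S u d) = of_real (\<Sum>i\<in>S. d i)"
  by (simp add: specmat_def trace_sum trace_scaleR trace_ketbra onbD(2)) (simp add: scaleR_conv_of_real)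

lemma hermitian_specmat: "hermitian (specmat S u d)"
  by (simp add: hermitian_def specmat_def adj_sum adj_scaleR adj_ketbra)

lemma supported_specmat: "onb S u \<Longrightarrow> supported S S (specmat S u d)"
  unfolding specmat_def
  by (intro supported_sum supported_scaleR) (auto simp: supported_def ketbra_def dest: onbD(1))

lemma specmat_inner: "specmat S u d \<bullet> G = (\<Sum>i\<in>S. d i * (u i \<bullet> (G *v u i)))"
  by (simp add: specmat_def inner_sum_left ketbra_inner Re_cinner)

lemma specmat_vec: "specmat S u d *v v = (\<Sum>i\<in>S. d i *\<^sub>R (cinner (u i) v *s u i))"
  by (simp add: specmat_def matvec_sum matvec ketbra_vec)

lemma specmat_eigen:
  assumes "onb S u" "i \<in> S"
  shows "specmat S u d *v u i = d i *\<^sub>R u i"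
proof -
  have "specmat S u d *v u i = (\<Sum>j\<in>S. if i = j then d i *\<^sub>R u i else 0)"
    unfolding specmat_vec using onbD(2)[OF assms(1)] assms(2) by (intro sum.cong refl) auto
  then show ?thesis using assms by simp
qed

lemma specmat_quadratic:
  fixes v :: "complex^'n"
  shows "v \<bullet> (specmat S u d *v v) = (\<Sum>i\<in>S. d i * (cmod (cinner (u i) v))\<^sup>2)"
proof -
  have "v \<bullet> (c *s w) = Re (c * cinner v w)" for c and w :: "complex^'n"
    by (simp flip: Re_cinner add: cinner_scale_right)
  moreover have "Re (cinner (u i) v * cinner v (u i)) = (cmod (cinner (u i) v))\<^sup>2" for i
    by (subst cinner_commute[of v]) (simp add: cmod_power2 flip: power2_eq_square)
  ultimately show ?thesis
    by (simp add: specmat_vec inner_sum_right)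
qed

lemma psd_specmat: "(\<And>i. i \<in> S \<Longrightarrow> d i \<ge> 0) \<Longrightarrow> psd (specmat S u d)"
  by (auto simp: psd_iff specmat_quadratic intro!: sum_nonneg)

lemma onb_parseval:
  assumes "onb S u" "\<And>a. a \<notin> S \<Longrightarrow> v $ a = 0"
  shows "(\<Sum>i\<in>S. (cmod (cinner (u i) v))\<^sup>2) = (norm v)\<^sup>2"
proof -
  have "(\<Sum>k\<in>UNIV. (if i = k \<and> i \<in> S then 1 else 0) * v $ k) = (if i \<in> S then v $ i else 0)" for i
    by (cases "i \<in> S") (simp_all add: if_distrib[of "\<lambda>x. x * _"] cong: if_cong)
  then have "mpow S 0 0 *v v = v"
    using assms(2) by (auto simp: vec_eq_iff matrix_vector_mult_def)
  then show ?thesis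
    using specmat_quadratic[of v S u "\<lambda>_. 1"] specmat_1[OF assms(1), of 0]
    by (simp add: power2_norm_eq_inner)
qed

lemma norm_ketbra: "norm (ketbra u v) = norm u * norm v"
proof -
  have "ketbra u v \<bullet> ketbra u v = (norm u * norm v)\<^sup>2"
    by (simp add: ketbra_inner ketbra_vec cinner_scale_right cinner_self power_mult_distrib flip: of_real_power of_real_mult)
  then show ?thesis by (simp add: norm_eq_sqrt_inner)
qed

lemma norm_specmat_le:
  assumes "onb S u"
  shows "norm (specmat S u d) \<le> (\<Sum>i\<in>S. \<bar>d i\<bar>)"
  unfolding specmat_def
  by (rule sum_norm_le) (simp add: norm_ketbra onb_norm[OF assms])

section \<open>The free energy and its gradient\<close>

definition herm :: "'n set \<Rightarrow> (complex^'n^'n) set" where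
  "herm S = {Y. hermitian Y \<and> supported S S Y}"

text \<open>The action set of a user with antennas \<open>S\<close>.\<close>

definition density_mats :: "'n set \<Rightarrow> (complex^'n^'n) set" where
  "density_mats S = {X. supported S S X \<and> hermitian X \<and> psd X \<and> trace X = 1}"

definition free_energy :: "'n set \<Rightarrow> complex^'n^'n \<Rightarrow> real" where
  "free_energy S Y = ln (Re (trace (mexp S Y)))"

abbreviation idmat :: "'n set \<Rightarrow> complex^'n^'n" where
  "idmat S \<equiv> mpow S 0 0"

text \<open>The law \<open>scaleR_conv_of_real\<close> also applies to matrices, where it introduces the componentwise
  product; quotients of entries are therefore turned into scalings by this instance.\<close>

lemma complex_divide_of_real: "z / complex_of_real r = (1 / r) *\<^sub>R z"
  by (simp add: scaleR_conv_of_real)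

declare mpow.simps(1) [simp del]

lemma subspace_herm: "subspace (herm S)"
  by (auto simp: subspace_def herm_def hermitian_add hermitian_scaleR supported_add
      supported_scaleR hermitian_zero supported_zero)

lemma closed_herm: "closed (herm S)"
  by (rule closed_subspace[OF subspace_herm])

lemma idmat_herm: "idmat S \<in> herm S"
  by (auto simp: herm_def hermitian_def adj_def supported_def vec_eq_iff mpow.simps(1))

lemma idmat_inner: "idmat S \<bullet> X = (\<Sum>i\<in>S. Re (X $ i $ i))"
proof -
  have "idmat S \<bullet> X = (\<Sum>i\<in>UNIV. \<Sum>j\<in>UNIV. if i = j then (if i \<in> S then Re (X $ i $ i) else 0) else 0)"
    unfolding inner_vec_def inner_complex_def mpow.simps(1) by (intro sum.cong refl) auto
  also have "\<dots> = (\<Sum>i\<in>UNIV. if i \<in> S then Re (X $ i $ i) else 0)" by simp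
  finally show ?thesis by (simp add: sum.If_cases)
qed

lemma idmat_inner_supported:
  assumes "supported S S X"
  shows "idmat S \<bullet> X = Re (trace X)"
proof -
  have "(\<Sum>i\<in>S. Re (X $ i $ i)) = (\<Sum>i\<in>UNIV. Re (X $ i $ i))"
    using assms by (intro sum.mono_neutral_left) (auto simp: supported_def, metis complex.sel(1) zero_complex.code)
  then show ?thesis by (simp add: idmat_inner trace_def)
qed

lemma idmat_inner_idmat: "idmat S \<bullet> (idmat S :: complex^'n^'n) = card S"
  unfolding idmat_inner by (simp add: mpow.simps(1))

lemma densityD:
  assumes "X \<in> density_mats S"
  shows "supported S S X" "hermitian X" "psd X" "trace X = 1" "X \<in> herm S" "idmat S \<bullet> X = 1" "X \<bullet> idmat S = 1"
  using assms idmat_inner_supported[of S X] by (auto simp: density_mats_def herm_def inner_commute)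

lemma gibbs_spectral:
  assumes "Y \<in> herm S" "S \<noteq> {}"
  obtains u d Z where "onb S u" "Y = specmat S u d" "Z = (\<Sum>i\<in>S. exp (d i))" "Z > 0"
    "mexp S Y = specmat S u (\<lambda>i. exp (d i))" "free_energy S Y = ln Z"
    "exp_normalized S Y = specmat S u (\<lambda>i. exp (d i) / Z)" "trace (mexp S Y) = of_real Z"
proof -
  obtain u d where u: "onb S u" "Y = specmat S u d"
    using spectral_decomposition[of Y S] assms by (auto simp: herm_def)
  define Z where "Z = (\<Sum>i\<in>S. exp (d i))"
  have Z: "Z > 0" using assms by (simp add: Z_def sum_pos)
  have m: "mexp S Y = specmat S u (\<lambda>i. exp (d i))" by (simp add: u mexp_specmat)
  have t: "trace (mexp S Y) = of_real Z" by (simp add: m trace_specmat[OF u(1)] Z_def)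
  have "exp_normalized S Y = (1 / Z) *\<^sub>R mexp S Y"
    by (simp add: exp_normalized_def t vec_eq_iff complex_divide_of_real)
  also have "\<dots> = specmat S u (\<lambda>i. exp (d i) / Z)" by (simp add: m specmat_scaleR)
  finally show ?thesis using that u Z_def Z m t by (simp add: free_energy_def)
qed

lemma specmat_density:
  assumes "onb S u" "\<And>i. i \<in> S \<Longrightarrow> d i \<ge> 0" "(\<Sum>i\<in>S. d i) = 1"
  shows "specmat S u d \<in> density_mats S"
  using assms by (simp add: density_mats_def supported_specmat hermitian_specmat psd_specmat trace_specmat
      del: of_real_sum)

lemma exp_normalized_density:
  assumes "Y \<in> herm S" "S \<noteq> {}"
  shows "exp_normalized S Y \<in> density_mats S"
proof -
  obtain u d Z where *: "onb S u" "Z = (\<Sum>i\<in>S. exp (d i))" "Z > 0"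
    "exp_normalized S Y = specmat S u (\<lambda>i. exp (d i) / Z)"
    using gibbs_spectral[OF assms] by metis
  show ?thesis unfolding *(4)
    by (rule specmat_density) (use * in \<open>auto simp flip: sum_divide_distrib\<close>)
qed

text \<open>The exponential of the free energy of \<open>Y'\<close> dominates the sum of the exponentials of the diagonal
  entries of \<open>Y'\<close> in an eigenbasis of \<open>Y\<close>. This is Peierls' inequality: the matrix of squared
  overlaps of two orthonormal bases is doubly stochastic, so it can be combined with Jensen's
  inequality for the exponential. A second use of Jensen's inequality, with the eigenvalues of the
  density as weights, yields the subgradient.\<close>

lemma free_energy_convex:
  assumes Y: "Y \<in> herm S" and Y': "Y' \<in> herm S" and S: "S \<noteq> {}"
  shows "free_energy S Y' \<ge> free_energy S Y + exp_normalized S Y \<bullet> (Y' - Y)"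
proof -
  obtain u d Z where u: "onb S u" "Y = specmat S u d" "Z = (\<Sum>i\<in>S. exp (d i))" "Z > 0"
    "free_energy S Y = ln Z" "exp_normalized S Y = specmat S u (\<lambda>i. exp (d i) / Z)"
    using gibbs_spectral[OF Y S] by metis
  obtain v c Z' where v: "onb S v" "Y' = specmat S v c" "Z' = (\<Sum>i\<in>S. exp (c i))" "Z' > 0"
    "free_energy S Y' = ln Z'"
    using gibbs_spectral[OF Y' S] by metis
  define p where "p i j = (cmod (cinner (v j) (u i)))\<^sup>2" for i j
  have p: "p i j = (cmod (cinner (u i) (v j)))\<^sup>2" for i j
    unfolding p_def by (subst cinner_commute) simp
  have row: "(\<Sum>j\<in>S. p i j) = 1" if "i \<in> S" for i
    unfolding p_def using onb_parseval[OF v(1), of "u i"] onbD(1)[OF u(1)] onb_norm[OF u(1)] that by simp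
  have col: "(\<Sum>i\<in>S. p i j) = 1" if "j \<in> S" for j
    unfolding p using onb_parseval[OF u(1), of "v j"] onbD(1)[OF v(1)] onb_norm[OF v(1)] that by simp
  define y where "y i = (\<Sum>j\<in>S. p i j *\<^sub>R c j)" for i
  have y: "u i \<bullet> (Y' *v u i) = y i" for i
    unfolding v(2) specmat_quadratic y_def p_def by (simp add: mult.commute)
  define q where "q i = exp (d i) / Z" for i
  have q: "(\<Sum>i\<in>S. q i) = 1" "\<And>i. q i \<ge> 0" "\<And>i. q i * Z = exp (d i)"
    using u(4) by (auto simp: q_def u(3)[symmetric] simp flip: sum_divide_distrib)
  have "Z * exp (\<Sum>i\<in>S. q i *\<^sub>R (y i - d i)) \<le> Z * (\<Sum>i\<in>S. q i * exp (y i - d i))"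
    using u(4) S q by (intro mult_left_mono convex_on_sum[OF _ _ exp_convex]) auto
  also have "\<dots> = (\<Sum>i\<in>S. exp (y i))"
    by (simp add: sum_distrib_left exp_diff q_def) (use u(4) in auto)
  also have "\<dots> \<le> (\<Sum>i\<in>S. \<Sum>j\<in>S. p i j * exp (c j))"
    unfolding y_def using S row
    by (intro sum_mono convex_on_sum[OF _ _ exp_convex]) (auto simp: p_def)
  also have "\<dots> = (\<Sum>j\<in>S. (\<Sum>i\<in>S. p i j) * exp (c j))"
    by (subst sum.swap) (simp add: sum_distrib_right)
  also have "\<dots> = Z'" by (simp add: col v(3))
  finally have "ln (Z * exp (\<Sum>i\<in>S. q i *\<^sub>R (y i - d i))) \<le> ln Z'"
    using u(4) v(4) by (subst ln_le_cancel_iff) auto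
  then have "ln Z + (\<Sum>i\<in>S. q i * (y i - d i)) \<le> ln Z'"
    using u(4) by (simp add: ln_mult)
  moreover have "exp_normalized S Y \<bullet> (Y' - Y) = (\<Sum>i\<in>S. q i * (y i - d i))"
  proof -
    have "u i \<bullet> (Y *v u i) = d i" if "i \<in> S" for i
      using specmat_eigen[OF u(1) that, of d] onb_norm[OF u(1) that]
      by (simp add: u(2) flip: power2_norm_eq_inner)
    then show ?thesis
      unfolding u(6) specmat_inner q_def
      by (intro sum.cong refl) (simp add: matvec inner_diff_right y)
  qed
  ultimately show ?thesis by (simp add: u(5) v(5))
qed

lemma density_weights:
  assumes X: "X \<in> density_mats S" and u: "onb S u"
  shows "\<And>i. u i \<bullet> (X *v u i) \<ge> 0" "(\<Sum>i\<in>S. u i \<bullet> (X *v u i)) = 1"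
proof -
  show "u i \<bullet> (X *v u i) \<ge> 0" for i using densityD(3)[OF X] by (simp add: psd_iff)
  show "(\<Sum>i\<in>S. u i \<bullet> (X *v u i)) = 1"
    using specmat_inner[of S u "\<lambda>_. 1" X] densityD(6)[OF X] specmat_1[OF u, of 0] by simp
qed

text \<open>The diagonal of a density matrix in an eigenbasis of \<open>Y\<close> is a probability vector, and each
  eigenvalue of \<open>Y\<close> is at most the logarithm of the sum of their exponentials.\<close>

lemma density_inner_le_free_energy:
  assumes X: "X \<in> density_mats S" and Y: "Y \<in> herm S" and S: "S \<noteq> {}"
  shows "X \<bullet> Y \<le> free_energy S Y"
proof -
  obtain u d Z where u: "onb S u" "Y = specmat S u d" "Z = (\<Sum>i\<in>S. exp (d i))" "Z > 0"
    "free_energy S Y = ln Z"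
    using gibbs_spectral[OF Y S] by metis
  have "d i \<le> ln Z" if "i \<in> S" for i
  proof -
    have "exp (d i) \<le> Z" unfolding u(3) using that by (intro member_le_sum) auto
    then show ?thesis using u(4) by (simp add: ln_ge_iff)
  qed
  then have "(\<Sum>i\<in>S. d i * (u i \<bullet> (X *v u i))) \<le> (\<Sum>i\<in>S. ln Z * (u i \<bullet> (X *v u i)))"
    using density_weights(1)[OF X u(1)] by (intro sum_mono mult_right_mono) auto
  also have "\<dots> = ln Z" by (simp add: density_weights(2)[OF X u(1)] flip: sum_distrib_left)
  finally show ?thesis unfolding u(5) inner_commute[of X] by (simp only: u(2) specmat_inner)
qed

lemma density_norm_le:
  assumes X: "X \<in> density_mats S"
  shows "norm X \<le> 1"
proof -
  obtain u d where u: "onb S u" "X = specmat S u d"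
    using spectral_decomposition[of X S] densityD[OF X] by metis
  have d: "d i = u i \<bullet> (X *v u i)" if "i \<in> S" for i
    using specmat_eigen[OF u(1) that, of d] onb_norm[OF u(1) that]
    by (simp add: u(2) flip: power2_norm_eq_inner)
  have "norm X \<le> (\<Sum>i\<in>S. \<bar>d i\<bar>)" unfolding u(2) by (rule norm_specmat_le[OF u(1)])
  also have "\<dots> = (\<Sum>i\<in>S. u i \<bullet> (X *v u i))"
    using d density_weights(1)[OF X u(1)] by (intro sum.cong) auto
  finally show ?thesis by (simp add: density_weights(2)[OF X u(1)])
qed

lemma density_convex: "convex (density_mats S)"
proof (rule convexI)
  fix X Y :: "complex^'a^'a" and s t :: real
  assume *: "X \<in> density_mats S" "Y \<in> density_mats S" "0 \<le> s" "0 \<le> t" "s + t = 1"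
  have "psd (s *\<^sub>R X + t *\<^sub>R Y)"
    using * unfolding psd_iff density_mats_def matvec inner_add_right inner_scaleR_right by auto
  moreover have "trace (s *\<^sub>R X + t *\<^sub>R Y) = 1"
    using * unfolding trace_add trace_scaleR density_mats_def
    by (auto simp flip: scaleR_add_left)
  ultimately show "s *\<^sub>R X + t *\<^sub>R Y \<in> density_mats S"
    using * unfolding density_mats_def
    by (intro CollectI conjI supported_add supported_scaleR hermitian_add hermitian_scaleR) auto
qed

lemma density_closed: "closed (density_mats S)"
proof -
  have "density_mats S = herm S \<inter> ((\<Inter>v. {X. 0 \<le> v \<bullet> (X *v v)}) \<inter> {X. trace X = 1})"
    by (auto simp: density_mats_def herm_def psd_iff)
  moreover have "closed (\<Inter>v. {X::complex^'a^'a. 0 \<le> v \<bullet> (X *v v)})"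
    by (intro closed_INT ballI closed_Collect_le continuous_intros
        bounded_bilinear.continuous_on[OF bounded_bilinear_matrix_vector])
  moreover have "closed {X::complex^'a^'a. trace X = 1}"
    unfolding trace_def by (intro closed_Collect_eq continuous_intros)
  ultimately show ?thesis by (simp only: closed_Int closed_herm)
qed

lemma continuous_mpow: "continuous_on UNIV (\<lambda>B. mpow S B n)"
proof (induct n)
  case (Suc n)
  then show ?case
    by simp (intro continuous_intros bounded_bilinear.continuous_on[OF bounded_bilinear_matrix_mult])
qed (simp add: mpow.simps(1))

lemma continuous_mexp:
  fixes S :: "'n::finite set"
  shows "continuous_on UNIV (mexp S)"
proof -
  obtain K where K: "K > 0" "\<And>(A :: complex^'n^'n) (B :: complex^'n^'n). norm (A ** B) \<le> norm A * norm B * K"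
    using bounded_bilinear.pos_bounded[OF bounded_bilinear_matrix_mult] by blast
  define c where "c = norm (idmat S :: complex^'n^'n)"
  have le: "norm (mpow S B n) \<le> c * (K * norm B) ^ n" for B :: "complex^'n^'n" and n
  proof (induct n)
    case 0
    show ?case by (simp add: c_def mpow.simps(1))
  next
    case (Suc n)
    have "norm (mpow S B (Suc n)) \<le> norm B * norm (mpow S B n) * K" using K(2)[of B] by simp
    also have "\<dots> \<le> norm B * (c * (K * norm B) ^ n) * K"
      using Suc K(1) by (intro mult_right_mono mult_left_mono) auto
    finally show ?case by (simp add: mult_ac)
  qed
  have "continuous_on (ball 0 r) (mexp S)" for r
  proof -
    have "uniform_limit (ball 0 r) (\<lambda>n B. \<Sum>i<n. (1 / fact i) *\<^sub>R mpow S B i)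
        (\<lambda>B. \<Sum>i. (1 / fact i) *\<^sub>R mpow S B i) sequentially"
    proof (rule Weierstrass_m_test)
      show "norm ((1 / fact n) *\<^sub>R mpow S B n) \<le> c * (inverse (fact n) * (K * r) ^ n)"
        if "B \<in> ball 0 r" for n B
      proof -
        have "c \<ge> 0" by (simp add: c_def)
        have "norm ((1 / fact n) *\<^sub>R mpow S B n) \<le> (1 / fact n) * (c * (K * norm B) ^ n)"
          using le[of B n] by (simp add: divide_right_mono)
        also have "\<dots> \<le> (1 / fact n) * (c * (K * r) ^ n)"
          using that K \<open>c \<ge> 0\<close> by (intro mult_left_mono power_mono) auto
        finally show ?thesis by (simp add: field_simps)
      qed
      show "summable (\<lambda>n. c * (inverse (fact n) * (K * r) ^ n))"
        by (intro summable_mult summable_exp)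
    qed
    then show ?thesis
      unfolding mexp_def
      by (rule uniform_limit_theorem[rotated])
        (auto intro!: always_eventually continuous_intros continuous_on_subset[OF continuous_mpow])
  qed
  then have "continuous (at B) (mexp S)" for B :: "complex^'n^'n"
    using continuous_on_eq_continuous_at[of "ball 0 (norm B + 1)" "mexp S"] by auto
  then show ?thesis by (simp add: continuous_at_imp_continuous_on)
qed

lemma continuous_exp_normalized:
  assumes S: "S \<noteq> {}"
  shows "continuous_on (herm S) (exp_normalized S)"
proof -
  have "trace (mexp S Y) \<noteq> 0" if "Y \<in> herm S" for Y
    using gibbs_spectral[OF that S] by (metis less_irrefl of_real_eq_0_iff)
  moreover have c: "continuous_on (herm S) (mexp S)"
    using continuous_mexp continuous_on_subset by blast
  ultimately show ?thesis
    unfolding exp_normalized_def trace_def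
    by (intro continuous_intros c) auto
qed

text \<open>A shift by a multiple of the identity multiplies the exponential by a positive number, which the
  normalization cancels: only the traceless part of a score matrix matters.\<close>

lemma gibbs_shift:
  assumes Y: "Y \<in> herm S" and S: "S \<noteq> {}"
  shows "exp_normalized S (Y + c *\<^sub>R idmat S) = exp_normalized S Y"
proof -
  obtain u d Z where u: "onb S u" "Y = specmat S u d" "Z = (\<Sum>i\<in>S. exp (d i))" "Z > 0"
    "exp_normalized S Y = specmat S u (\<lambda>i. exp (d i) / Z)"
    "mexp S Y = specmat S u (\<lambda>i. exp (d i))" "trace (mexp S Y) = of_real Z"
    using gibbs_spectral[OF Y S] by metis
  have "Y + c *\<^sub>R idmat S = specmat S u (\<lambda>i. d i + c)"
    by (simp only: u(2) specmat_1[OF u(1), symmetric] specmat_scaleR specmat_add mult_1_right)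
  then have "mexp S (Y + c *\<^sub>R idmat S) = exp c *\<^sub>R mexp S Y"
    by (simp only: mexp_specmat[OF u(1)] u(6) specmat_scaleR exp_add mult.commute)
  then have "mexp S (Y + c *\<^sub>R idmat S) $ i $ j / trace (mexp S (Y + c *\<^sub>R idmat S)) =
      mexp S Y $ i $ j / trace (mexp S Y)" for i j
    by (simp add: trace_scaleR) (simp add: scaleR_conv_of_real)
  then show ?thesis by (simp add: exp_normalized_def)
qed

text \<open>The Bregman divergence of the free energy, which is the quantum relative entropy of
  \<open>exp_normalized S Y\<close> with respect to \<open>exp_normalized S Y'\<close>.\<close>

definition bregman :: "'n set \<Rightarrow> complex^'n^'n \<Rightarrow> complex^'n^'n \<Rightarrow> real" where
  "bregman S Y' Y = free_energy S Y' - free_energy S Y - exp_normalized S Y \<bullet> (Y' - Y)"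

lemma bregman_nonneg: "Y \<in> herm S \<Longrightarrow> Y' \<in> herm S \<Longrightarrow> S \<noteq> {} \<Longrightarrow> bregman S Y' Y \<ge> 0"
  using free_energy_convex[of Y S Y'] by (simp add: bregman_def)

lemma bregman_le_symmetrized:
  assumes "Y \<in> herm S" "Y' \<in> herm S" "S \<noteq> {}"
  shows "bregman S Y' Y \<le> (exp_normalized S Y' - exp_normalized S Y) \<bullet> (Y' - Y)"
  using bregman_nonneg[of Y' S Y] assms by (simp add: bregman_def algebra_simps)

lemma bregman_increment:
  assumes "Y \<in> herm S" "Y' \<in> herm S" "Z \<in> herm S" "S \<noteq> {}"
  shows "bregman S Y' Z - bregman S Y Z \<le> (exp_normalized S Y' - exp_normalized S Z) \<bullet> (Y' - Y)"
  using bregman_nonneg[of Y' S Y] assms by (simp add: bregman_def algebra_simps)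

text \<open>A point where the divergence from \<open>Y\<close> vanishes minimizes it, and the gradient of the
  divergence is the difference of the two densities.\<close>

lemma bregman_eq_0D:
  assumes Y: "Y \<in> herm S" and Y': "Y' \<in> herm S" and S: "S \<noteq> {}" and 0: "bregman S Y' Y = 0"
  shows "exp_normalized S Y' = exp_normalized S Y"
proof -
  define W where "W = exp_normalized S Y - exp_normalized S Y'"
  have W: "W \<in> herm S"
    unfolding W_def using exp_normalized_density[OF _ S] Y Y' subspace_diff[OF subspace_herm]
    by (meson densityD(5))
  have mem: "Y' + s *\<^sub>R W \<in> herm S" for s
    using Y' W subspace_herm by (auto intro: subspace_add subspace_scale)
  have pos: "0 \<le> (exp_normalized S (Y' + s *\<^sub>R W) - exp_normalized S Y) \<bullet> W" if s: "s > 0" for s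
  proof -
    have "0 \<le> bregman S (Y' + s *\<^sub>R W) Y - bregman S Y' Y"
      using bregman_nonneg[OF Y mem S] 0 by simp
    also have "\<dots> \<le> s * ((exp_normalized S (Y' + s *\<^sub>R W) - exp_normalized S Y) \<bullet> W)"
      using bregman_increment[OF Y' mem Y S, of s] by simp
    finally show ?thesis using s by (simp add: zero_le_mult_iff)
  qed
  have "continuous_on UNIV (\<lambda>s. (exp_normalized S (Y' + s *\<^sub>R W) - exp_normalized S Y) \<bullet> W)"
    by (intro continuous_intros continuous_on_compose2[OF continuous_exp_normalized[OF S]])
      (auto simp: mem)
  then have "isCont (\<lambda>s. (exp_normalized S (Y' + s *\<^sub>R W) - exp_normalized S Y) \<bullet> W) 0"
    by (simp add: continuous_on_eq_continuous_at)
  then have "((\<lambda>s. (exp_normalized S (Y' + s *\<^sub>R W) - exp_normalized S Y) \<bullet> W) \<longlongrightarrow>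
      (exp_normalized S (Y' + 0 *\<^sub>R W) - exp_normalized S Y) \<bullet> W) (at_right 0)"
    unfolding isCont_def by (rule filterlim_at_split[THEN iffD1, THEN conjunct2])
  then have "0 \<le> (exp_normalized S (Y' + 0 *\<^sub>R W) - exp_normalized S Y) \<bullet> W"
    by (rule tendsto_lowerbound) (auto simp: eventually_at_right_less pos intro!: eventually_mono[OF eventually_at_right_less[of 0]])
  then have "- (W \<bullet> W) \<ge> 0" by (simp add: W_def inner_diff_left algebra_simps)
  then have "W = 0" by (metis inner_gt_zero_iff neg_0_le_iff_le not_le)
  then show ?thesis by (simp add: W_def)
qed

text \<open>The exponential is injective on Hermitian matrices: two eigenvectors that are not orthogonal
  belong to equal eigenvalues of the exponentials, hence of the matrices.\<close>

lemma mexp_inj: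
  assumes Y: "Y \<in> herm S" and Y': "Y' \<in> herm S" and eq: "mexp S Y = mexp S Y'"
  shows "Y = Y'"
proof -
  obtain u d where u: "onb S u" "Y = specmat S u d"
    using spectral_decomposition[of Y S] Y by (auto simp: herm_def)
  obtain v c where v: "onb S v" "Y' = specmat S v c"
    using spectral_decomposition[of Y' S] Y' by (auto simp: herm_def)
  have e: "exp (c j) *\<^sub>R cinner (v j) (u i) = exp (d i) *\<^sub>R cinner (v j) (u i)"
    if "i \<in> S" "j \<in> S" for i j
  proof -
    have "exp (d i) *\<^sub>R cinner (v j) (u i) = cinner (v j) (mexp S Y *v u i)"
      using specmat_eigen[OF u(1) that(1)] by (simp add: u(2) mexp_specmat[OF u(1)] cinner_scaleR_right)
    also have "\<dots> = cinner (mexp S Y' *v v j) (u i)"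
      by (simp add: eq v(2) mexp_specmat[OF v(1)] hermitian_cinner[OF hermitian_specmat])
    also have "\<dots> = cnj (exp (c j) *\<^sub>R cinner (u i) (v j))"
      using specmat_eigen[OF v(1) that(2)] 
      by (subst cinner_commute) (simp add: v(2) mexp_specmat[OF v(1)] cinner_scaleR_right)
    also have "\<dots> = exp (c j) *\<^sub>R cinner (v j) (u i)"
      by (subst (2) cinner_commute) simp
    finally show ?thesis by (rule sym)
  qed
  have same: "cinner (v j) (Y' *v u i) = cinner (v j) (Y *v u i)" if "i \<in> S" "j \<in> S" for i j
  proof -
    have "cinner (v j) (Y' *v u i) = cinner (Y' *v v j) (u i)"
      by (simp add: v(2) hermitian_cinner[OF hermitian_specmat])
    also have "\<dots> = c j *\<^sub>R cinner (v j) (u i)"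
      using specmat_eigen[OF v(1) that(2), of c]
      by (subst cinner_commute) (simp add: v(2) cinner_scaleR_right cinner_commute[of "v j"])
    also have "\<dots> = d i *\<^sub>R cinner (v j) (u i)"
    proof (cases "cinner (v j) (u i) = 0")
      case False
      then have "exp (c j) = exp (d i)" using e[OF that] by (simp only: scaleR_cancel_right) simp
      then show ?thesis by (simp only: exp_inj_iff)
    qed simp
    also have "\<dots> = cinner (v j) (Y *v u i)"
      using specmat_eigen[OF u(1) that(1)] by (simp add: u(2) cinner_scaleR_right)
    finally show ?thesis .
  qed
  have vec: "Y' *v u i = Y *v u i" if i: "i \<in> S" for i
  proof -
    have "(\<Sum>j\<in>S. (cmod (cinner (v j) (Y' *v u i - Y *v u i)))\<^sup>2) = (norm (Y' *v u i - Y *v u i))\<^sup>2"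
      by (rule onb_parseval[OF v(1)])
        (use Y Y' in \<open>auto simp: herm_def supported_mult_vec\<close>)
    then show ?thesis using same[OF i] by (simp add: cinner_diff_right)
  qed
  have "Y' ** mpow S 0 0 = Y ** mpow S 0 0"
    using vec by (simp add: onbD(3)[OF u(1), symmetric] matmul_sum matrix_ketbra)
  then show ?thesis using Y Y' supported_mpow_0 by (metis (no_types) herm_def mem_Collect_eq)
qed

definition traceless :: "'n set \<Rightarrow> complex^'n^'n \<Rightarrow> complex^'n^'n" where
  "traceless S Y = Y - ((idmat S \<bullet> Y) / card S) *\<^sub>R idmat S"

lemma linear_traceless: "linear (traceless S)"
  by (rule linearI) (simp_all add: traceless_def inner_add_right algebra_simps add_divide_distrib)

lemma traceless_herm: "Y \<in> herm S \<Longrightarrow> traceless S Y \<in> herm S"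
  unfolding traceless_def
  using subspace_herm idmat_herm by (auto intro: subspace_diff subspace_scale)

lemma traceless_idmat_inner: "S \<noteq> {} \<Longrightarrow> idmat S \<bullet> traceless S Y = 0"
  by (simp add: traceless_def inner_diff_right idmat_inner_idmat)

lemma exp_normalized_traceless:
  assumes "Y \<in> herm S" "S \<noteq> {}"
  shows "exp_normalized S (traceless S Y) = exp_normalized S Y"
  using gibbs_shift[OF assms, of "- ((idmat S \<bullet> Y) / card S)"] by (simp add: traceless_def)

lemma traceless_inner: "traceless S Y \<bullet> G = Y \<bullet> traceless S G"
  by (simp add: traceless_def inner_diff_left inner_diff_right inner_commute)

lemma density_diff_traceless:
  assumes "X \<in> density_mats S" "X' \<in> density_mats S"
  shows "(X - X') \<bullet> traceless S Y = (X - X') \<bullet> Y"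
  using densityD(7)[OF assms(1)] densityD(7)[OF assms(2)]
  by (simp add: traceless_def inner_diff_left inner_diff_right)

lemma exp_normalized_inj:
  assumes S: "S \<noteq> {}" and Y: "Y \<in> herm S" "idmat S \<bullet> Y = 0" and Y': "Y' \<in> herm S" "idmat S \<bullet> Y' = 0"
    and eq: "exp_normalized S Y = exp_normalized S Y'"
  shows "Y = Y'"
proof -
  obtain u d Z where u: "Z > 0" "trace (mexp S Y) = of_real Z"
    using gibbs_spectral[OF Y(1) S] by metis
  obtain Z' where v: "Z' > 0" "trace (mexp S Y') = of_real Z'"
    using gibbs_spectral[OF Y'(1) S] by metis
  have "mexp S Y $ i $ j / of_real Z = mexp S Y' $ i $ j / of_real Z'" for i j
    using eq by (simp add: exp_normalized_def vec_eq_iff u v)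
  then have "mexp S Y $ i $ j = (Z / Z') *\<^sub>R (mexp S Y' $ i $ j)" for i j
    using u(1) v(1) by (simp add: scaleR_conv_of_real field_simps)
  then have e: "mexp S Y = (Z / Z') *\<^sub>R mexp S Y'"
    by (simp add: vec_eq_iff)
  define c where "c = ln (Z / Z')"
  obtain w f where w: "onb S w" "Y' = specmat S w f"
    using spectral_decomposition[of Y' S] Y' by (auto simp: herm_def)
  have "Y' + c *\<^sub>R idmat S = specmat S w (\<lambda>i. f i + c)"
    by (simp only: w(2) specmat_1[OF w(1), symmetric] specmat_scaleR specmat_add mult_1_right)
  then have "mexp S (Y' + c *\<^sub>R idmat S) = specmat S w (\<lambda>i. exp c * exp (f i))"
    by (simp only: mexp_specmat[OF w(1)] exp_add mult.commute)
  also have "\<dots> = exp c *\<^sub>R mexp S Y'"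
    by (simp only: w(2) mexp_specmat[OF w(1)] specmat_scaleR)
  also have "\<dots> = mexp S Y"
    using u(1) v(1) by (simp add: e c_def)
  finally have "mexp S (Y' + c *\<^sub>R idmat S) = mexp S Y" .
  moreover have "Y' + c *\<^sub>R idmat S \<in> herm S"
    by (rule subspace_add[OF subspace_herm Y'(1) subspace_scale[OF subspace_herm idmat_herm]])
  ultimately have "Y = Y' + c *\<^sub>R idmat S"
    using mexp_inj[OF Y(1)] by simp
  then have "idmat S \<bullet> Y = idmat S \<bullet> Y' + c * (idmat S \<bullet> (idmat S :: complex^'a^'a))"
    by (simp only: inner_add_right inner_scaleR_right)
  then have "c = 0" using Y(2) Y'(2) S by (simp add: idmat_inner_idmat)
  then show ?thesis using \<open>Y = Y' + c *\<^sub>R idmat S\<close> by simp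
qed

lemma free_energy_0: "S \<noteq> {} \<Longrightarrow> free_energy S 0 = ln (card S)"
proof -
  assume S: "S \<noteq> {}"
  have "0 \<in> herm S" using subspace_herm subspace_0 by blast
  obtain u d where u: "onb S u" "(0::complex^'a^'a) = specmat S u d"
    using spectral_decomposition[of 0 S] hermitian_zero supported_zero by metis
  have "(0::complex^'a^'a) = specmat S u (\<lambda>_. 0)" by (simp add: specmat_def)
  then show ?thesis
    using mexp_specmat[OF u(1), of "\<lambda>_. 0"] trace_specmat[OF u(1), of "\<lambda>_. 1"]
    by (simp add: free_energy_def)
qed

section \<open>The log-determinant and the ergodic sum rate\<close>

lemma norm_matrix_sqr: "(norm (A::complex^'m^'n))\<^sup>2 = (\<Sum>i\<in>UNIV. \<Sum>j\<in>UNIV. (cmod (A $ i $ j))\<^sup>2)"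
  by (simp add: power2_norm_eq_inner inner_vec_def)

lemma norm_matrix_mult_le: "norm (A ** B) \<le> norm A * norm (B::complex^'l^'m)" for A :: "complex^'m^'n"
proof (rule power2_le_imp_le)
  have "(cmod ((A ** B) $ i $ j))\<^sup>2 \<le> (\<Sum>k\<in>UNIV. (cmod (A $ i $ k))\<^sup>2) * (\<Sum>k\<in>UNIV. (cmod (B $ k $ j))\<^sup>2)" for i j
  proof -
    have "cmod ((A ** B) $ i $ j) \<le> (\<Sum>k\<in>UNIV. cmod (A $ i $ k) * cmod (B $ k $ j))"
      unfolding matrix_matrix_mult_def vec_lambda_beta by (rule sum_norm_le) (simp only: norm_mult)
    then have "(cmod ((A ** B) $ i $ j))\<^sup>2 \<le> (\<Sum>k\<in>UNIV. cmod (A $ i $ k) * cmod (B $ k $ j))\<^sup>2"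
      by (rule power_mono) simp
    also have "\<dots> \<le> (\<Sum>k\<in>UNIV. (cmod (A $ i $ k))\<^sup>2) * (\<Sum>k\<in>UNIV. (cmod (B $ k $ j))\<^sup>2)"
      by (rule Cauchy_Schwarz_ineq_sum)
    finally show ?thesis .
  qed
  then have "(norm (A ** B))\<^sup>2 \<le> (\<Sum>i\<in>UNIV. \<Sum>j\<in>UNIV. (\<Sum>k\<in>UNIV. (cmod (A $ i $ k))\<^sup>2) * (\<Sum>k\<in>UNIV. (cmod (B $ k $ j))\<^sup>2))"
    unfolding norm_matrix_sqr by (intro sum_mono)
  also have "\<dots> = (norm A)\<^sup>2 * (\<Sum>j\<in>UNIV. \<Sum>k\<in>UNIV. (cmod (B $ k $ j))\<^sup>2)"
    by (simp only: norm_matrix_sqr sum_product)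
  also have "(\<Sum>j\<in>UNIV. \<Sum>k\<in>UNIV. (cmod (B $ k $ j))\<^sup>2) = (norm B)\<^sup>2"
    unfolding norm_matrix_sqr by (rule sum.swap)
  finally show "(norm (A ** B))\<^sup>2 \<le> (norm A * norm B)\<^sup>2" by (simp add: power_mult_distrib)
qed simp

lemma norm_matrix_mult3_le: "norm (A ** B ** C) \<le> norm A * norm B * norm C"
  for A :: "complex^'m^'n" and B :: "complex^'l^'m" and C :: "complex^'j^'l"
  by (rule order_trans[OF norm_matrix_mult_le mult_right_mono[OF norm_matrix_mult_le norm_ge_zero]])

lemma inner_trace: "A \<bullet> B = Re (trace (adj A ** B))" for A :: "complex^'m^'n"
proof -
  have "A \<bullet> B = (\<Sum>i\<in>UNIV. \<Sum>j\<in>UNIV. Re (cnj (A $ i $ j) * B $ i $ j))"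
    by (simp add: inner_vec_def inner_complex_def)
  also have "\<dots> = (\<Sum>j\<in>UNIV. \<Sum>i\<in>UNIV. Re (cnj (A $ i $ j) * B $ i $ j))" by (rule sum.swap)
  finally show ?thesis by (simp add: trace_def matrix_matrix_mult_def adj_def)
qed

lemma inner_mult_left: "A \<bullet> (B ** C) = (adj B ** A) \<bullet> C"
  by (simp add: inner_trace adj_mult matrix_mul_assoc)

lemma inner_mult_right: "A \<bullet> (B ** C) = (A ** adj C) \<bullet> B" 
proof -
  have "trace (adj A ** (B ** C)) = trace ((adj A ** B) ** C)" by (simp add: matrix_mul_assoc)
  also have "\<dots> = trace (C ** (adj A ** B))" by (rule trace_mul_sym)
  finally show ?thesis by (simp add: inner_trace adj_mult matrix_mul_assoc)
qed

lemma inner_gain: "B \<bullet> (G ** X ** adj G) = (adj G ** B ** G) \<bullet> X"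
proof -
  have "B \<bullet> (G ** X ** adj G) = (B ** G) \<bullet> (G ** X)" by (simp add: inner_mult_right[of B "G ** X"])
  then show ?thesis by (simp add: inner_mult_left matrix_mul_assoc)
qed

text \<open>All values of \<open>W\<close> at profiles lie in this set, on which inverses are bounded and determinants
  are at least 1.\<close>

definition above_id :: "(complex^'n^'n) set" where
  "above_id = {B. hermitian B \<and> (\<forall>v. v \<bullet> v \<le> v \<bullet> (B *v v))}"

lemma idmat_UNIV: "idmat UNIV = mat 1"
  by (simp add: mpow.simps(1) mat_def)

lemma supported_UNIV: "supported UNIV UNIV B"
  by (simp add: supported_def)

lemma matrix_inv_eqI:
  fixes B :: "complex^'n^'n"
  assumes "B ** C = mat 1"
  shows "matrix_inv B = C"
proof -
  have C: "C ** B = mat 1" using assms matrix_left_right_inverse by blast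
  then have "B ** matrix_inv B = mat 1 \<and> matrix_inv B ** B = mat 1"
    unfolding matrix_inv_def using assms by (metis (mono_tags, lifting) someI_ex)
  then show ?thesis by (metis C matrix_mul_assoc matrix_mul_lid matrix_mul_rid)
qed

lemma above_id_spectral:
  fixes B :: "complex^'n^'n"
  assumes "B \<in> above_id"
  obtains u d where "onb UNIV u" "B = specmat UNIV u d" "\<And>i. d i \<ge> 1"
    "matrix_inv B = specmat UNIV u (\<lambda>i. 1 / d i)"
proof -
  obtain u d where u: "onb UNIV u" "B = specmat UNIV u d"
    using spectral_decomposition[of B UNIV] assms supported_UNIV by (auto simp: above_id_def)
  have d: "d i \<ge> 1" for i
  proof -
    have "u i \<bullet> u i \<le> u i \<bullet> (B *v u i)" using assms by (simp add: above_id_def)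
    then show ?thesis
      using specmat_eigen[OF u(1), of i d] onb_norm[OF u(1), of i]
      by (simp add: u(2) flip: power2_norm_eq_inner)
  qed
  have "B ** specmat UNIV u (\<lambda>i. 1 / d i) = specmat UNIV u (\<lambda>i. d i * (1 / d i))"
    unfolding u(2) by (rule specmat_mult[OF u(1)])
  also have "(\<lambda>i. d i * (1 / d i)) = (\<lambda>_. 1)"
  proof
    show "d i * (1 / d i) = 1" for i using d[of i] by simp
  qed
  finally have "matrix_inv B = specmat UNIV u (\<lambda>i. 1 / d i)"
    by (intro matrix_inv_eqI) (simp add: specmat_1[OF u(1), of 0] idmat_UNIV)
  then show ?thesis using that u d by blast
qed

lemma above_id_inverse:
  fixes B :: "complex^'n^'n"
  assumes B: "B \<in> above_id"
  shows "B ** matrix_inv B = mat 1" "matrix_inv B ** B = mat 1" "hermitian (matrix_inv B)"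
    "norm (matrix_inv B) \<le> CARD('n)"
proof -
  obtain u d where u: "onb UNIV u" "B = specmat UNIV u d" "\<And>i. d i \<ge> 1"
    "matrix_inv B = specmat UNIV u (\<lambda>i. 1 / d i)"
    using above_id_spectral[OF B] by metis
  have eq: "(\<lambda>i. d i * (1 / d i)) = (\<lambda>_. 1)"
  proof
    show "d i * (1 / d i) = 1" for i using u(3)[of i] by simp
  qed
  show 1: "B ** matrix_inv B = mat 1"
    unfolding u(4) unfolding u(2) specmat_mult[OF u(1)] eq
    by (simp add: specmat_1[OF u(1), of 0] idmat_UNIV)
  then show "matrix_inv B ** B = mat 1" using matrix_left_right_inverse by blast
  show "hermitian (matrix_inv B)" by (simp add: u(4) hermitian_specmat)
  have "norm (matrix_inv B) \<le> (\<Sum>i\<in>UNIV. \<bar>1 / d i\<bar>)"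
    unfolding u(4) by (rule norm_specmat_le[OF u(1)])
  also have "\<dots> \<le> (\<Sum>i\<in>(UNIV::'n set). 1)"
  proof (rule sum_mono)
    show "\<bar>1 / d i\<bar> \<le> 1" for i using u(3)[of i] by simp
  qed
  finally show "norm (matrix_inv B) \<le> CARD('n)" by simp
qed

text \<open>By the resolvent identity \<open>B\<^sup>-\<^sup>1 - C\<^sup>-\<^sup>1 = B\<^sup>-\<^sup>1 (C - B) C\<^sup>-\<^sup>1\<close>.\<close>

lemma matrix_inv_lipschitz:
  fixes B C :: "complex^'n^'n"
  assumes B: "B \<in> above_id" and C: "C \<in> above_id"
  shows "norm (matrix_inv B - matrix_inv C) \<le> (CARD('n))\<^sup>2 * norm (B - C)"
proof -
  note b = above_id_inverse[OF B] and c = above_id_inverse[OF C]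
  have "matrix_inv B ** (C - B) ** matrix_inv C = matrix_inv B ** (C ** matrix_inv C) - (matrix_inv B ** B) ** matrix_inv C"
    by (simp only: matmul matrix_mul_assoc)
  also have "\<dots> = matrix_inv B - matrix_inv C" by (simp add: b c)
  finally have "norm (matrix_inv B - matrix_inv C) = norm (matrix_inv B ** (C - B) ** matrix_inv C)" by simp
  also have "\<dots> \<le> (norm (matrix_inv B) * norm (C - B)) * norm (matrix_inv C)"
    by (rule norm_matrix_mult3_le)
  also have "\<dots> \<le> (CARD('n) * norm (C - B)) * CARD('n)"
    using b(4) c(4) by (intro mult_mono) auto
  finally show ?thesis by (simp add: power2_eq_square norm_minus_commute mult_ac)
qed

lemma continuous_on_norm_lipschitz:
  fixes f :: "'a::real_normed_vector \<Rightarrow> 'b::real_normed_vector"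
  assumes "c \<ge> 0" "\<And>x y. x \<in> S \<Longrightarrow> y \<in> S \<Longrightarrow> norm (f x - f y) \<le> c * norm (x - y)"
  shows "continuous_on S f"
  by (rule lipschitz_on_continuous_on[of c], rule lipschitz_onI) (use assms in \<open>auto simp: dist_norm\<close>)

lemma continuous_matrix_inv: "continuous_on above_id (matrix_inv :: complex^'n^'n \<Rightarrow> _)"
  by (rule continuous_on_norm_lipschitz[OF _ matrix_inv_lipschitz]) auto

lemma det_specmat:
  fixes u :: "'n::finite \<Rightarrow> complex^'n"
  assumes u: "onb UNIV u"
  shows "det (specmat UNIV u d) = of_real (\<Prod>i\<in>UNIV. d i)"
proof -
  define U :: "complex^'n^'n" where "U = (\<chi> a i. u i $ a)"
  define D :: "complex^'n^'n" where "D = (\<chi> i j. if i = j then of_real (d i) else 0)"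
  have "U ** D = (\<chi> a j. u j $ a * of_real (d j))"
    by (simp add: vec_eq_iff U_def D_def matrix_matrix_mult_def if_distrib[of "\<lambda>x. _ * x"] cong: if_cong)
  then have s: "specmat UNIV u d = (U ** D) ** adj U"
    by (simp add: vec_eq_iff specmat_def ketbra_def matrix_matrix_mult_def adj_def U_def)
      (simp add: scaleR_conv_of_real mult_ac)
  have "adj U ** U = mat 1"
    using onbD(2)[OF u] by (simp add: vec_eq_iff matrix_matrix_mult_def adj_def U_def cinner_def mat_def)
  then have "det (adj U) * det U = 1" by (metis det_mul det_I)
  moreover have "det D = of_real (\<Prod>i\<in>UNIV. d i)"
    by (subst det_diagonal) (auto simp: D_def)
  ultimately show ?thesis by (simp add: s det_mul mult_ac)
qed

lemma above_id_det: "B \<in> above_id \<Longrightarrow> Re (det B) \<ge> 1"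
proof -
  assume B: "B \<in> above_id"
  obtain u d where u: "onb UNIV u" "B = specmat UNIV u d" "\<And>i. d i \<ge> 1"
    using above_id_spectral[OF B] by metis
  show ?thesis using u(3) by (simp add: u(2) det_specmat[OF u(1)] prod_ge_1 del: of_real_prod)
qed

text \<open>Concavity of the log-determinant: with a Hermitian square root \<open>E\<close> of the inverse of \<open>B\<close>, the
  eigenvalues \<open>c\<close> of \<open>E C E\<close> satisfy \<open>ln c \<le> c - 1\<close>.\<close>

lemma logdet_concave:
  fixes B C :: "complex^'n^'n"
  assumes B: "B \<in> above_id" and C: "C \<in> above_id"
  shows "ln (Re (det C)) \<le> ln (Re (det B)) + matrix_inv B \<bullet> (C - B)"
proof -
  obtain u d where u: "onb UNIV u" "B = specmat UNIV u d" "\<And>i. d i \<ge> 1"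
    "matrix_inv B = specmat UNIV u (\<lambda>i. 1 / d i)"
    using above_id_spectral[OF B] by metis
  have dpos: "d i > 0" for i using u(3)[of i] by simp
  define E where "E = specmat UNIV u (\<lambda>i. 1 / sqrt (d i))"
  have hE: "adj E = E" using hermitian_specmat by (simp add: E_def hermitian_def)
  have EE: "E ** E = matrix_inv B"
    unfolding E_def specmat_mult[OF u(1)] u(4)
    using dpos by (simp add: less_imp_le flip: real_sqrt_mult)
  define G where "G = E ** C ** E"
  have hC: "adj C = C" using C by (simp add: above_id_def hermitian_def)
  have hG: "hermitian G" by (simp add: G_def hermitian_def adj_mult hE hC matrix_mul_assoc)
  obtain v c where v: "onb UNIV v" "G = specmat UNIV v c"
    using spectral_decomposition[OF hG supported_UNIV] by blast
  have cpos: "c i > 0" for i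
  proof -
    have "c i = v i \<bullet> (G *v v i)"
      using specmat_eigen[OF v(1), of i c] onb_norm[OF v(1), of i]
      by (simp add: v(2) flip: power2_norm_eq_inner)
    also have "\<dots> = (E *v v i) \<bullet> (C *v (E *v v i))"
      using inner_adj[of E "v i" "C *v (E *v v i)"]
      by (simp add: G_def hE flip: matrix_vector_mul_assoc)
    also have "\<dots> \<ge> (E *v v i) \<bullet> (E *v v i)" using C by (simp add: above_id_def)
    finally have "c i \<ge> (E *v v i) \<bullet> (E *v v i)" .
    moreover have "E *v v i \<noteq> 0"
    proof
      assume "E *v v i = 0"
      then have "B *v (E *v (E *v v i)) = 0" by (simp add: matvec)
      then have "(B ** (E ** E)) *v v i = 0" by (simp flip: matrix_vector_mul_assoc)
      then show False using above_id_inverse(1)[OF B] onb_norm[OF v(1), of i] by (simp add: EE)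
    qed
    ultimately show ?thesis by (metis inner_gt_zero_iff less_le_trans)
  qed
  have detG: "det G = det C / det B"
  proof -
    have "det E * det E * det B = 1"
      using EE above_id_inverse(2)[OF B] by (metis det_mul det_I)
    then have "det E * det E = 1 / det B"
      by (metis nonzero_eq_divide_eq mult_zero_right zero_neq_one)
    moreover have "det G = det C * (det E * det E)" by (simp add: G_def det_mul)
    ultimately show ?thesis by simp
  qed
  have rB: "det B = of_real (Re (det B))"
    by (simp add: u(2) det_specmat[OF u(1)] del: of_real_prod)
  have "Re (det G) = Re (det C) / Re (det B)"
    unfolding detG by (subst rB) simp
  moreover have "Re (det G) = (\<Prod>i\<in>UNIV. c i)"
    by (simp add: v(2) det_specmat[OF v(1)] del: of_real_prod)
  ultimately have "ln (Re (det C) / Re (det B)) = ln (\<Prod>i\<in>UNIV. c i)" by simp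
  also have "\<dots> = (\<Sum>i\<in>UNIV. ln (c i))" by (rule ln_prod) (auto, metis cpos less_irrefl)
  also have "\<dots> \<le> (\<Sum>i\<in>UNIV. c i - 1)"
    by (intro sum_mono ln_le_minus_one cpos)
  also have "\<dots> = idmat UNIV \<bullet> G - CARD('n)"
    using idmat_inner_supported[OF supported_UNIV, of G] trace_specmat[OF v(1), of c]
    by (simp add: v(2) sum_subtractf)
  also have "idmat UNIV \<bullet> G = matrix_inv B \<bullet> C"
    using inner_gain[of "mat 1" E C] by (simp add: idmat_UNIV G_def hE EE)
  also have "matrix_inv B \<bullet> C - CARD('n) = matrix_inv B \<bullet> (C - B)"
  proof -
    have "matrix_inv B \<bullet> B = idmat UNIV \<bullet> (idmat UNIV :: complex^'n^'n)"
      using above_id_inverse(1,3)[OF B] inner_mult_left[of "mat 1" "matrix_inv B" B] above_id_inverse(2)[OF B]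
      by (simp add: idmat_UNIV hermitian_def)
    then show ?thesis by (simp add: idmat_inner_idmat inner_diff_right)
  qed
  finally have "ln (Re (det C) / Re (det B)) \<le> matrix_inv B \<bullet> (C - B)" .
  moreover have "ln (Re (det C) / Re (det B)) = ln (Re (det C)) - ln (Re (det B))"
    using above_id_det[OF B] above_id_det[OF C] by (subst ln_div) auto
  ultimately show ?thesis by simp
qed

lemma psd_congruence: "psd X \<Longrightarrow> psd (G ** X ** adj G)"
proof -
  assume X: "psd X"
  have "v \<bullet> ((G ** X ** adj G) *v v) = (adj G *v v) \<bullet> (X *v (adj G *v v))" for v
    using inner_adj[of G v "X *v (adj G *v v)"] by (simp flip: matrix_vector_mul_assoc)
  then show ?thesis using X by (simp add: psd_iff)
qed

lemma W_on_above_id: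
  assumes "\<And>l. l \<in> U \<Longrightarrow> hermitian (X $ l) \<and> psd (X $ l)" "\<And>l. P l > 0"
  shows "W_on U P X H \<in> above_id"
proof -
  have "hermitian (W_on U P X H)"
    using assms unfolding W_on_def
    by (intro hermitian_add hermitian_sum hermitian_scaleR)
      (auto simp: hermitian_def adj_mult matrix_mul_assoc)
  moreover have "v \<bullet> v \<le> v \<bullet> (W_on U P X H *v v)" for v
  proof -
    have "0 \<le> v \<bullet> ((P l *\<^sub>R (H $ l ** X $ l ** adj (H $ l))) *v v)" if "l \<in> U" for l
      using assms(1)[OF that] assms(2)[of l] psd_congruence[of "X $ l" "H $ l"]
      by (simp add: matvec psd_iff)
    then show ?thesis
      unfolding W_on_def by (simp add: matvec matvec_sum inner_add_right inner_sum_right sum_nonneg)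
  qed
  ultimately show ?thesis by (simp add: above_id_def)
qed

definition profiles :: "('k::finite \<Rightarrow> 'm::finite set) \<Rightarrow> ('k, 'm) profile set" where
  "profiles A = {X. \<forall>k. X $ k \<in> density_mats (A k)}"

lemma action_set_density: "action_set A k = density_mats (A k)"
  by (simp add: action_set_def density_mats_def)

lemma profilesD: "X \<in> profiles A \<Longrightarrow> X $ k \<in> density_mats (A k)"
  by (simp add: profiles_def)

lemma W_above_id: "X \<in> profiles A \<Longrightarrow> (\<And>l. P l > 0) \<Longrightarrow> W P X H \<in> above_id"
  by (rule W_on_above_id) (auto dest: profilesD densityD)

lemma profiles_compact:
  fixes A :: "'a::finite \<Rightarrow> 'b::finite set"
  shows "compact (profiles A)"
proof -
  have "profiles A = (\<Inter>k. {X. X $ k \<in> density_mats (A k)})" by (auto simp: profiles_def)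
  moreover have "closed {X::('a,'b) profile. X $ k \<in> density_mats (A k)}" for k
    using closed_vimage[OF density_closed, of "\<lambda>X::('a,'b) profile. X $ k" "A k"]
      continuous_on_component[OF continuous_on_id, of UNIV k]
    by (simp add: vimage_def)
  ultimately have "closed (profiles A)" by (metis (no_types, lifting) closed_INT)
  moreover have "norm X \<le> real CARD('a)" if "X \<in> profiles A" for X :: "('a,'b) profile"
  proof -
    have "norm X \<le> (\<Sum>k\<in>UNIV. norm (X $ k))" by (simp add: norm_vec_def L2_set_le_sum)
    also have "\<dots> \<le> (\<Sum>k\<in>(UNIV::'a set). 1)"
      using that by (intro sum_mono density_norm_le) (auto dest: profilesD)
    finally show ?thesis by simp
  qed
  ultimately show ?thesis by (auto simp: compact_eq_bounded_closed bounded_iff)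
qed

lemma profiles_convex: "convex (profiles A)"
  unfolding convex_def profiles_def
  by (auto intro!: convexD[OF density_convex])

lemma adj_continuous: "continuous_on S adj"
  by (rule linear_continuous_on[OF linear_conv_bounded_linear[THEN iffD1, OF linear_adj]])

lemmas matrix_continuous_intros =
  bounded_bilinear.continuous_on[OF bounded_bilinear_matrix_mult]
  continuous_on_compose2[OF adj_continuous[of UNIV]]

lemma continuous_W: "continuous_on S (\<lambda>H. W_on U P X H)" "continuous_on S' (\<lambda>X. W_on U P X H)"
  unfolding W_on_def by (intro continuous_intros matrix_continuous_intros subset_UNIV)+

lemma continuous_det: "continuous_on S f \<Longrightarrow> continuous_on S (\<lambda>x. det (f x :: complex^'n^'n))"
  unfolding det_def by (intro continuous_intros)

definition effective_gain :: "('k::finite \<Rightarrow> real) \<Rightarrow> 'k \<Rightarrow> ('k, 'm::finite) profile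
    \<Rightarrow> ('k, 'n::finite, 'm) channel \<Rightarrow> complex^'m^'m" where
  "effective_gain P k X H = adj (H $ k) ** matrix_inv (W P X H) ** H $ k"

lemma norm_gain_le:
  fixes G :: "complex^'m^'n"
  assumes "B \<in> above_id" "norm G \<le> b"
  shows "norm (adj G ** matrix_inv B ** G) \<le> b\<^sup>2 * CARD('n)"
proof -
  have b: "b \<ge> 0" using assms(2) norm_ge_zero order_trans by blast
  have "norm (adj G ** matrix_inv B ** G) \<le> (norm (adj G) * norm (matrix_inv B)) * norm G"
    by (rule norm_matrix_mult3_le)
  also have "\<dots> \<le> (b * CARD('n)) * b"
    using above_id_inverse(4)[OF assms(1)] assms(2) b by (intro mult_mono) (auto simp: norm_adj)
  finally show ?thesis by (simp add: power2_eq_square mult_ac)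
qed

lemma gain_herm:
  assumes "B \<in> above_id" "supported UNIV S G"
  shows "adj G ** matrix_inv B ** G \<in> herm S"
proof -
  have "hermitian (adj G ** matrix_inv B ** G)"
    using above_id_inverse(3)[OF assms(1)] by (simp add: hermitian_def adj_mult matrix_mul_assoc)
  moreover have "G $ i $ j = 0" if "j \<notin> S" for i j
    using assms(2) that by (auto simp: supported_def)
  then have "supported S S (adj G ** matrix_inv B ** G)"
    unfolding supported_def matrix_matrix_mult_def adj_def
    by (auto intro!: sum.neutral)
  ultimately show ?thesis by (simp add: herm_def)
qed

locale channel_law = prob_space L
  for L :: "('k::finite, 'n::finite, 'm::finite) channel measure" +
  fixes A :: "'k \<Rightarrow> 'm set" and P :: "'k \<Rightarrow> real" and b :: real
  assumes A_nonempty: "\<And>k. A k \<noteq> {}"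
    and P_pos: "\<And>k. P k > 0"
    and sets_L: "sets L = sets borel"
    and L_bounded: "AE H in L. norm H \<le> b"
    and L_supported: "AE H in L. \<forall>k. supported UNIV (A k) (H $ k)"
begin

lemma measurable_continuous: "continuous_on UNIV f \<Longrightarrow> f \<in> borel_measurable L"
  by (subst measurable_cong_sets[OF sets_L refl]) (rule borel_measurable_continuous_onI)

lemma W_above: "X \<in> profiles A \<Longrightarrow> W P X H \<in> above_id"
  by (rule W_above_id) (auto simp: P_pos)

lemma effective_gain_continuous:
  assumes "X \<in> profiles A" shows "continuous_on UNIV (effective_gain P k X)"
  unfolding effective_gain_def
  by (intro matrix_continuous_intros continuous_on_compose2[OF continuous_matrix_inv] continuous_W
      continuous_intros) (use W_above[OF assms] in auto)

definition gain_bound :: real where "gain_bound = b\<^sup>2 * CARD('n)"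

lemma effective_gain_le:
  fixes H :: "('k, 'n, 'm) channel"
  shows "X \<in> profiles A \<Longrightarrow> norm H \<le> b \<Longrightarrow> norm (effective_gain P k X H) \<le> gain_bound"
  unfolding effective_gain_def gain_bound_def
  by (rule norm_gain_le[OF W_above order_trans[OF vec_norm_nth_le]])

lemma effective_gain_integrable:
  assumes "X \<in> profiles A" shows "integrable L (effective_gain P k X)"
  using L_bounded effective_gain_le[OF assms]
  by (intro integrable_const_bound[where B = gain_bound] measurable_continuous
      effective_gain_continuous assms) auto

lemma V_mean_eq: "V_mean P L k X = (\<integral>H. effective_gain P k X H \<partial>L)"
  by (simp add: V_mean_def effective_gain_def)

lemma integral_norm_le:
  fixes f :: "('k, 'n, 'm) channel \<Rightarrow> 'b::{banach, second_countable_topology}"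
  assumes "integrable L f" "AE H in L. norm (f H) \<le> c"
  shows "norm (\<integral>H. f H \<partial>L) \<le> c"
proof -
  have "norm (\<integral>H. f H \<partial>L) \<le> (\<integral>H. norm (f H) \<partial>L)" by (rule integral_norm_bound)
  also have "\<dots> \<le> c" by (rule integral_le_const) (use assms in auto)
  finally show ?thesis .
qed

lemma V_mean_bounded: "X \<in> profiles A \<Longrightarrow> norm (V_mean P L k X) \<le> gain_bound"
  unfolding V_mean_eq using L_bounded effective_gain_le
  by (intro integral_norm_le effective_gain_integrable) auto

lemma V_mean_herm:
  assumes X: "X \<in> profiles A"
  shows "V_mean P L k X \<in> herm (A k)"
proof -
  note int = effective_gain_integrable[OF X, of k]
  have ae: "AE H in L. effective_gain P k X H \<in> herm (A k)"
    using L_supported by eventually_elim (auto simp: effective_gain_def intro!: gain_herm W_above[OF X])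
  have "adj (V_mean P L k X) = (\<integral>H. adj (effective_gain P k X H) \<partial>L)"
    unfolding V_mean_eq
    by (rule integral_bounded_linear[symmetric, OF linear_conv_bounded_linear[THEN iffD1, OF linear_adj] int])
  also have "\<dots> = (\<integral>H. effective_gain P k X H \<partial>L)"
    by (rule integral_cong_AE)
      (use ae in \<open>auto simp: herm_def hermitian_def intro!: measurable_continuous matrix_continuous_intros effective_gain_continuous X\<close>)
  finally have h: "hermitian (V_mean P L k X)" by (simp add: hermitian_def V_mean_eq)
  have "V_mean P L k X $ i $ j = 0" if ij: "\<not> (i \<in> A k \<and> j \<in> A k)" for i j
  proof -
    have bl: "bounded_linear (\<lambda>M::complex^'m^'m. M $ i $ j)"
      by (intro bounded_linear_compose[OF bounded_linear_vec_nth] bounded_linear_vec_nth)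
    have "V_mean P L k X $ i $ j = (\<integral>H. effective_gain P k X H $ i $ j \<partial>L)"
      unfolding V_mean_eq by (rule integral_bounded_linear[symmetric, OF bl int])
    also have "\<dots> = 0"
      by (rule integral_eq_zero_AE) (use ae ij in \<open>auto simp: herm_def supported_def\<close>)
    finally show ?thesis .
  qed
  then show ?thesis using h by (auto simp: herm_def supported_def)
qed

lemma V_mean_continuous: "continuous_on (profiles A) (V_mean P L k)"
proof -
  have b0: "b \<ge> 0"
  proof (rule ccontr)
    assume "\<not> b \<ge> 0"
    then have "norm H \<le> b \<Longrightarrow> False" for H :: "('k, 'n, 'm) channel"
      using norm_ge_zero[of H] by linarith
    then have "AE H in L. False" by (intro eventually_mono[OF L_bounded])
    then show False by (simp add: AE_False)
  qed
  define c where "c = b * (real (CARD('n)))\<^sup>2 * (\<Sum>l\<in>UNIV. P l * b * b) * b"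
  have P0: "P l \<ge> 0" for l using P_pos[of l] by simp
  have c: "c \<ge> 0" unfolding c_def using b0 P0 by (simp add: sum_nonneg)
  have lip: "norm (V_mean P L k X - V_mean P L k Z) \<le> c * norm (X - Z)"
    if X: "X \<in> profiles A" and Z: "Z \<in> profiles A" for X Z
  proof -
    have pt: "norm (effective_gain P k X H - effective_gain P k Z H) \<le> c * norm (X - Z)"
      if H: "norm H \<le> b" for H :: "('k, 'n, 'm) channel"
    proof -
      have Hk: "norm (H $ l) \<le> b" for l
        using H vec_norm_nth_le[of H l] by simp
      have "W P X H - W P Z H = (\<Sum>l\<in>UNIV. P l *\<^sub>R (H $ l ** (X $ l - Z $ l) ** adj (H $ l)))"
        by (simp add: W_on_def matmul sum_subtractf scaleR_diff_right)
      also have "norm \<dots> \<le> (\<Sum>l\<in>UNIV. P l * ((b * norm (X - Z)) * b))"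
      proof (rule sum_norm_le)
        fix l
        have "norm (H $ l ** (X $ l - Z $ l) ** adj (H $ l)) \<le> (norm (H $ l) * norm (X $ l - Z $ l)) * norm (H $ l)"
          using norm_matrix_mult3_le[of "H $ l" "X $ l - Z $ l" "adj (H $ l)"] by (simp only: norm_adj)
        also have "\<dots> \<le> (b * norm (X - Z)) * b"
          using Hk[of l] b0 vec_norm_nth_le[of "X - Z" l] by (intro mult_mono) auto
        finally show "norm (P l *\<^sub>R (H $ l ** (X $ l - Z $ l) ** adj (H $ l))) \<le> P l * ((b * norm (X - Z)) * b)"
          using P0[of l] by (simp add: mult_left_mono)
      qed
      also have "\<dots> = (\<Sum>l\<in>UNIV. P l * b * b) * norm (X - Z)"
        unfolding sum_distrib_right by (intro sum.cong refl) simp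
      finally have w: "norm (W P X H - W P Z H) \<le> (\<Sum>l\<in>UNIV. P l * b * b) * norm (X - Z)" .
      have "effective_gain P k X H - effective_gain P k Z H
          = adj (H $ k) ** (matrix_inv (W P X H) - matrix_inv (W P Z H)) ** H $ k"
        by (simp add: effective_gain_def matmul)
      also have "norm \<dots> \<le> (norm (H $ k) * norm (matrix_inv (W P X H) - matrix_inv (W P Z H))) * norm (H $ k)"
        using norm_matrix_mult3_le[of "adj (H $ k)" "matrix_inv (W P X H) - matrix_inv (W P Z H)" "H $ k"]
        by (simp only: norm_adj)
      also have "\<dots> \<le> (b * ((real CARD('n))\<^sup>2 * ((\<Sum>l\<in>UNIV. P l * b * b) * norm (X - Z)))) * b"
      proof (intro mult_mono)
        have "norm (matrix_inv (W P X H) - matrix_inv (W P Z H)) \<le> (real CARD('n))\<^sup>2 * norm (W P X H - W P Z H)"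
          using matrix_inv_lipschitz[OF W_above[OF X, of H] W_above[OF Z, of H]] by simp
        also have "\<dots> \<le> (real CARD('n))\<^sup>2 * ((\<Sum>l\<in>UNIV. P l * b * b) * norm (X - Z))"
          by (rule mult_left_mono[OF w]) simp
        finally show "norm (matrix_inv (W P X H) - matrix_inv (W P Z H)) \<le> (real CARD('n))\<^sup>2 * ((\<Sum>l\<in>UNIV. P l * b * b) * norm (X - Z))" .
      qed (use Hk[of k] b0 P0 in \<open>auto intro!: mult_nonneg_nonneg sum_nonneg\<close>)
      finally show ?thesis by (simp add: c_def mult_ac)
    qed
    have "V_mean P L k X - V_mean P L k Z = (\<integral>H. effective_gain P k X H - effective_gain P k Z H \<partial>L)"
      unfolding V_mean_eq by (rule Bochner_Integration.integral_diff[symmetric]) (intro effective_gain_integrable X Z)+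
    also have "norm \<dots> \<le> c * norm (X - Z)"
      by (rule integral_norm_le) (use L_bounded pt in \<open>auto intro!: effective_gain_integrable X Z Bochner_Integration.integrable_diff\<close>)
    finally show ?thesis .
  qed
  show ?thesis by (rule continuous_on_norm_lipschitz[OF c lip])
qed

definition rate :: "('k, 'm) profile \<Rightarrow> real" where
  "rate X = (\<integral>H. ln (Re (det (W P X H))) \<partial>L)"

lemma logdet_integrable:
  assumes X: "X \<in> profiles A"
  shows "integrable L (\<lambda>H. ln (Re (det (W_on U P X H))))"
proof -
  have above: "W_on U P X H \<in> above_id" for H :: "('k, 'n, 'm) channel"
    by (rule W_on_above_id) (use X P_pos in \<open>auto dest: profilesD densityD\<close>)
  have pos: "Re (det (W_on U P X H)) > 0" for H :: "('k, 'n, 'm) channel"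
    by (rule less_le_trans[OF zero_less_one above_id_det[OF above]])
  have cont: "continuous_on S (\<lambda>H::('k, 'n, 'm) channel. ln (Re (det (W_on U P X H))))" for S
  proof -
    have "\<forall>H\<in>S. Re (det (W_on U P X H)) \<noteq> 0" using pos by (metis less_irrefl)
    then show ?thesis by (intro continuous_on_ln continuous_on_Re continuous_det continuous_W)
  qed
  have "bounded ((\<lambda>H. ln (Re (det (W_on U P X H)))) ` cball (0::('k, 'n, 'm) channel) b)"
    by (intro compact_imp_bounded compact_continuous_image cont) simp
  then obtain c where "\<forall>y\<in>(\<lambda>H. ln (Re (det (W_on U P X H)))) ` cball (0::('k, 'n, 'm) channel) b. norm y \<le> c"
    unfolding bounded_iff by (rule exE)
  then have "norm (ln (Re (det (W_on U P X H)))) \<le> c" if "norm H \<le> b" for H :: "('k, 'n, 'm) channel"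
    by (rule bspec) (rule imageI, simp only: mem_cball_0 that)
  then show ?thesis
    using L_bounded by (intro integrable_const_bound[where B = c] measurable_continuous cont) auto
qed

text \<open>This averages the concavity of the log-determinant over the channels: \<open>W\<close> is affine in the
  profile, and moving the channel matrices to the other side of the trace pairing turns the inverse
  of \<open>W\<close> into the effective gains.\<close>

lemma rate_concave:
  assumes X: "X \<in> profiles A" and Z: "Z \<in> profiles A"
  shows "rate Z \<le> rate X + (\<Sum>k\<in>UNIV. P k * (V_mean P L k X \<bullet> (Z $ k - X $ k)))"
proof -
  have "rate Z \<le> (\<integral>H. ln (Re (det (W P X H))) + (\<Sum>k\<in>UNIV. P k * (effective_gain P k X H \<bullet> (Z $ k - X $ k))) \<partial>L)"
    unfolding rate_def
  proof (rule integral_mono)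
    fix H :: "('k, 'n, 'm) channel"
    have "W P Z H - W P X H = (\<Sum>l\<in>UNIV. P l *\<^sub>R (H $ l ** (Z $ l - X $ l) ** adj (H $ l)))"
      by (simp add: W_on_def matmul sum_subtractf scaleR_diff_right)
    then have "matrix_inv (W P X H) \<bullet> (W P Z H - W P X H)
        = (\<Sum>k\<in>UNIV. P k * (effective_gain P k X H \<bullet> (Z $ k - X $ k)))"
      by (simp add: inner_sum_right inner_gain effective_gain_def)
    then show "ln (Re (det (W P Z H))) \<le> ln (Re (det (W P X H))) + (\<Sum>k\<in>UNIV. P k * (effective_gain P k X H \<bullet> (Z $ k - X $ k)))"
      using logdet_concave[OF W_above[OF X, of H] W_above[OF Z, of H]] by simp
  qed (intro Bochner_Integration.integrable_add logdet_integrable X Z Bochner_Integration.integrable_sum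
      integrable_mult_right integrable_inner_left effective_gain_integrable)+
  also have "\<dots> = rate X + (\<Sum>k\<in>UNIV. P k * (V_mean P L k X \<bullet> (Z $ k - X $ k)))"
    unfolding rate_def V_mean_eq using logdet_integrable[OF X] effective_gain_integrable[OF X]
    by (subst Bochner_Integration.integral_add) auto
  finally show ?thesis .
qed

lemma V_mean_monotone:
  assumes X: "X \<in> profiles A" and Z: "Z \<in> profiles A"
  shows "(\<Sum>k\<in>UNIV. P k * ((Z $ k - X $ k) \<bullet> (V_mean P L k Z - V_mean P L k X))) \<le> 0"
proof -
  have "0 \<le> (\<Sum>k\<in>UNIV. P k * (V_mean P L k X \<bullet> (Z $ k - X $ k))) + (\<Sum>k\<in>UNIV. P k * (V_mean P L k Z \<bullet> (X $ k - Z $ k)))"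
    using rate_concave[OF X Z] rate_concave[OF Z X] by simp
  also have "\<dots> = - (\<Sum>k\<in>UNIV. P k * ((Z $ k - X $ k) \<bullet> (V_mean P L k Z - V_mean P L k X)))"
    by (simp add: sum_negf[symmetric] sum.distrib[symmetric] inner_diff inner_commute algebra_simps)
  finally show ?thesis by simp
qed

lemma rate_continuous: "continuous_on (profiles A) rate"
proof -
  define c where "c = (\<Sum>k\<in>UNIV. P k * gain_bound)"
  have gb: "gain_bound \<ge> 0" by (simp add: gain_bound_def)
  have c: "c \<ge> 0" using gb P_pos by (auto simp: c_def less_imp_le intro!: sum_nonneg)
  have le: "rate Z - rate X \<le> c * norm (Z - X)" if X: "X \<in> profiles A" and Z: "Z \<in> profiles A" for X Z
  proof -
    have "rate Z - rate X \<le> (\<Sum>k\<in>UNIV. P k * (V_mean P L k X \<bullet> (Z $ k - X $ k)))"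
      using rate_concave[OF X Z] by simp
    also have "\<dots> \<le> (\<Sum>k\<in>UNIV. P k * (gain_bound * norm (Z - X)))"
    proof (intro sum_mono mult_left_mono)
      show "V_mean P L k X \<bullet> (Z $ k - X $ k) \<le> gain_bound * norm (Z - X)" for k
        using V_mean_bounded[OF X, of k] vec_norm_nth_le[of "Z - X" k] gb
        by (intro order_trans[OF norm_cauchy_schwarz] mult_mono) auto
    qed (use P_pos in \<open>auto simp: less_imp_le\<close>)
    also have "\<dots> = c * norm (Z - X)" by (simp only: c_def sum_distrib_right mult.assoc)
    finally show ?thesis .
  qed
  show ?thesis
  proof (rule continuous_on_norm_lipschitz[OF c])
    show "norm (rate Z - rate X) \<le> c * norm (Z - X)" if "Z \<in> profiles A" "X \<in> profiles A" for Z X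
      using le[OF that(2,1)] le[OF that] by (simp add: norm_minus_commute abs_le_iff)
  qed
qed

text \<open>The sum rate is an exact potential of the game: the interference term in the utility of a user does
  not depend on the action of that user.\<close>

lemma nash_if_maximizes_rate:
  assumes X: "X \<in> profiles A" and max: "\<And>Z. Z \<in> profiles A \<Longrightarrow> rate Z \<le> rate X"
  shows "nash_equilibrium A P L X"
  unfolding nash_equilibrium_def
proof (intro conjI allI ballI)
  show "X $ k \<in> action_set A k" for k
    using profilesD[OF X] by (simp add: action_set_density)
  fix k Z assume Z: "Z \<in> action_set A k"
  have dev: "deviate X k Z \<in> profiles A"
    using X Z by (auto simp: profiles_def deviate_def action_set_density)
  have same: "W_on (UNIV - {k}) P (deviate X k Z) H = W_on (UNIV - {k}) P X H" for H :: "('k, 'n, 'm) channel"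
    unfolding W_on_def by (intro arg_cong2[of _ _ _ _ "(+)"] sum.cong) (auto simp: deviate_def)
  have "utility P L k X' = rate X' - (\<integral>H. ln (Re (det (W_on (UNIV - {k}) P X H))) \<partial>L)"
    if "X' = X \<or> X' = deviate X k Z" for X'
    unfolding utility_def rate_def using that same logdet_integrable[OF X] logdet_integrable[OF dev]
    by auto
  then show "utility P L k (deviate X k Z) \<le> utility P L k X"
    using max[OF dev] by simp
qed

section \<open>Equilibria of the entropy-regularized game\<close>

text \<open>The rest points of the dynamics \<open>Y' = V(X) - \<tau> Y\<close>.\<close>

definition entropic_equilibrium :: "real \<Rightarrow> ('k, 'm) profile \<Rightarrow> bool" where
  "entropic_equilibrium \<tau> X \<longleftrightarrow>
     X \<in> profiles A \<and> (\<forall>k. X $ k = exp_normalized (A k) ((1 / \<tau>) *\<^sub>R V_mean P L k X))"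

lemma entropic_equilibrium_exists: "\<exists>X. entropic_equilibrium \<tau> X"
proof -
  define F :: "('k, 'm) profile \<Rightarrow> ('k, 'm) profile"
    where "F X = (\<chi> k. exp_normalized (A k) ((1 / \<tau>) *\<^sub>R V_mean P L k X))" for X
  have mem: "(1 / \<tau>) *\<^sub>R V_mean P L k X \<in> herm (A k)" if "X \<in> profiles A" for k X
    using V_mean_herm[OF that] subspace_herm by (auto intro: subspace_scale)
  have "continuous_on (profiles A) F"
    unfolding F_def
    by (intro continuous_intros continuous_on_compose2[OF continuous_exp_normalized[OF A_nonempty]]
        V_mean_continuous) (use mem in auto)
  moreover have FX: "F \<in> profiles A \<rightarrow> profiles A"
    using exp_normalized_density[OF mem A_nonempty] by (auto simp: F_def profiles_def)
  moreover have "(\<chi> k. exp_normalized (A k) 0) \<in> profiles A"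
    using exp_normalized_density[OF subspace_0[OF subspace_herm] A_nonempty] by (auto simp: profiles_def)
  ultimately obtain X where X: "X \<in> profiles A" "F X = X"
    using brouwer[OF profiles_compact[of A] profiles_convex[of A]] by blast
  have "X $ k = exp_normalized (A k) ((1 / \<tau>) *\<^sub>R V_mean P L k X)" for k
    using arg_cong[OF X(2), of "\<lambda>Z. Z $ k"] unfolding F_def vec_lambda_beta by (rule sym)
  then show ?thesis using X(1) by (auto simp: entropic_equilibrium_def)
qed

text \<open>By the variational principle for the free energy, the regularization costs at most the
  largest entropies \<open>ln (card (A k))\<close>, weighted by \<open>\<tau>\<close> and the powers.\<close>

lemma entropic_equilibrium_almost_optimal:
  assumes X: "entropic_equilibrium \<tau> X" and \<tau>: "\<tau> > 0" and Z: "Z \<in> profiles A"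
  shows "rate Z \<le> rate X + \<tau> * (\<Sum>k\<in>UNIV. P k * ln (card (A k)))"
proof -
  have XP: "X \<in> profiles A" using X by (simp add: entropic_equilibrium_def)
  have "V_mean P L k X \<bullet> (Z $ k - X $ k) \<le> \<tau> * ln (card (A k))" for k
  proof -
    define Y where "Y = (1 / \<tau>) *\<^sub>R V_mean P L k X"
    have Y: "Y \<in> herm (A k)"
      unfolding Y_def using V_mean_herm[OF XP] subspace_herm by (auto intro: subspace_scale)
    have Xk: "X $ k = exp_normalized (A k) Y" using X by (simp add: entropic_equilibrium_def Y_def)
    have "Z $ k \<bullet> Y \<le> free_energy (A k) Y"
      by (rule density_inner_le_free_energy[OF profilesD[OF Z] Y A_nonempty])
    moreover have "free_energy (A k) Y + X $ k \<bullet> (0 - Y) \<le> free_energy (A k) 0"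
      unfolding Xk by (rule free_energy_convex[OF Y subspace_0[OF subspace_herm] A_nonempty])
    ultimately have "Y \<bullet> (Z $ k - X $ k) \<le> ln (card (A k))"
      by (simp add: free_energy_0[OF A_nonempty] inner_diff_right inner_commute)
    then show ?thesis using \<tau> by (simp add: Y_def pos_divide_le_eq mult.commute)
  qed
  then have "(\<Sum>k\<in>UNIV. P k * (V_mean P L k X \<bullet> (Z $ k - X $ k))) \<le> (\<Sum>k\<in>UNIV. P k * (\<tau> * ln (card (A k))))"
    using P_pos by (intro sum_mono mult_left_mono) (auto simp: less_imp_le)
  also have "\<dots> = \<tau> * (\<Sum>k\<in>UNIV. P k * ln (card (A k)))"
    by (simp add: sum_distrib_left mult_ac)
  finally show ?thesis using rate_concave[OF XP Z] by simp
qed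

text \<open>By compactness, almost optimal profiles are close to optimal ones.\<close>

theorem entropic_equilibria_approach_nash:
  assumes eq: "\<And>\<tau>. \<tau> > 0 \<Longrightarrow> entropic_equilibrium \<tau> (Xt \<tau>)"
  shows "\<exists>\<epsilon>. (\<epsilon> \<longlongrightarrow> 0) (at_right 0) \<and>
    (\<forall>\<tau>>0. \<exists>Xs. nash_equilibrium A P L Xs \<and> dist (Xt \<tau>) Xs \<le> \<epsilon> \<tau>)"
proof -
  define N where "N = {X \<in> profiles A. \<forall>Z\<in>profiles A. rate Z \<le> rate X}"
  have mem: "Xt \<tau> \<in> profiles A" if "\<tau> > 0" for \<tau> using eq[OF that] by (simp add: entropic_equilibrium_def)
  have "profiles A \<noteq> {}" using mem[of 1] by auto
  then obtain X0 where X0: "X0 \<in> profiles A" "\<And>Z. Z \<in> profiles A \<Longrightarrow> rate Z \<le> rate X0"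
    using continuous_attains_sup[OF profiles_compact _ rate_continuous] by blast
  have N: "N \<noteq> {}" using X0 by (auto simp: N_def)
  define E where "E = (\<Sum>k\<in>UNIV. P k * ln (card (A k)))"
  have E: "E \<ge> 0"
    unfolding E_def using P_pos A_nonempty
    by (intro sum_nonneg mult_nonneg_nonneg ln_ge_zero) (auto simp: less_imp_le Suc_le_eq card_gt_0_iff)
  have "((\<lambda>\<tau>. infdist (Xt \<tau>) N) \<longlongrightarrow> 0) (at_right 0)"
  proof (rule tendstoI)
    fix e :: real assume e: "e > 0"
    define K where "K = profiles A \<inter> {X. e \<le> infdist X N}"
    have K: "compact K"
      unfolding K_def by (intro compact_Int_closed profiles_compact closed_Collect_le continuous_intros)
    have "\<exists>t>0. \<forall>\<tau>>0. \<tau> < t \<longrightarrow> Xt \<tau> \<notin> K"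
    proof (cases "K = {}")
      case False
      then obtain X1 where X1: "X1 \<in> K" "\<And>Z. Z \<in> K \<Longrightarrow> rate Z \<le> rate X1"
        using continuous_attains_sup[OF K _ continuous_on_subset[OF rate_continuous]] by (auto simp: K_def)
      have "X1 \<notin> N" using X1(1) e by (auto simp: K_def)
      then have gap: "rate X1 < rate X0"
        using X1(1) X0 unfolding N_def K_def by (smt (verit) IntD1 mem_Collect_eq)
      show ?thesis
      proof (intro exI[of _ "(rate X0 - rate X1) / (E + 1)"] conjI allI impI notI)
        show "(rate X0 - rate X1) / (E + 1) > 0" using gap E by simp
        fix \<tau> assume \<tau>: "0 < \<tau>" "\<tau> < (rate X0 - rate X1) / (E + 1)" "Xt \<tau> \<in> K"
        have "rate X0 \<le> rate (Xt \<tau>) + \<tau> * E"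
          unfolding E_def by (rule entropic_equilibrium_almost_optimal[OF eq[OF \<tau>(1)] \<tau>(1) X0(1)])
        also have "\<dots> \<le> rate X1 + \<tau> * (E + 1)"
          using X1(2)[OF \<tau>(3)] \<tau>(1) by (intro add_mono mult_left_mono) auto
        also have "\<dots> < rate X0" using \<tau>(2) E by (simp add: pos_less_divide_eq)
        finally show False by simp
      qed
    qed (auto intro: exI[of _ 1])
    then obtain t where t: "t > 0" "\<And>\<tau>. 0 < \<tau> \<Longrightarrow> \<tau> < t \<Longrightarrow> Xt \<tau> \<notin> K" by blast
    show "\<forall>\<^sub>F \<tau> in at_right 0. dist (infdist (Xt \<tau>) N) 0 < e"
      unfolding eventually_at_right_field
    proof (intro exI conjI allI impI)
      fix \<tau> assume "0 < \<tau>" "\<tau> < t"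
      then show "dist (infdist (Xt \<tau>) N) 0 < e"
        using t(2) mem by (auto simp: K_def dist_real_def infdist_nonneg not_le)
    qed (use t in auto)
  qed
  \<comment> \<open>The summand \<open>\<tau>\<close> makes room for a maximizer that realizes the distance only approximately.\<close>
  moreover have "((\<lambda>\<tau>::real. \<tau>) \<longlongrightarrow> 0) (at_right 0)" by (rule tendsto_ident_at)
  ultimately have "((\<lambda>\<tau>. infdist (Xt \<tau>) N + \<tau>) \<longlongrightarrow> 0) (at_right 0)"
    using tendsto_add[of "\<lambda>\<tau>. infdist (Xt \<tau>) N" 0 "at_right 0" "\<lambda>\<tau>. \<tau>" 0] by simp
  moreover have "\<exists>Xs. nash_equilibrium A P L Xs \<and> dist (Xt \<tau>) Xs \<le> infdist (Xt \<tau>) N + \<tau>" if "\<tau> > 0" for \<tau>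
  proof -
    have "(INF a\<in>N. dist (Xt \<tau>) a) < infdist (Xt \<tau>) N + \<tau>"
      using that N by (simp add: infdist_notempty)
    then obtain Xs where "Xs \<in> N" "dist (Xt \<tau>) Xs < infdist (Xt \<tau>) N + \<tau>"
      using N by (auto simp: cInf_less_iff)
    then show ?thesis using nash_if_maximizes_rate[of Xs] by (auto simp: N_def intro: less_imp_le)
  qed
  ultimately show ?thesis by (intro exI[of _ "\<lambda>\<tau>. infdist (Xt \<tau>) N + \<tau>"]) auto
qed

end

section \<open>Asynchronous stochastic approximation along a path\<close>

definition tick_count :: "(nat \<Rightarrow> real) \<Rightarrow> real \<Rightarrow> nat" where
  "tick_count T t = card {j. j \<ge> 1 \<and> T j < t}"

text \<open>The ticks of a timer of positive finite rate along a single path.\<close>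

definition regular_ticks :: "(nat \<Rightarrow> real) \<Rightarrow> bool" where
  "regular_ticks T \<longleftrightarrow> strict_mono_on {1..} T \<and> (\<exists>c>0. (\<lambda>j. T j / real j) \<longlonglongrightarrow> c)"

lemma regular_ticks_at_top:
  assumes "regular_ticks T"
  shows "filterlim T at_top sequentially"
proof -
  obtain c where c: "c > 0" "(\<lambda>j. T j / real j) \<longlonglongrightarrow> c"
    using assms by (auto simp: regular_ticks_def)
  have "filterlim (\<lambda>j. T j / real j * real j) at_top sequentially"
    by (rule filterlim_tendsto_pos_mult_at_top[OF c(2,1) filterlim_real_sequentially])
  moreover have ev: "\<forall>\<^sub>F j in sequentially. T j / real j * real j = T j"
    using eventually_gt_at_top[of 0] by eventually_elim auto
  ultimately show ?thesis by (subst (asm) filterlim_cong[OF refl refl ev])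
qed

lemma strict_ticks_less_iff:
  fixes T :: "nat \<Rightarrow> real"
  assumes "strict_mono_on {1..} T" "i \<ge> 1" "j \<ge> 1"
  shows "T i < T j \<longleftrightarrow> i < j"
  using assms by (auto simp: strict_mono_on_def) (metis linorder_neqE_nat not_less_iff_gr_or_eq)

lemma strict_ticks_pred:
  fixes T :: "nat \<Rightarrow> real"
  assumes "strict_mono_on {1..} T" "j \<ge> 1"
  shows "j - 1 = 0 \<or> T (j - 1) < T j"
proof (cases "j - 1 = 0")
  case False
  then have "j - 1 \<ge> 1" "j - 1 < j" by auto
  then show ?thesis using strict_ticks_less_iff[OF assms(1) _ assms(2), of "j - 1"] by blast
qed simp

lemma strict_ticks_count_eq:
  fixes T :: "nat \<Rightarrow> real"
  assumes T: "strict_mono_on {1..} T" and n: "n = 0 \<or> T n < t" "t \<le> T (Suc n)"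
  shows "{j. j \<ge> 1 \<and> T j < t} = {1..n}" "tick_count T t = n"
proof -
  show eq: "{j. j \<ge> 1 \<and> T j < t} = {1..n}"
  proof (intro set_eqI iffI)
    fix j assume "j \<in> {j. j \<ge> 1 \<and> T j < t}"
    then have j: "j \<ge> 1" "T j < T (Suc n)" using n(2) by auto
    then have "j < Suc n" using strict_ticks_less_iff[OF T j(1), of "Suc n"] by simp
    then show "j \<in> {1..n}" using j by simp
  next
    fix j assume j: "j \<in> {1..n}"
    then have "T j \<le> T n" using strict_ticks_less_iff[OF T, of n j] by auto
    then show "j \<in> {j. j \<ge> 1 \<and> T j < t}" using j n by auto
  qed
  show "tick_count T t = n" unfolding tick_count_def eq by simp
qed

lemma tick_count_bracket:
  assumes "regular_ticks T"
  shows "tick_count T t = 0 \<or> T (tick_count T t) < t" "t \<le> T (Suc (tick_count T t))"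
proof -
  have T: "strict_mono_on {1..} T" using assms by (simp add: regular_ticks_def)
  have "\<exists>j. j \<ge> 1 \<and> t \<le> T j"
    using regular_ticks_at_top[OF assms] unfolding filterlim_at_top eventually_sequentially
    by (metis max.cobounded1 max.cobounded2)
  then have ex: "\<exists>n. t \<le> T (Suc n)" by (metis Suc_le_D One_nat_def)
  define n where "n = (LEAST n. t \<le> T (Suc n))"
  have n: "t \<le> T (Suc n)" unfolding n_def using ex by (rule LeastI_ex)
  have "n = 0 \<or> T n < t"
    using not_less_Least[of "n - 1" "\<lambda>n. t \<le> T (Suc n)"] by (cases n) (auto simp: n_def[symmetric] not_le)
  then have "tick_count T t = n" using strict_ticks_count_eq(2)[OF T _ n] by simp
  then show "tick_count T t = 0 \<or> T (tick_count T t) < t" "t \<le> T (Suc (tick_count T t))"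
    using n \<open>n = 0 \<or> T n < t\<close> by auto
qed

lemma less_iff_le_tick_count:
  assumes "regular_ticks T" "j \<ge> 1"
  shows "T j < t \<longleftrightarrow> j \<le> tick_count T t"
proof -
  have T: "strict_mono_on {1..} T" using assms by (simp add: regular_ticks_def)
  have "{j. j \<ge> 1 \<and> T j < t} = {1..tick_count T t}"
    by (rule strict_ticks_count_eq(1)[OF T tick_count_bracket[OF assms(1)]])
  then show ?thesis using assms(2) by (metis (mono_tags, lifting) atLeastAtMost_iff mem_Collect_eq)
qed

lemma tick_count_mono: "regular_ticks T \<Longrightarrow> s \<le> t \<Longrightarrow> tick_count T s \<le> tick_count T t"
  using less_iff_le_tick_count[of T "tick_count T s" s] less_iff_le_tick_count[of T "tick_count T s" t]
  by (cases "tick_count T s = 0") auto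

lemma tick_count_at_tick:
  assumes "regular_ticks T" "j \<ge> 1"
  shows "tick_count T (T j) = j - 1"
proof (rule strict_ticks_count_eq(2))
  show T: "strict_mono_on {1..} T" using assms by (simp add: regular_ticks_def)
  show "j - 1 = 0 \<or> T (j - 1) < T j" by (rule strict_ticks_pred[OF T assms(2)])
qed (use assms in auto)

lemma tick_count_at_top:
  assumes "regular_ticks T"
  shows "filterlim (tick_count T) at_top at_top"
  unfolding filterlim_at_top
proof
  fix n :: nat
  show "\<forall>\<^sub>F t in at_top. n \<le> tick_count T t"
    using eventually_gt_at_top[of "T (max 1 n)"]
  proof eventually_elim
    fix t assume "T (max 1 n) < t"
    then have "max 1 n \<le> tick_count T t" using less_iff_le_tick_count[OF assms, of "max 1 n" t] by simp
    then show "n \<le> tick_count T t" by simp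
  qed
qed

text \<open>The time \<open>t\<close> lies between two consecutive ticks, so \<open>t\<close> divided by the number of ticks inherits
  the limit of the timer.\<close>

lemma tick_count_rate:
  assumes "regular_ticks T"
  obtains c where "c > 0" "((\<lambda>t. t / (real (tick_count T t) + 1)) \<longlongrightarrow> c) at_top"
proof -
  let ?low = "\<lambda>t. T (tick_count T t) / real (tick_count T t) * (real (tick_count T t) / real (Suc (tick_count T t)))"
  obtain c where c: "c > 0" "(\<lambda>j. T j / real j) \<longlonglongrightarrow> c"
    using assms by (auto simp: regular_ticks_def)
  have up: "((\<lambda>t. T (Suc (tick_count T t)) / real (Suc (tick_count T t))) \<longlongrightarrow> c) at_top"
    by (rule filterlim_compose[OF LIMSEQ_Suc[OF c(2)] tick_count_at_top[OF assms]])
  have "(\<lambda>n. T n / real n * (real n / real (Suc n))) \<longlonglongrightarrow> c * 1"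
    by (intro tendsto_mult c(2) LIMSEQ_n_over_Suc_n)
  then have low: "(?low \<longlongrightarrow> c) at_top"
    using filterlim_compose[OF _ tick_count_at_top[OF assms]] by fastforce
  have "((\<lambda>t. t / (real (tick_count T t) + 1)) \<longlongrightarrow> c) at_top"
  proof (rule tendsto_sandwich[OF _ _ low up])
    have "\<forall>\<^sub>F t in at_top. 1 \<le> tick_count T t"
      using tick_count_at_top[OF assms] by (simp add: filterlim_at_top)
    then show "\<forall>\<^sub>F t in at_top. ?low t
        \<le> t / (real (tick_count T t) + 1)"
    proof eventually_elim
      fix t assume "1 \<le> tick_count T t"
      then show "?low t
        \<le> t / (real (tick_count T t) + 1)"
        using tick_count_bracket(1)[OF assms, of t] by (simp add: divide_right_mono add.commute)
    qed
    show "\<forall>\<^sub>F t in at_top. t / (real (tick_count T t) + 1) \<le> T (Suc (tick_count T t)) / real (Suc (tick_count T t))"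
      by (intro always_eventually allI) (simp add: divide_right_mono tick_count_bracket(2)[OF assms] add.commute)
  qed
  then show ?thesis using that c(1) by blast
qed

text \<open>The total step size that a user spends in the time window from \<open>t\<close> to \<open>a * t\<close>. It tends to
  \<open>ln a\<close> whatever the rate of the timer: the step sizes \<open>1 / (j + 1)\<close> make every user move at the
  same speed on the logarithmic time scale.\<close>

definition window_weight :: "(nat \<Rightarrow> real) \<Rightarrow> real \<Rightarrow> real \<Rightarrow> real" where
  "window_weight T a t = (\<Sum>j\<in>{tick_count T t<..tick_count T (a * t)}. 1 / (real j + 1))"

lemma sum_step_sizes:
  assumes "m \<le> n"
  shows "(\<Sum>j\<in>{m<..n}. 1 / (real j + 1)) = harm (Suc n) - harm (Suc m)"
  using assms
proof (induct n rule: dec_induct)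
  case (step n)
  then have "{m<..Suc n} = insert (Suc n) {m<..n}" by auto
  then have "(\<Sum>j\<in>{m<..Suc n}. 1 / (real j + 1)) = 1 / (real (Suc n) + 1) + (harm (Suc n) - harm (Suc m))"
    using step by simp
  moreover have "harm (Suc (Suc n)) = harm (Suc n) + inverse (real (Suc (Suc n)))"
    by (rule harm_Suc)
  ultimately show ?case by (simp add: inverse_eq_divide add.commute)
qed simp

lemma window_weight_tendsto:
  assumes T: "regular_ticks T" and a: "a > 1"
  shows "(window_weight T a \<longlongrightarrow> ln a) at_top"
proof -
  let ?r = "\<lambda>t. (real (tick_count T (a * t)) + 1) / (real (tick_count T t) + 1)"
  obtain c where c: "c > 0" "((\<lambda>t. t / (real (tick_count T t) + 1)) \<longlongrightarrow> c) at_top"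
    using tick_count_rate[OF T] by blast
  have at: "filterlim (\<lambda>t. a * t) at_top at_top"
    using a by (intro filterlim_tendsto_pos_mult_at_top[of _ a] filterlim_ident) auto
  have c2: "((\<lambda>t. a * t / (real (tick_count T (a * t)) + 1)) \<longlongrightarrow> c) at_top"
    by (rule filterlim_compose[OF c(2) at])
  have "((\<lambda>t. a * ((t / (real (tick_count T t) + 1)) / (a * t / (real (tick_count T (a * t)) + 1)))) \<longlongrightarrow> a * (c / c)) at_top"
    using c(1) by (intro tendsto_intros c(2) c2) auto
  moreover have "\<forall>\<^sub>F t in at_top. a * ((t / (real (tick_count T t) + 1)) / (a * t / (real (tick_count T (a * t)) + 1)))
      = ?r t"
  proof -
    have "a * ((t / x) / (a * t / y)) = y / x" if "0 < t" "0 < x" "0 < y" for t x y :: real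
      using that a by (simp add: field_simps)
    then show ?thesis
      by (intro eventually_mono[OF eventually_gt_at_top[of "0::real"]]) simp_all
  qed
  ultimately have "(?r \<longlongrightarrow> a) at_top"
    using c(1) tendsto_cong by force
  then have l: "((\<lambda>t. ln (?r t)) \<longlongrightarrow> ln a) at_top"
    using a by (intro tendsto_ln) auto
  define h where "h n = harm (Suc n) - ln (real (Suc n))" for n
  have h: "h \<longlonglongrightarrow> euler_mascheroni"
    unfolding h_def using LIMSEQ_Suc[OF euler_mascheroni_LIMSEQ] by simp
  have h1: "((\<lambda>t. h (tick_count T t)) \<longlongrightarrow> euler_mascheroni) at_top"
    by (rule filterlim_compose[OF h tick_count_at_top[OF T]])
  have h2: "((\<lambda>t. h (tick_count T (a * t))) \<longlongrightarrow> euler_mascheroni) at_top"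
    by (rule filterlim_compose[OF h1 at])
  have "((\<lambda>t. h (tick_count T (a * t)) - h (tick_count T t)
      + ln (?r t)) \<longlongrightarrow> (euler_mascheroni - euler_mascheroni) + ln a) at_top"
    by (intro tendsto_add tendsto_diff h1 h2 l)
  moreover have "\<forall>\<^sub>F t in at_top. h (tick_count T (a * t)) - h (tick_count T t)
      + ln (?r t) = window_weight T a t"
    using eventually_gt_at_top[of 0]
  proof eventually_elim
    fix t :: real assume "0 < t"
    then have "tick_count T t \<le> tick_count T (a * t)"
      using a by (intro tick_count_mono[OF T]) auto
    then show "h (tick_count T (a * t)) - h (tick_count T t)
      + ln (?r t) = window_weight T a t"
      unfolding window_weight_def by (subst sum_step_sizes) (auto simp: h_def ln_div add.commute)
  qed
  ultimately show ?thesis using tendsto_cong by force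
qed

lemma norm_vec_le_sum: "norm x \<le> (\<Sum>k\<in>UNIV. norm (x $ k))" for x :: "'e::real_normed_vector^'k"
  unfolding norm_vec_def by (rule L2_set_le_sum) simp

text \<open>Summation by parts: a sequence with vanishing averages contributes little to a window, since
  the step sizes decrease slowly.\<close>

lemma abel_window_bound:
  fixes x :: "nat \<Rightarrow> 'e::real_normed_vector"
  assumes mn: "m \<le> n" and \<eta>: "\<And>j. j \<ge> m \<Longrightarrow> norm (\<Sum>i\<in>{1..j}. x i) \<le> \<eta> * (real j + 1)"
  shows "norm (\<Sum>j\<in>{m<..n}. (1 / (real j + 1)) *\<^sub>R x j) \<le> \<eta> * (2 + (\<Sum>j\<in>{m<..n}. 1 / (real j + 1)))"
proof -
  define S where "S j = (\<Sum>i\<in>{1..j}. x i)" for j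
  \<comment> \<open>The summand of index \<open>j\<close> on the right compares the weights of \<open>S (j - 1)\<close> in \<open>x (j - 1)\<close> and \<open>x j\<close>.\<close>
  have id: "(\<Sum>j\<in>{m<..n}. (1 / (real j + 1)) *\<^sub>R x j) =
      (1 / (real n + 1)) *\<^sub>R S n - (1 / (real m + 1)) *\<^sub>R S m
      + (\<Sum>j\<in>{m<..n}. (1 / real j - 1 / (real j + 1)) *\<^sub>R S (j - 1))"
    using mn
  proof (induct n rule: dec_induct)
    case (step n)
    have "{m<..Suc n} = insert (Suc n) {m<..n}" using step by auto
    moreover have "S (Suc n) = S n + x (Suc n)" by (simp add: S_def)
    ultimately show ?case using step by (simp add: algebra_simps)
  qed simp
  have pos: "0 \<le> \<eta>"
  proof -
    have "0 \<le> norm (S m)" by simp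
    also have "\<dots> \<le> \<eta> * (real m + 1)" unfolding S_def by (rule \<eta>) simp
    finally show ?thesis by (simp add: zero_le_mult_iff)
  qed
  have b1: "norm ((1 / (real j + 1)) *\<^sub>R S j) \<le> \<eta>" if "j \<ge> m" for j
    using \<eta>[OF that] by (simp add: S_def pos_divide_le_eq)
  have b2: "norm ((1 / real j - 1 / (real j + 1)) *\<^sub>R S (j - 1)) \<le> \<eta> * (1 / (real j + 1))" if j: "j \<in> {m<..n}" for j
  proof -
    have jp: "real j > 0" using j by simp
    have "m \<le> j - 1" using j by auto
    from \<eta>[OF this] have "norm (S (j - 1)) \<le> \<eta> * real j"
      using j by (simp add: S_def of_nat_diff)
    moreover have "1 / real j - 1 / (real j + 1) = 1 / (real j * (real j + 1))"
      using jp by (simp add: field_simps)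
    ultimately have "norm ((1 / real j - 1 / (real j + 1)) *\<^sub>R S (j - 1)) \<le> (1 / (real j * (real j + 1))) * (\<eta> * real j)"
      using jp by (simp only: norm_scaleR) (intro mult_mono, auto)
    also have "\<dots> = \<eta> * (1 / (real j + 1))" using jp by simp
    finally show ?thesis .
  qed
  have "norm (\<Sum>j\<in>{m<..n}. (1 / (real j + 1)) *\<^sub>R x j)
      \<le> norm ((1 / (real n + 1)) *\<^sub>R S n) + norm ((1 / (real m + 1)) *\<^sub>R S m)
        + norm (\<Sum>j\<in>{m<..n}. (1 / real j - 1 / (real j + 1)) *\<^sub>R S (j - 1))"
    unfolding id by (meson norm_triangle_ineq norm_triangle_ineq4 add_mono order_refl order_trans)
  also have "\<dots> \<le> \<eta> + \<eta> + (\<Sum>j\<in>{m<..n}. \<eta> * (1 / (real j + 1)))"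
    by (intro add_mono b1 mn order_refl sum_norm_le b2)
  finally show ?thesis by (simp add: sum_distrib_left algebra_simps)
qed

lemma norm_sum3_le:
  "x = a + b + c \<Longrightarrow> norm a \<le> p \<Longrightarrow> norm b \<le> q \<Longrightarrow> norm x \<le> p + q + norm (c :: 'e::real_normed_vector)"
  by (metis add_mono norm_triangle_mono order_refl)

text \<open>User \<open>k\<close> has the score \<open>z k j\<close> after \<open>j\<close> ticks of the timer \<open>T k\<close>; \<open>g\<close> is the systematic part of
  the updates and \<open>\<xi>\<close> their noise. The scores of all users in force just before a real time
  make up the state.\<close>

locale async_path =
  fixes T :: "'k::finite \<Rightarrow> nat \<Rightarrow> real" and z :: "'k \<Rightarrow> nat \<Rightarrow> 'e::euclidean_space"
    and g \<xi> :: "'k \<Rightarrow> nat \<Rightarrow> 'e" and \<tau> C :: real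
    and K :: "('e^'k) set"
  assumes ticks: "\<And>k. regular_ticks (T k)"
    and recursion: "\<And>k j. j \<ge> 1 \<Longrightarrow> z k j = z k (j - 1) + (1 / (real j + 1)) *\<^sub>R (g k j + \<xi> k j - \<tau> *\<^sub>R z k (j - 1))"
    and \<tau>: "\<tau> > 0"
    and g_bounded: "\<And>k j. j \<ge> 1 \<Longrightarrow> norm (g k j) \<le> C"
    and \<xi>_bounded: "\<And>k j. j \<ge> 1 \<Longrightarrow> norm (\<xi> k j) \<le> C"
    and K_compact: "compact K"
    and state_mem: "\<And>t. (\<chi> k. z k (tick_count (T k) t)) \<in> K"
begin

definition state :: "real \<Rightarrow> 'e^'k" where
  "state t = (\<chi> k. z k (tick_count (T k) t))"

lemma K: "compact K" "state t \<in> K"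
  using K_compact state_mem by (simp_all add: state_def)

lemma state_at_tick: "j \<ge> 1 \<Longrightarrow> state (T k j) $ k = z k (j - 1)"
  by (simp add: state_def tick_count_at_tick[OF ticks])

definition bnd :: real where "bnd = (SOME r. r \<ge> 0 \<and> (\<forall>x\<in>K. norm x \<le> r))"

lemma bnd: "bnd \<ge> 0" "x \<in> K \<Longrightarrow> norm x \<le> bnd"
proof -
  have "\<exists>r. r \<ge> 0 \<and> (\<forall>x\<in>K. norm x \<le> r)"
    using compact_imp_bounded[OF K(1)] unfolding bounded_iff by (metis max.cobounded2 max.coboundedI1)
  from someI_ex[OF this] show "bnd \<ge> 0" "x \<in> K \<Longrightarrow> norm x \<le> bnd"
    by (auto simp: bnd_def)
qed

lemma z_bounded: "norm (z k j) \<le> bnd"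
proof -
  have "norm (state (T k (Suc j)) $ k) \<le> norm (state (T k (Suc j)))" by (rule vec_norm_nth_le)
  also have "\<dots> \<le> bnd" by (rule bnd(2)[OF K(2)])
  finally show ?thesis by (simp add: state_at_tick)
qed

definition speed :: real where "speed = C + C + \<tau> * bnd"

lemma speed_nonneg: "speed \<ge> 0"
  using bnd(1) \<tau> order_trans[OF norm_ge_zero g_bounded[of 1]] by (simp add: speed_def)

lemma z_increments:
  assumes "m \<le> n"
  shows "z k n - z k m = (\<Sum>j\<in>{m<..n}. (1 / (real j + 1)) *\<^sub>R (g k j + \<xi> k j - \<tau> *\<^sub>R z k (j - 1)))"
  using assms
proof (induct n rule: dec_induct)
  case (step n)
  have "{m<..Suc n} = insert (Suc n) {m<..n}" using step by auto
  then show ?case using step recursion[of "Suc n" k] by (simp add: algebra_simps)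
qed simp

lemma z_increments_le:
  assumes "m \<le> n"
  shows "norm (z k n - z k m) \<le> speed * (\<Sum>j\<in>{m<..n}. 1 / (real j + 1))"
proof -
  have "norm ((1 / (real j + 1)) *\<^sub>R (g k j + \<xi> k j - \<tau> *\<^sub>R z k (j - 1))) \<le> speed * (1 / (real j + 1))"
    if "j \<in> {m<..n}" for j
  proof -
    have j: "j \<ge> 1" using that by auto
    have "norm (g k j + \<xi> k j - \<tau> *\<^sub>R z k (j - 1)) \<le> norm (g k j) + norm (\<xi> k j) + norm (\<tau> *\<^sub>R z k (j - 1))"
      by (meson norm_triangle_ineq norm_triangle_ineq4 add_mono order_refl order_trans)
    also have "\<dots> \<le> C + C + \<tau> * bnd"
      using z_bounded[of k "j - 1"] \<tau>
      by (intro add_mono g_bounded[OF j] \<xi>_bounded[OF j]) (simp add: mult_left_mono)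
    also have "\<dots> = speed" by (simp add: speed_def)
    finally show ?thesis by (simp add: divide_right_mono)
  qed
  then show ?thesis
    unfolding z_increments[OF assms] sum_distrib_left by (intro sum_norm_le) auto
qed

lemma state_difference_le:
  assumes "s \<le> t" "\<And>k. tick_count (T k) t \<le> tick_count (T k) s + N"
  shows "norm (state t - state s) \<le> (\<Sum>k\<in>UNIV. speed * (real N * (1 / (real (tick_count (T k) s) + 1))))"
proof -
  have "norm ((state t - state s) $ k) \<le> speed * (real N * (1 / (real (tick_count (T k) s) + 1)))" for k
  proof -
    let ?I = "{tick_count (T k) s<..tick_count (T k) t}"
    have "norm ((state t - state s) $ k) \<le> speed * (\<Sum>j\<in>?I. 1 / (real j + 1))"
      using z_increments_le[OF tick_count_mono[OF ticks assms(1)], of k] by (simp add: state_def)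
    also have "(\<Sum>j\<in>?I. 1 / (real j + 1)) \<le> of_nat (card ?I) * (1 / (real (tick_count (T k) s) + 1))"
      by (rule sum_bounded_above) (auto intro!: divide_left_mono)
    also have "\<dots> \<le> real N * (1 / (real (tick_count (T k) s) + 1))"
      using assms(2)[of k] by (intro mult_right_mono) auto
    finally show ?thesis using speed_nonneg by (simp add: mult_left_mono)
  qed
  then have "(\<Sum>k\<in>UNIV. norm ((state t - state s) $ k)) \<le> (\<Sum>k\<in>UNIV. speed * (real N * (1 / (real (tick_count (T k) s) + 1))))"
    by (rule sum_mono)
  with norm_vec_le_sum show ?thesis by (rule order_trans)
qed

end

locale async_recursion = async_path T z g \<xi> \<tau> C K
  for T :: "'k::finite \<Rightarrow> nat \<Rightarrow> real" and z :: "'k \<Rightarrow> nat \<Rightarrow> 'e::euclidean_space"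
    and g \<xi> :: "'k \<Rightarrow> nat \<Rightarrow> 'e" and \<tau> C :: real and K :: "('e^'k) set" +
  fixes f :: "'e^'k \<Rightarrow> 'e^'k"
  assumes noise: "\<And>k. (\<lambda>J. (1 / real J) *\<^sub>R (\<Sum>j\<in>{1..J}. \<xi> k j)) \<longlonglongrightarrow> 0"
    and f: "continuous_on K f"
    and tracking: "\<And>k. (\<lambda>j. g k j - f (state (T k j)) $ k) \<longlonglongrightarrow> 0"
begin

lemma ln_at_right_1: "((\<lambda>a. ln a) \<longlongrightarrow> (0::real)) (at_right 1)"
proof -
  have "((\<lambda>a::real. ln a) \<longlongrightarrow> ln 1) (at_right 1)" by (intro tendsto_ln tendsto_ident_at) simp
  then show ?thesis by simp
qed

lemma eventually_window_le:
  assumes a: "a > 1"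
  shows "\<forall>\<^sub>F t in at_top. \<forall>k. window_weight (T k) a t \<le> 2 * ln a"
proof -
  have *: "\<forall>\<^sub>F t in at_top. window_weight (T k) a t < 2 * ln a" for k
    using a by (intro order_tendstoD(2)[OF window_weight_tendsto[OF ticks a]]) simp
  have "\<forall>\<^sub>F t in at_top. window_weight (T k) a t \<le> 2 * ln a" for k
    by (rule eventually_mono[OF *[of k]]) simp
  then show ?thesis by (rule eventually_all_finite)
qed

text \<open>A bound that is independent of the noise, because single updates are bounded by the step size.\<close>

lemma window_moves_little:
  assumes d: "d > 0"
  shows "\<forall>\<^sub>F a in at_right 1. \<forall>\<^sub>F t in at_top. \<forall>s\<in>{t..a * t}. norm (state s - state t) < d"
proof -
  let ?c = "real CARD('k) * (speed * 2)"
  have "((\<lambda>a. ?c * ln a) \<longlongrightarrow> ?c * 0) (at_right 1)" by (intro tendsto_intros ln_at_right_1)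
  then have "\<forall>\<^sub>F a in at_right 1. ?c * ln a < d" using d by (intro order_tendstoD(2)) auto
  moreover have "\<forall>\<^sub>F a::real in at_right 1. a > 1" by (simp add: eventually_at_right_less)
  ultimately show ?thesis
  proof eventually_elim
    fix a :: real assume a: "?c * ln a < d" "a > 1"
    show "\<forall>\<^sub>F t in at_top. \<forall>s\<in>{t..a * t}. norm (state s - state t) < d"
      using eventually_window_le[OF a(2)]
    proof eventually_elim
      fix t assume t: "\<forall>k. window_weight (T k) a t \<le> 2 * ln a"
      show "\<forall>s\<in>{t..a * t}. norm (state s - state t) < d"
      proof
        fix s assume s: "s \<in> {t..a * t}"
        have "norm (state s $ k - state t $ k) \<le> speed * (2 * ln a)" for k
        proof -
          have le: "tick_count (T k) t \<le> tick_count (T k) s" "tick_count (T k) s \<le> tick_count (T k) (a * t)"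
            using s by (auto intro!: tick_count_mono ticks)
          have "norm (state s $ k - state t $ k) \<le> speed * (\<Sum>j\<in>{tick_count (T k) t<..tick_count (T k) s}. 1 / (real j + 1))"
            unfolding state_def using z_increments_le[OF le(1)] by simp
          also have "\<dots> \<le> speed * window_weight (T k) a t"
            unfolding window_weight_def using le
            by (intro mult_left_mono sum_mono2 speed_nonneg) auto
          also have "\<dots> \<le> speed * (2 * ln a)" using t by (intro mult_left_mono speed_nonneg) auto
          finally show ?thesis .
        qed
        then have "(\<Sum>k\<in>UNIV. norm ((state s - state t) $ k)) \<le> (\<Sum>k\<in>(UNIV::'k set). speed * (2 * ln a))"
          by (intro sum_mono) simp
        with norm_vec_le_sum have "norm (state s - state t) \<le> (\<Sum>k\<in>(UNIV::'k set). speed * (2 * ln a))"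
          by (rule order_trans)
        then show "norm (state s - state t) < d" using a(1) by (simp add: mult_ac)
      qed
    qed
  qed
qed

abbreviation drift :: "'e^'k \<Rightarrow> 'e^'k" where "drift x \<equiv> f x - \<tau> *\<^sub>R x"

lemma drift_bounded: "\<exists>r>0. \<forall>x\<in>K. norm (drift x) \<le> r"
proof -
  have "bounded (drift ` K)"
    by (intro compact_imp_bounded compact_continuous_image K(1) continuous_intros f)
  then show ?thesis unfolding bounded_pos by auto
qed

text \<open>The drift hardly changes within a short window, the step sizes in the window add up to about
  \<open>ln a\<close>, and summation by parts disposes of the noise. All three errors are small relative to the
  length \<open>ln a\<close> of the window on the logarithmic time scale.\<close>

lemma window_follows_drift_component:
  assumes \<epsilon>: "\<epsilon> > 0"
  shows "\<forall>\<^sub>F a in at_right 1. \<forall>\<^sub>F t in at_top.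
    norm ((state (a * t) - state t - ln a *\<^sub>R drift (state t)) $ k) \<le> \<epsilon> * ln a"
proof -
  have "uniformly_continuous_on K drift"
    by (intro compact_uniformly_continuous K(1) continuous_intros f)
  then obtain d where d: "d > 0" "\<And>x y. x \<in> K \<Longrightarrow> y \<in> K \<Longrightarrow> dist y x < d \<Longrightarrow> dist (drift y) (drift x) < \<epsilon> / 8"
    using \<epsilon> unfolding uniformly_continuous_on_def by (metis zero_less_divide_iff zero_less_numeral)
  obtain r where r: "r > 0" "\<And>x. x \<in> K \<Longrightarrow> norm (drift x) \<le> r" using drift_bounded by blast
  have "\<forall>\<^sub>F a::real in at_right 1. a > 1" by (simp add: eventually_at_right_less)
  with window_moves_little[OF d(1)] show ?thesis
  proof eventually_elim
    fix a :: real assume small: "\<forall>\<^sub>F t in at_top. \<forall>s\<in>{t..a * t}. norm (state s - state t) < d" and a: "a > 1"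
    have la: "ln a > 0" using a by simp
    \<comment> \<open>Chosen such that \<open>\<eta> * (2 + w) \<le> \<epsilon> * ln a / 4\<close> for every window weight \<open>w \<le> 2 * ln a\<close>.\<close>
    define \<eta> where "\<eta> = \<epsilon> * ln a / (8 * (1 + ln a))"
    have \<eta>: "\<eta> > 0" using \<epsilon> la by (simp add: \<eta>_def)
    have "\<forall>\<^sub>F j in sequentially. norm ((1 / real j) *\<^sub>R (\<Sum>i\<in>{1..j}. \<xi> k i)) < \<eta>"
      using tendstoD[OF noise \<eta>] by (simp add: dist_norm)
    moreover have "\<forall>\<^sub>F j in sequentially. norm (g k j - f (state (T k j)) $ k) < \<epsilon> / 8"
      using tendstoD[OF tracking, of "\<epsilon> / 8" k] \<epsilon> by (simp add: dist_norm)
    ultimately have "\<forall>\<^sub>F j in sequentially. norm ((1 / real j) *\<^sub>R (\<Sum>i\<in>{1..j}. \<xi> k i)) < \<eta>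
        \<and> norm (g k j - f (state (T k j)) $ k) < \<epsilon> / 8"
      by (rule eventually_conj)
    then obtain J where J: "\<And>j. j \<ge> J \<Longrightarrow> norm ((1 / real j) *\<^sub>R (\<Sum>i\<in>{1..j}. \<xi> k i)) < \<eta>"
        "\<And>j. j \<ge> J \<Longrightarrow> norm (g k j - f (state (T k j)) $ k) < \<epsilon> / 8"
      unfolding eventually_sequentially by blast
    have "\<forall>\<^sub>F t in at_top. J \<le> tick_count (T k) t"
      using tick_count_at_top[OF ticks] by (simp add: filterlim_at_top)
    moreover have "\<forall>\<^sub>F t in at_top. dist (window_weight (T k) a t) (ln a) < \<epsilon> * ln a / (4 * r)"
      by (rule tendstoD[OF window_weight_tendsto[OF ticks a]]) (use \<epsilon> la r in simp)
    ultimately show "\<forall>\<^sub>F t in at_top. norm ((state (a * t) - state t - ln a *\<^sub>R drift (state t)) $ k) \<le> \<epsilon> * ln a"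
      using small eventually_window_le[OF a] eventually_gt_at_top[of 0]
    proof eventually_elim
      fix t assume t: "J \<le> tick_count (T k) t"
        "dist (window_weight (T k) a t) (ln a) < \<epsilon> * ln a / (4 * r)"
        "\<forall>s\<in>{t..a * t}. norm (state s - state t) < d" "\<forall>k. window_weight (T k) a t \<le> 2 * ln a" "0 < t"
      define m where "m = tick_count (T k) t"
      define n where "n = tick_count (T k) (a * t)"
      define w where "w = window_weight (T k) a t"
      have w: "w = (\<Sum>j\<in>{m<..n}. 1 / (real j + 1))" by (simp add: w_def window_weight_def m_def n_def)
      have w0: "w \<ge> 0" unfolding w by (intro sum_nonneg) auto
      have w2: "w \<le> 2 * ln a" using t(4) by (simp add: w_def)
      have mn: "m \<le> n" unfolding m_def n_def using a t(5) by (intro tick_count_mono ticks) auto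
      have noise: "norm (\<Sum>j\<in>{m<..n}. (1 / (real j + 1)) *\<^sub>R \<xi> k j) \<le> \<eta> * (2 + w)"
        unfolding w
      proof (rule abel_window_bound[OF mn])
        fix j assume "j \<ge> m"
        then have "norm ((1 / real j) *\<^sub>R (\<Sum>i\<in>{1..j}. \<xi> k i)) < \<eta>" using J(1) t(1) by (simp add: m_def)
        then show "norm (\<Sum>i\<in>{1..j}. \<xi> k i) \<le> \<eta> * (real j + 1)"
          using \<eta> by (cases "j = 0") (auto simp: field_simps intro: less_imp_le)
      qed
      have main: "norm (\<Sum>j\<in>{m<..n}. (1 / (real j + 1)) *\<^sub>R (g k j - \<tau> *\<^sub>R z k (j - 1) - drift (state t) $ k)) \<le> w * (\<epsilon> / 4)"
        unfolding w sum_distrib_right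
      proof (rule sum_norm_le)
        fix j assume j: "j \<in> {m<..n}"
        then have j1: "j \<ge> 1" by auto
        have "\<not> T k j < t" "T k j < a * t"
          using j less_iff_le_tick_count[OF ticks j1] by (auto simp: m_def n_def)
        then have "dist (state (T k j)) (state t) < d" using t(3) by (auto simp: dist_norm)
        then have "dist (drift (state (T k j))) (drift (state t)) < \<epsilon> / 8" using d(2) K(2) by blast
        then have 1: "norm ((drift (state (T k j)) - drift (state t)) $ k) < \<epsilon> / 8"
          using vec_norm_nth_le[of "drift (state (T k j)) - drift (state t)" k]
          by (simp add: dist_norm)
        have 2: "norm (g k j - f (state (T k j)) $ k) < \<epsilon> / 8" using J(2) j t(1) by (simp add: m_def)
        have "g k j - \<tau> *\<^sub>R z k (j - 1) - drift (state t) $ k =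
            (g k j - f (state (T k j)) $ k) + (drift (state (T k j)) - drift (state t)) $ k"
          unfolding state_at_tick[OF j1, of k, symmetric] by simp
        then have "norm (g k j - \<tau> *\<^sub>R z k (j - 1) - drift (state t) $ k) \<le>
            norm (g k j - f (state (T k j)) $ k) + norm ((drift (state (T k j)) - drift (state t)) $ k)"
          by (simp only: norm_triangle_ineq)
        with 1 2 have "norm (g k j - \<tau> *\<^sub>R z k (j - 1) - drift (state t) $ k) \<le> \<epsilon> / 4"
          by linarith
        then have "(1 / (real j + 1)) * norm (g k j - \<tau> *\<^sub>R z k (j - 1) - drift (state t) $ k) \<le> (1 / (real j + 1)) * (\<epsilon> / 4)"
          by (rule mult_left_mono) simp
        then show "norm ((1 / (real j + 1)) *\<^sub>R (g k j - \<tau> *\<^sub>R z k (j - 1) - drift (state t) $ k)) \<le> 1 / (real j + 1) * (\<epsilon> / 4)"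
          by simp
      qed
      have "(state (a * t) - state t - ln a *\<^sub>R drift (state t)) $ k = z k n - z k m - ln a *\<^sub>R drift (state t) $ k"
        by (simp add: state_def m_def n_def)
      also have "\<dots> = (\<Sum>j\<in>{m<..n}. (1 / (real j + 1)) *\<^sub>R (g k j - \<tau> *\<^sub>R z k (j - 1) - drift (state t) $ k))
          + (\<Sum>j\<in>{m<..n}. (1 / (real j + 1)) *\<^sub>R \<xi> k j) + (w - ln a) *\<^sub>R drift (state t) $ k"
        unfolding z_increments[OF mn] w
        by (simp only: scaleR_diff_right scaleR_add_right sum.distrib sum_subtractf scaleR_sum_left scaleR_diff_left)
           (simp add: algebra_simps)
      finally have "norm ((state (a * t) - state t - ln a *\<^sub>R drift (state t)) $ k)
          \<le> w * (\<epsilon> / 4) + \<eta> * (2 + w) + norm ((w - ln a) *\<^sub>R drift (state t) $ k)"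
        by (rule norm_sum3_le[OF _ main noise])
      also have "\<dots> \<le> \<epsilon> * ln a / 2 + \<epsilon> * ln a / 4 + \<epsilon> * ln a / 4"
      proof (intro add_mono)
        have "norm (drift (state t) $ k) \<le> r"
          using r(2)[OF K(2), of t] vec_norm_nth_le[of "drift (state t)" k] by linarith
        then have "norm ((w - ln a) *\<^sub>R drift (state t) $ k) \<le> \<epsilon> * ln a / (4 * r) * r"
          using t(2) unfolding norm_scaleR w_def[symmetric] dist_real_def by (intro mult_mono) auto
        also have "\<dots> = \<epsilon> * ln a / 4" using r(1) by simp
        finally show "norm ((w - ln a) *\<^sub>R drift (state t) $ k) \<le> \<epsilon> * ln a / 4" .
        have "w * (\<epsilon> / 4) \<le> (2 * ln a) * (\<epsilon> / 4)" using w2 \<epsilon> by (intro mult_right_mono) auto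
        then show "w * (\<epsilon> / 4) \<le> \<epsilon> * ln a / 2" by (simp add: mult.commute)
        have "\<eta> * (2 + w) \<le> \<eta> * (2 * (1 + ln a))" using w2 \<eta> by (intro mult_left_mono) auto
        also have "\<eta> * (2 * (1 + ln a)) = \<epsilon> * ln a / 4" using la by (simp add: \<eta>_def field_simps)
        finally show "\<eta> * (2 + w) \<le> \<epsilon> * ln a / 4" .
      qed
      finally show "norm ((state (a * t) - state t - ln a *\<^sub>R drift (state t)) $ k) \<le> \<epsilon> * ln a" by simp
    qed
  qed
qed

lemma window_follows_drift:
  assumes \<epsilon>: "\<epsilon> > 0"
  shows "\<forall>\<^sub>F a in at_right 1. \<forall>\<^sub>F t in at_top. norm (state (a * t) - state t - ln a *\<^sub>R drift (state t)) \<le> \<epsilon> * ln a"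
proof -
  let ?err = "\<lambda>a t. state (a * t) - state t - ln a *\<^sub>R drift (state t)"
  have "\<forall>\<^sub>F a in at_right 1. \<forall>k. \<forall>\<^sub>F t in at_top.
      norm ((?err a t) $ k) \<le> \<epsilon> / CARD('k) * ln a"
    by (intro eventually_all_finite allI window_follows_drift_component) (use \<epsilon> in simp)
  then show ?thesis
  proof eventually_elim
    fix a assume "\<forall>k. \<forall>\<^sub>F t in at_top. norm ((?err a t) $ k) \<le> \<epsilon> / CARD('k) * ln a"
    then have "\<forall>\<^sub>F t in at_top. \<forall>k. norm ((?err a t) $ k) \<le> \<epsilon> / CARD('k) * ln a"
      by (intro eventually_all_finite) auto
    then show "\<forall>\<^sub>F t in at_top. norm (?err a t) \<le> \<epsilon> * ln a"
    proof eventually_elim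
      fix t assume t: "\<forall>k. norm ((?err a t) $ k) \<le> \<epsilon> / CARD('k) * ln a"
      have "norm (?err a t) \<le> (\<Sum>k\<in>UNIV. norm ((?err a t) $ k))"
        by (rule norm_vec_le_sum)
      also have "\<dots> \<le> (\<Sum>k\<in>(UNIV::'k set). \<epsilon> / CARD('k) * ln a)" using t by (intro sum_mono) auto
      finally show "norm (?err a t) \<le> \<epsilon> * ln a" by simp
    qed
  qed
qed

end

text \<open>Iterating the contraction from the interval \<open>[s, a * s]\<close> onwards.\<close>

lemma scaled_contraction_eventually_small:
  fixes u :: "real \<Rightarrow> real"
  assumes a: "a > 1" and \<rho>: "0 \<le> \<rho>" "\<rho> < 1" and s: "s > 0"
    and contr: "\<And>t. t \<ge> s \<Longrightarrow> u (a * t) \<le> \<rho> * u t" and U: "\<And>t. t \<ge> s \<Longrightarrow> u t \<le> U" and e: "e > 0"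
  shows "\<forall>\<^sub>F t in at_top. u t < e"
proof -
  define V where "V = max U 1"
  have V: "V > 0" "\<And>t. t \<ge> s \<Longrightarrow> u t \<le> V"
    using U by (auto simp: V_def intro: order_trans[OF _ max.cobounded1])
  have le: "u t \<le> \<rho> ^ m * V" if "t \<ge> a ^ m * s" for m t
    using that
  proof (induct m arbitrary: t)
    case (Suc m)
    then have t: "t / a \<ge> a ^ m * s" using a by (simp add: pos_le_divide_eq mult_ac)
    moreover have "a ^ m * s \<ge> 1 * s" using a s by (intro mult_right_mono one_le_power) auto
    ultimately have "t / a \<ge> s" by linarith
    from contr[OF this] have "u t \<le> \<rho> * u (t / a)" using a by simp
    also have "\<dots> \<le> \<rho> * (\<rho> ^ m * V)" using Suc(1)[OF t] \<rho> by (intro mult_left_mono) auto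
    finally show ?case by simp
  qed (use V in simp)
  have "(\<lambda>m. \<rho> ^ m * V) \<longlonglongrightarrow> 0 * V" by (intro tendsto_mult LIMSEQ_realpow_zero \<rho> tendsto_const)
  then have "\<forall>\<^sub>F m in sequentially. \<rho> ^ m * V < e" using e by (intro order_tendstoD(2)) auto
  then obtain m where m: "\<rho> ^ m * V < e" by (auto simp: eventually_sequentially)
  show ?thesis
    using eventually_ge_at_top[of "a ^ m * s"] by eventually_elim (use le m in fastforce)
qed

text \<open>A Lyapunov function that decays exponentially along the drift decays along the recursion: over a
  window from \<open>t\<close> to \<open>a * t\<close> it contracts by the factor \<open>1 - \<tau> * ln a\<close>, up to \<open>\<epsilon> * ln a\<close>, and
  summing these contractions leaves an error of \<open>\<epsilon> / \<tau>\<close> only, for every \<open>\<epsilon>\<close>.\<close>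

theorem (in async_recursion) lyapunov_tendsto_0:
  fixes D :: "'e^'k \<Rightarrow> real" and G :: "'e^'k \<Rightarrow> 'e^'k"
  assumes D0: "\<And>x. x \<in> K \<Longrightarrow> D x \<ge> 0"
    and G: "continuous_on K G"
    and sub: "\<And>x y. x \<in> K \<Longrightarrow> y \<in> K \<Longrightarrow> D y - D x \<le> G y \<bullet> (y - x)"
    and diss: "\<And>x. x \<in> K \<Longrightarrow> G x \<bullet> (f x - \<tau> *\<^sub>R x) \<le> - \<tau> * D x"
  shows "((\<lambda>t. D (state t)) \<longlongrightarrow> 0) at_top"
proof -
  obtain r where r: "r > 0" "\<And>x. x \<in> K \<Longrightarrow> norm (drift x) \<le> r" using drift_bounded by blast
  have "bounded (G ` K)" by (intro compact_imp_bounded compact_continuous_image K(1) G)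
  then obtain q where q: "q > 0" "\<And>x. x \<in> K \<Longrightarrow> norm (G x) \<le> q" unfolding bounded_pos by auto
  define U where "U = D (state 0) + q * (2 * bnd)"
  have U: "D (state t) \<le> U" for t
  proof -
    have "D (state t) - D (state 0) \<le> norm (G (state t)) * norm (state t - state 0)"
      using sub[OF K(2) K(2)] norm_cauchy_schwarz order_trans by blast
    also have "\<dots> \<le> q * (2 * bnd)"
      using q(2)[OF K(2)] bnd(2)[OF K(2), of t] bnd(2)[OF K(2), of 0] q(1) norm_triangle_ineq4[of "state t" "state 0"]
      by (intro mult_mono) (auto intro: order_trans)
    finally show ?thesis by (simp add: U_def)
  qed
  have small: "\<forall>\<^sub>F t in at_top. D (state t) < \<epsilon> / \<tau> + e" if \<epsilon>: "\<epsilon> > 0" and e: "e > 0" for \<epsilon> e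
  proof -
    have "uniformly_continuous_on K G" by (intro compact_uniformly_continuous K(1) G)
    moreover have "\<epsilon> / (2 * r) > 0" using \<epsilon> r by simp
    ultimately obtain d where d: "d > 0" "\<And>x y. x \<in> K \<Longrightarrow> y \<in> K \<Longrightarrow> dist y x < d \<Longrightarrow> dist (G y) (G x) < \<epsilon> / (2 * r)"
      unfolding uniformly_continuous_on_def by blast
    have "\<forall>\<^sub>F a in at_right 1. \<tau> * ln a < 1"
      using tendsto_mult[OF tendsto_const ln_at_right_1, of \<tau>] by (intro order_tendstoD(2)) auto
    moreover have "\<forall>\<^sub>F a::real in at_right 1. a > 1" by (simp add: eventually_at_right_less)
    moreover have "\<epsilon> / (2 * q) > 0" using \<epsilon> q by simp
    ultimately have "\<forall>\<^sub>F a in at_right 1. a > 1 \<and> \<tau> * ln a < 1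
        \<and> (\<forall>\<^sub>F t in at_top. \<forall>s\<in>{t..a * t}. norm (state s - state t) < d)
        \<and> (\<forall>\<^sub>F t in at_top. norm (state (a * t) - state t - ln a *\<^sub>R drift (state t)) \<le> \<epsilon> / (2 * q) * ln a)"
      by (intro eventually_conj window_moves_little window_follows_drift d(1)) auto
    then obtain a where a: "a > 1" "\<tau> * ln a < 1"
        "\<forall>\<^sub>F t in at_top. \<forall>s\<in>{t..a * t}. norm (state s - state t) < d"
        "\<forall>\<^sub>F t in at_top. norm (state (a * t) - state t - ln a *\<^sub>R drift (state t)) \<le> \<epsilon> / (2 * q) * ln a"
      using eventually_happens'[OF trivial_limit_at_right_real] by blast
    have la: "ln a > 0" using a by simp
    have "\<forall>\<^sub>F t in at_top. D (state (a * t)) \<le> (1 - \<tau> * ln a) * D (state t) + \<epsilon> * ln a"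
      using a(3,4) eventually_gt_at_top[of 0]
    proof eventually_elim
      fix t assume t: "\<forall>s\<in>{t..a * t}. norm (state s - state t) < d"
        "norm (state (a * t) - state t - ln a *\<^sub>R drift (state t)) \<le> \<epsilon> / (2 * q) * ln a" "0 < t"
      define err where "err = state (a * t) - state t - ln a *\<^sub>R drift (state t)"
      have "D (state (a * t)) - D (state t) \<le> G (state (a * t)) \<bullet> (state (a * t) - state t)" by (rule sub[OF K(2) K(2)])
      also have "\<dots> = ln a * (G (state t) \<bullet> drift (state t)) + ln a * ((G (state (a * t)) - G (state t)) \<bullet> drift (state t)) + G (state (a * t)) \<bullet> err"
        unfolding err_def by (simp add: inner_diff_left inner_diff_right algebra_simps)
      also have "\<dots> \<le> ln a * (- \<tau> * D (state t)) + ln a * (\<epsilon> / 2) + \<epsilon> / 2 * ln a"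
      proof (intro add_mono mult_left_mono diss K(2))
        have "a * t \<in> {t..a * t}" using a(1) t(3) by simp
        then have "dist (state (a * t)) (state t) < d" using t(1) by (auto simp: dist_norm)
        then have "dist (G (state (a * t))) (G (state t)) < \<epsilon> / (2 * r)" using d(2) K(2) by blast
        then have "norm (G (state (a * t)) - G (state t)) * norm (drift (state t)) \<le> \<epsilon> / (2 * r) * r"
          using r(2)[OF K(2)] r(1) \<epsilon> by (intro mult_mono) (auto simp: dist_norm)
        also have "\<dots> = \<epsilon> / 2" using r(1) by simp
        finally show "(G (state (a * t)) - G (state t)) \<bullet> drift (state t) \<le> \<epsilon> / 2"
          using norm_cauchy_schwarz order_trans by blast
        have "norm (G (state (a * t))) * norm err \<le> q * (\<epsilon> / (2 * q) * ln a)"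
          using q(2)[OF K(2)] t(2) q(1) by (intro mult_mono) (auto simp: err_def)
        also have "\<dots> = \<epsilon> / 2 * ln a" using q(1) by simp
        finally show "G (state (a * t)) \<bullet> err \<le> \<epsilon> / 2 * ln a"
          using norm_cauchy_schwarz order_trans by blast
      qed (use la in auto)
      finally show "D (state (a * t)) \<le> (1 - \<tau> * ln a) * D (state t) + \<epsilon> * ln a" by (simp add: algebra_simps)
    qed
    then obtain t1 where t1: "\<And>t. t \<ge> t1 \<Longrightarrow> D (state (a * t)) \<le> (1 - \<tau> * ln a) * D (state t) + \<epsilon> * ln a"
      by (auto simp: eventually_at_top_linorder)
    have "\<forall>\<^sub>F t in at_top. D (state t) - \<epsilon> / \<tau> < e"
    proof (rule scaled_contraction_eventually_small[OF a(1), where \<rho> = "1 - \<tau> * ln a" and s = "max t1 1" and U = U])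
      fix t assume t: "t \<ge> max t1 1"
      have "(1 - \<tau> * ln a) * (D (state t) - \<epsilon> / \<tau>) = (1 - \<tau> * ln a) * D (state t) - \<epsilon> / \<tau> + \<epsilon> * ln a"
        using \<tau> by (simp add: field_simps)
      then show "D (state (a * t)) - \<epsilon> / \<tau> \<le> (1 - \<tau> * ln a) * (D (state t) - \<epsilon> / \<tau>)"
        using t1[of t] t by simp
      have "\<epsilon> / \<tau> > 0" using \<epsilon> \<tau> by simp
      then show "D (state t) - \<epsilon> / \<tau> \<le> U" using U[of t] by linarith
    qed (use a \<tau> la e in auto)
    then show ?thesis by eventually_elim simp
  qed
  show ?thesis
  proof (rule tendstoI)
    fix e :: real assume e: "e > 0"
    have "\<forall>\<^sub>F t in at_top. D (state t) < (\<tau> * e / 2) / \<tau> + e / 2"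
      by (rule small) (use e \<tau> in auto)
    then show "\<forall>\<^sub>F t in at_top. dist (D (state t)) 0 < e"
      by eventually_elim (use \<tau> D0[OF K(2)] in \<open>auto simp: dist_real_def abs_of_nonneg\<close>)
  qed
qed

section \<open>Update epochs\<close>

locale regular_epochs =
  fixes T :: "'k::finite \<Rightarrow> nat \<Rightarrow> 'w \<Rightarrow> real" and w :: 'w
  assumes ticks: "\<And>k. regular_ticks (\<lambda>j. T k j w)"
    and ticks_nonneg: "\<And>k j. j \<ge> 1 \<Longrightarrow> T k j w \<ge> 0"
begin

abbreviation count :: "'k \<Rightarrow> nat \<Rightarrow> nat" where
  "count k n \<equiv> tick_count (\<lambda>j. T k j w) (epoch T n w)"

text \<open>The update times do not accumulate, which makes the infimum in \<open>epoch\<close> a minimum and exhausts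
  all update times by epochs.\<close>

lemma finite_update_times_below: "finite {u \<in> update_times T w. u \<le> t}"
proof -
  have "{u \<in> update_times T w. u \<le> t} \<subseteq> (\<Union>k. (\<lambda>j. T k j w) ` {..tick_count (\<lambda>j. T k j w) (t + 1)})"
  proof
    fix u assume "u \<in> {u \<in> update_times T w. u \<le> t}"
    then obtain k j where u: "u = T k j w" "j \<ge> 1" "u \<le> t" by (auto simp: update_times_def)
    then have "j \<le> tick_count (\<lambda>j. T k j w) (t + 1)"
      using less_iff_le_tick_count[OF ticks[of k] u(2), of "t + 1"] by simp
    then show "u \<in> (\<Union>k. (\<lambda>j. T k j w) ` {..tick_count (\<lambda>j. T k j w) (t + 1)})" using u by auto
  qed
  then show ?thesis by (rule finite_subset) auto
qed

lemma epoch_Suc_props: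
  "epoch T (Suc n) w \<in> update_times T w" "epoch T n w < epoch T (Suc n) w"
  "u \<in> update_times T w \<Longrightarrow> epoch T n w < u \<Longrightarrow> epoch T (Suc n) w \<le> u"
proof -
  let ?S = "{t \<in> update_times T w. epoch T n w < t}"
  obtain j where j: "j \<ge> 1" "T undefined j w > epoch T n w"
    using regular_ticks_at_top[OF ticks[of undefined]]
    unfolding filterlim_at_top_dense eventually_sequentially by (metis max.cobounded1 max.cobounded2)
  define u0 where "u0 = T undefined j w"
  have u0: "u0 \<in> ?S" using j by (auto simp: u0_def update_times_def)
  define F where "F = {u \<in> ?S. u \<le> u0}"
  have F: "finite F" "F \<noteq> {}"
    using finite_subset[OF _ finite_update_times_below[of u0], of F] u0 by (auto simp: F_def)
  have "Inf ?S = Min F"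
  proof (rule cInf_eq_minimum)
    show "Min F \<in> ?S" using Min_in[OF F] by (auto simp: F_def)
    show "Min F \<le> u" if "u \<in> ?S" for u
    proof (cases "u \<le> u0")
      case True
      then show ?thesis using that F by (auto simp: F_def)
    next
      case False
      moreover have "Min F \<le> u0" using F u0 by (auto simp: F_def)
      ultimately show ?thesis by simp
    qed
  qed
  then have e: "epoch T (Suc n) w = Min F" by simp
  have "Min F \<in> F" using F by simp
  then show "epoch T (Suc n) w \<in> update_times T w" "epoch T n w < epoch T (Suc n) w"
    unfolding e by (auto simp: F_def)
  have "Min F \<le> u0" using F u0 by (auto simp: F_def)
  then show "epoch T (Suc n) w \<le> u" if "u \<in> update_times T w" "epoch T n w < u"
    using that F unfolding e by (cases "u \<le> u0") (auto simp: F_def)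
qed

lemma epoch_strict_mono: "strict_mono (\<lambda>n. epoch T n w)"
  using epoch_Suc_props(2) by (rule strict_mono_Suc_iff[THEN iffD2, OF allI])

lemma epoch_at_top: "filterlim (\<lambda>n. epoch T n w) at_top sequentially"
  unfolding filterlim_at_top
proof
  fix t
  have "\<exists>n. t \<le> epoch T n w"
  proof (rule ccontr)
    assume "\<not> ?thesis"
    then have "range (\<lambda>n. epoch T (Suc n) w) \<subseteq> {u \<in> update_times T w. u \<le> t}"
      using epoch_Suc_props(1) by (auto simp: not_le intro: less_imp_le simp del: epoch.simps)
    then have "finite (range (\<lambda>n. epoch T (Suc n) w))"
      using finite_update_times_below by (rule finite_subset)
    moreover have "inj (\<lambda>n. epoch T (Suc n) w)"
      using strict_mono_imp_inj_on[OF epoch_strict_mono] by (auto simp: inj_on_def simp del: epoch.simps)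
    ultimately show False using finite_imageD infinite_UNIV_nat by blast
  qed
  then obtain n where n: "t \<le> epoch T n w" by blast
  show "\<forall>\<^sub>F n in sequentially. t \<le> epoch T n w"
    using eventually_ge_at_top[of n]
    by eventually_elim (use n strict_mono_mono[OF epoch_strict_mono] in \<open>force dest: monoD\<close>)
qed

lemma update_time_is_epoch:
  assumes "u \<in> update_times T w"
  shows "\<exists>n\<ge>1. epoch T n w = u"
proof -
  have u: "u \<ge> 0" using assms ticks_nonneg by (auto simp: update_times_def)
  have ex: "\<exists>n. u \<le> epoch T n w"
    using epoch_at_top unfolding filterlim_at_top eventually_sequentially by blast
  define n where "n = (LEAST n. u \<le> epoch T n w)"
  have n: "u \<le> epoch T n w" unfolding n_def using ex by (rule LeastI_ex)
  then obtain m where m: "n = Suc m" using u by (cases n) auto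
  have "epoch T m w < u" using not_less_Least[of m "\<lambda>n. u \<le> epoch T n w"] m by (simp add: n_def not_le)
  then have "epoch T n w \<le> u" using epoch_Suc_props(3)[OF assms] m by blast
  then show ?thesis using n m by (intro exI[of _ n]) auto
qed

lemma before_next_epoch_iff:
  assumes "j \<ge> 1"
  shows "T k j w < epoch T (Suc n) w \<longleftrightarrow> T k j w \<le> epoch T n w"
proof -
  have "T k j w \<in> update_times T w" using assms by (auto simp: update_times_def)
  then show ?thesis
    using epoch_Suc_props(2)[of n] epoch_Suc_props(3)[of "T k j w" n]
    by (cases "T k j w \<le> epoch T n w") (auto simp del: epoch.simps)
qed

lemma updating_user_tick:
  assumes "k \<in> update_set T n w"
  shows "T k (Suc (count k n)) w = epoch T n w"
proof -
  obtain j where j: "j \<ge> 1" "T k j w = epoch T n w" using assms by (auto simp: update_set_def)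
  then have "count k n = j - 1" using tick_count_at_tick[OF ticks j(1), of k] by simp
  then show ?thesis using j by simp
qed

lemma count_Suc: "count k (Suc n) = count k n + (if k \<in> update_set T n w then 1 else 0)"
proof (cases "k \<in> update_set T n w")
  case True
  note tick = updating_user_tick[OF True]
  have "count k (Suc n) = Suc (count k n)"
  proof (rule strict_ticks_count_eq(2))
    show "strict_mono_on {1..} (\<lambda>j. T k j w)" using ticks[of k] by (simp add: regular_ticks_def)
    show "Suc (count k n) = 0 \<or> T k (Suc (count k n)) w < epoch T (Suc n) w"
      using epoch_Suc_props(2)[of n] tick by simp
    have "T k (Suc (count k n)) w < T k (Suc (Suc (count k n))) w"
      using ticks[of k] by (auto simp: regular_ticks_def strict_mono_on_def)
    then show "epoch T (Suc n) w \<le> T k (Suc (Suc (count k n))) w"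
      using before_next_epoch_iff[of "Suc (Suc (count k n))" k n] tick by (simp add: not_less[symmetric])
  qed
  then show ?thesis using True by simp
next
  case False
  have "{j. j \<ge> 1 \<and> T k j w < epoch T (Suc n) w} = {j. j \<ge> 1 \<and> T k j w < epoch T n w}"
    using before_next_epoch_iff[of _ k n] False
    by (auto simp: update_set_def le_less simp del: epoch.simps)
  then show ?thesis using False by (simp add: tick_count_def)
qed

lemma count_0: "count k 0 = 0"
proof -
  have "\<not> T k j w < -1" if "j \<ge> 1" for j using ticks_nonneg[OF that, of k] by simp
  then have e: "{j. j \<ge> 1 \<and> T k j w < -1} = {}" by blast
  show ?thesis unfolding tick_count_def epoch.simps(1) e by simp
qed

lemma no_update_at_0: "k \<notin> update_set T 0 w"
proof
  assume "k \<in> update_set T 0 w"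
  then obtain i where i: "i \<ge> 1" "T k i w = -1" by (auto simp: update_set_def)
  then show False using ticks_nonneg[OF i(1), of k] by simp
qed

lemma count_eq_card: "count k n = card {m. m < n \<and> k \<in> update_set T m w}"
proof (induct n)
  case (Suc n)
  have "{m. m < Suc n \<and> k \<in> update_set T m w} =
      {m. m < n \<and> k \<in> update_set T m w} \<union> (if k \<in> update_set T n w then {n} else {})"
    by (auto simp: less_Suc_eq)
  then show ?case by (simp add: count_Suc Suc del: epoch.simps)
qed (simp only: count_0, simp)

lemma count_lag: "count k (n + d) \<le> count k n + d"
  by (induct d) (auto simp: count_Suc simp del: epoch.simps)

lemma count_at_top: "filterlim (count k) at_top sequentially"
  by (rule filterlim_compose[OF tick_count_at_top[OF ticks] epoch_at_top])

end

section \<open>Convergence along a path\<close>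

lemma traceless_norm_le: "S \<noteq> {} \<Longrightarrow> norm (traceless S Y) \<le> norm Y"
proof -
  assume S: "S \<noteq> {}"
  have "traceless S (traceless S Y) = traceless S Y"
    using traceless_idmat_inner[OF S, of Y] by (simp add: traceless_def[of S "traceless S Y"])
  then have "norm (traceless S Y) * norm (traceless S Y) \<le> norm Y * norm (traceless S Y)"
    using traceless_inner[of S Y "traceless S Y"] norm_cauchy_schwarz[of Y "traceless S Y"]
    by (simp flip: power2_norm_eq_inner power2_eq_square)
  then show ?thesis by (cases "norm (traceless S Y) = 0") auto
qed

text \<open>The relaxation term keeps the scores bounded: once \<open>j + 1 \<ge> \<tau>\<close>, an update is a convex
  combination of the old score and a point of norm at most \<open>c / \<tau>\<close>.\<close>

lemma relaxed_recursion_bounded: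
  fixes \<tau> c :: real
  assumes \<tau>: "\<tau> > 0" and c: "c \<ge> 0"
  shows "\<exists>R. \<forall>(z :: nat \<Rightarrow> 'e::real_normed_vector) v. norm (z 0) \<le> c \<and> (\<forall>j\<ge>1. norm (v j) \<le> c) \<and>
    (\<forall>j\<ge>1. z j = z (j - 1) + (1 / (real j + 1)) *\<^sub>R (v j - \<tau> *\<^sub>R z (j - 1))) \<longrightarrow>
    (\<forall>j. norm (z j) \<le> R)"
proof -
  define B where "B j = ((\<lambda>r. (1 + \<tau>) * r + c) ^^ j) c" for j
  have B0: "B j \<ge> 0" for j using \<tau> c by (induct j) (auto simp: B_def)
  have Bmono: "B j \<le> B (Suc j)" for j
  proof -
    have "0 \<le> \<tau> * B j" using \<tau> B0[of j] by simp
    then show ?thesis using c by (simp add: B_def algebra_simps)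
  qed
  define J where "J = nat \<lceil>\<tau>\<rceil>"
  have J: "\<tau> \<le> real J" unfolding J_def by linarith
  define R where "R = max (B J) (c / \<tau>)"
  show ?thesis
  proof (intro exI[of _ R] allI impI)
    fix z v :: "nat \<Rightarrow> 'e" and j
    assume "norm (z 0) \<le> c \<and> (\<forall>j\<ge>1. norm (v j) \<le> c) \<and>
      (\<forall>j\<ge>1. z j = z (j - 1) + (1 / (real j + 1)) *\<^sub>R (v j - \<tau> *\<^sub>R z (j - 1)))"
    then have z0: "norm (z 0) \<le> c" and v: "\<And>j. j \<ge> 1 \<Longrightarrow> norm (v j) \<le> c"
      and rec: "\<And>j. j \<ge> 1 \<Longrightarrow> z j = z (j - 1) + (1 / (real j + 1)) *\<^sub>R (v j - \<tau> *\<^sub>R z (j - 1))"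
      by blast+
    have eq: "z (Suc j) = (1 - \<tau> / (real j + 2)) *\<^sub>R z j + (1 / (real j + 2)) *\<^sub>R v (Suc j)" for j
      using rec[of "Suc j"] by (simp add: algebra_simps)
    have low: "norm (z j) \<le> B j" for j
    proof (induct j)
      case (Suc j)
      have "norm (z (Suc j)) \<le> \<bar>1 - \<tau> / (real j + 2)\<bar> * norm (z j) + (1 / (real j + 2)) * norm (v (Suc j))"
        unfolding eq by (rule order_trans[OF norm_triangle_ineq]) simp
      also have "\<dots> \<le> (1 + \<tau>) * B j + 1 * c"
      proof (intro add_mono mult_mono Suc v)
        have "0 \<le> \<tau> / (real j + 2)" "\<tau> / (real j + 2) \<le> \<tau>"
          using \<tau> by (auto simp: pos_divide_le_eq)
        then show "\<bar>1 - \<tau> / (real j + 2)\<bar> \<le> 1 + \<tau>" by linarith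
      qed (use \<tau> c in auto)
      finally show ?case by (simp add: B_def)
    qed (use z0 in \<open>simp add: B_def\<close>)
    have "norm (z j) \<le> R"
    proof (cases "j \<le> J")
      case True
      have "B j \<le> B J" using lift_Suc_mono_le[of B, OF Bmono True] .
      then show ?thesis using low[of j] by (simp add: R_def)
    next
      case False
      then have "J \<le> j" by simp
      then show ?thesis
      proof (induct j rule: dec_induct)
        case base
        show ?case using low[of J] by (simp add: R_def)
      next
        case (step j)
        have t: "0 \<le> 1 - \<tau> / (real j + 2)" using J step(1) by (simp add: pos_divide_le_eq)
        have "norm (z (Suc j)) \<le> (1 - \<tau> / (real j + 2)) * norm (z j) + (1 / (real j + 2)) * norm (v (Suc j))"
          unfolding eq using t by (intro order_trans[OF norm_triangle_ineq]) simp
        also have "\<dots> \<le> (1 - \<tau> / (real j + 2)) * R + (1 / (real j + 2)) * (\<tau> * R)"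
        proof (intro add_mono mult_left_mono step t)
          have "norm (v (Suc j)) \<le> \<tau> * (c / \<tau>)" using v[of "Suc j"] \<tau> by simp
          also have "\<dots> \<le> \<tau> * R" using \<tau> by (intro mult_left_mono) (auto simp: R_def)
          finally show "norm (v (Suc j)) \<le> \<tau> * R" .
        qed simp
        also have "\<dots> = R" by (simp add: algebra_simps)
        finally show ?case .
      qed
    qed
    then show "norm (z j) \<le> R" .
  qed
qed

lemma continuous_free_energy:
  assumes S: "S \<noteq> {}" shows "continuous_on (herm S) (free_energy S)"
proof -
  have c: "continuous_on (herm S) (mexp S)" using continuous_mexp continuous_on_subset by blast
  have "Re (trace (mexp S Y)) \<noteq> 0" if Y: "Y \<in> herm S" for Y
  proof -
    obtain Z where "Z > 0" "trace (mexp S Y) = of_real Z" using gibbs_spectral[OF Y S] by metis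
    then show ?thesis by simp
  qed
  then show ?thesis
    unfolding free_energy_def trace_def
    by (intro continuous_on_ln continuous_on_Re continuous_on_sum continuous_on_component c) auto
qed

text \<open>On the compact set of scores where the densities differ by \<open>e\<close> or more, the divergence has a
  positive minimum.\<close>

lemma bregman_tendsto_0D:
  fixes y :: "nat \<Rightarrow> complex^'n^'n"
  assumes S: "S \<noteq> {}" and K: "compact K" "K \<subseteq> herm S" and y: "\<And>n. y n \<in> K" and y0: "y0 \<in> herm S"
    and lim: "(\<lambda>n. bregman S (y n) y0) \<longlonglongrightarrow> 0"
  shows "(\<lambda>n. exp_normalized S (y n)) \<longlonglongrightarrow> exp_normalized S y0"
proof (rule tendstoI)
  fix e :: real assume e: "e > 0"
  define B where "B = {x \<in> K. e \<le> norm (exp_normalized S x - exp_normalized S y0)}"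
  have cQ: "continuous_on K (exp_normalized S)"
    by (rule continuous_on_subset[OF continuous_exp_normalized[OF S] K(2)])
  have "closed B"
    unfolding B_def
    by (intro continuous_on_closed_Collect_le compact_imp_closed K(1) continuous_intros cQ)
  then have "compact (K \<inter> B)" by (rule compact_Int_closed[OF K(1)])
  moreover have "K \<inter> B = B" by (auto simp: B_def)
  ultimately have B: "compact B" by simp
  have "\<exists>m>0. \<forall>x\<in>B. m \<le> bregman S x y0"
  proof (cases "B = {}")
    case False
    have BH: "B \<subseteq> herm S" using K(2) by (auto simp: B_def)
    have "continuous_on B (\<lambda>x. bregman S x y0)"
      unfolding bregman_def
      by (intro continuous_intros continuous_on_subset[OF continuous_free_energy[OF S] BH])
    then obtain x where x: "x \<in> B" "\<And>x'. x' \<in> B \<Longrightarrow> bregman S x y0 \<le> bregman S x' y0"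
      using continuous_attains_inf[OF B False] by blast
    have "bregman S x y0 \<noteq> 0"
      using bregman_eq_0D[OF y0 _ S, of x] x(1) BH e by (auto simp: B_def)
    then have "bregman S x y0 > 0" using bregman_nonneg[OF y0 _ S, of x] x(1) BH by force
    then show ?thesis using x(2) by blast
  qed (auto intro: exI[of _ 1])
  then obtain m where m: "m > 0" "\<And>x. x \<in> B \<Longrightarrow> m \<le> bregman S x y0" by blast
  have "\<forall>\<^sub>F n in sequentially. bregman S (y n) y0 < m" using order_tendstoD(2)[OF lim m(1)] .
  then show "\<forall>\<^sub>F n in sequentially. dist (exp_normalized S (y n)) (exp_normalized S y0) < e"
  proof eventually_elim
    fix n assume "bregman S (y n) y0 < m"
    then have "y n \<notin> B" using m(2) by force
    then show "dist (exp_normalized S (y n)) (exp_normalized S y0) < e"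
      using y[of n] by (auto simp: B_def dist_norm not_le)
  qed
qed

lemma inner_vec_lambda: "(\<chi> k. g k) \<bullet> y = (\<Sum>k\<in>UNIV. g k \<bullet> y $ k)"
  by (simp only: inner_vec_def vec_lambda_beta)

lemma iterate_eq:
  "iterate A T Y n w = (\<chi> k. exp_normalized (A k) (Y k (tick_count (\<lambda>j. T k j w) (epoch T n w)) w))"
  by (simp add: iterate_def profile_before_def tick_count_def)

text \<open>A path of the learning process on which the noise averages out. The update of user \<open>k\<close> at tick
  \<open>j\<close> happens at epoch \<open>epoch_of k j\<close> and uses an estimate of the gradient at the profile of epoch
  \<open>past k j\<close>.\<close>

locale learning_path = channel_law L A P b + regular_epochs T w
  for L :: "('k::finite, 'n::finite, 'm::finite) channel measure" and A P b
    and T :: "'k \<Rightarrow> nat \<Rightarrow> 'w \<Rightarrow> real" and w :: 'w +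
  fixes Y :: "'k \<Rightarrow> nat \<Rightarrow> 'w \<Rightarrow> complex^'m^'m" and \<tau> :: real
    and Vh :: "'k \<Rightarrow> nat \<Rightarrow> complex^'m^'m" and C :: real
    and epoch_of past :: "'k \<Rightarrow> nat \<Rightarrow> nat" and N :: nat
  assumes \<tau>: "\<tau> > 0"
    and Y_herm: "\<And>k j. Y k j w \<in> herm (A k)"
    and Y_recursion: "\<And>k j. j \<ge> 1 \<Longrightarrow> Y k j w = Y k (j - 1) w + (1 / (real j + 1)) *\<^sub>R (Vh k j - \<tau> *\<^sub>R Y k (j - 1) w)"
    and Vh_bounded: "\<And>k j. j \<ge> 1 \<Longrightarrow> norm (Vh k j) \<le> C"
    and epoch_of: "\<And>k j. j \<ge> 1 \<Longrightarrow> epoch T (epoch_of k j) w = T k j w"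
    and past_le: "\<And>k j. j \<ge> 1 \<Longrightarrow> past k j \<le> epoch_of k j"
    and epoch_of_le: "\<And>k j. j \<ge> 1 \<Longrightarrow> epoch_of k j \<le> past k j + N"
    and averaged_noise: "\<And>k. (\<lambda>J. (1 / real J) *\<^sub>R (\<Sum>j\<in>{1..J}.
        traceless (A k) (Vh k j - V_mean P L k (iterate A T Y (past k j) w)))) \<longlonglongrightarrow> 0"
begin

definition score :: "'k \<Rightarrow> nat \<Rightarrow> complex^'m^'m" where
  "score k j = traceless (A k) (Y k j w)"

text \<open>The profile that the users choose at given scores.\<close>

definition choice :: "('k, 'm) profile \<Rightarrow> ('k, 'm) profile" where
  "choice x = (\<chi> k. exp_normalized (A k) (x $ k))"

definition field :: "('k, 'm) profile \<Rightarrow> ('k, 'm) profile" where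
  "field x = (\<chi> k. traceless (A k) (V_mean P L k (choice x)))"

definition past_field :: "'k \<Rightarrow> nat \<Rightarrow> complex^'m^'m" where
  "past_field k j = traceless (A k) (V_mean P L k (iterate A T Y (past k j) w))"

definition noise_at :: "'k \<Rightarrow> nat \<Rightarrow> complex^'m^'m" where
  "noise_at k j = traceless (A k) (Vh k j) - past_field k j"

lemma score_herm: "score k j \<in> herm (A k)"
  unfolding score_def by (rule traceless_herm[OF Y_herm])

lemma score_recursion:
  assumes "j \<ge> 1"
  shows "score k j = score k (j - 1) + (1 / (real j + 1)) *\<^sub>R (traceless (A k) (Vh k j) - \<tau> *\<^sub>R score k (j - 1))"
proof -
  note tl = linear_traceless[of "A k"]
  show ?thesis
    unfolding score_def Y_recursion[OF assms]
    by (simp add: linear_add[OF tl] linear_diff[OF tl] linear_scale[OF tl])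
qed

lemma traceless_Vh_bounded: "j \<ge> 1 \<Longrightarrow> norm (traceless (A k) (Vh k j)) \<le> C"
  using traceless_norm_le[OF A_nonempty] Vh_bounded order_trans by blast

lemma C_nonneg: "C \<ge> 0"
  using order_trans[OF norm_ge_zero Vh_bounded[of 1]] by simp

lemma score_bounded: "\<exists>R. \<forall>k j. norm (score k j) \<le> R k"
proof -
  have "\<exists>R. \<forall>j. norm (score k j) \<le> R" for k
  proof -
  define c where "c = max C (norm (score k 0))"
  have "c \<ge> 0" using C_nonneg by (simp add: c_def le_max_iff_disj)
  from relaxed_recursion_bounded[OF \<tau> this] obtain R where R:
    "\<forall>(y :: nat \<Rightarrow> complex^'m^'m) v. norm (y 0) \<le> c \<and> (\<forall>j\<ge>1. norm (v j) \<le> c) \<and>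
      (\<forall>j\<ge>1. y j = y (j - 1) + (1 / (real j + 1)) *\<^sub>R (v j - \<tau> *\<^sub>R y (j - 1))) \<longrightarrow> (\<forall>j. norm (y j) \<le> R)"
    by (rule exE)
  have "\<forall>j\<ge>1. norm (traceless (A k) (Vh k j)) \<le> c" using traceless_Vh_bounded by (simp add: c_def le_max_iff_disj)
  moreover have "norm (score k 0) \<le> c" by (simp add: c_def)
  ultimately have "\<forall>j. norm (score k j) \<le> R"
    using score_recursion by (intro R[rule_format, of "score k" "\<lambda>j. traceless (A k) (Vh k j)"] allI) auto
  then show ?thesis by blast
  qed
  then show ?thesis by metis
qed

definition radius :: "'k \<Rightarrow> real" where
  "radius = (SOME R. \<forall>k j. norm (score k j) \<le> R k)"

definition score_set :: "'k \<Rightarrow> (complex^'m^'m) set" where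
  "score_set k = herm (A k) \<inter> cball 0 (radius k)"

definition states :: "('k, 'm) profile set" where
  "states = {x. \<forall>k. x $ k \<in> score_set k}"

lemma score_set_compact: "compact (score_set k)"
  unfolding score_set_def by (intro closed_Int_compact closed_herm compact_cball)

lemma score_in_score_set: "score k j \<in> score_set k"
  using someI_ex[OF score_bounded] score_herm by (simp add: score_set_def radius_def)

lemma states_compact: "compact states"
proof -
  have "closed {x::('k, 'm) profile. x $ k \<in> score_set k}" for k
    using closed_vimage[OF compact_imp_closed[OF score_set_compact[of k]], of "\<lambda>x::('k, 'm) profile. x $ k"]
      continuous_on_component[OF continuous_on_id, of UNIV k] by (simp add: vimage_def)
  then have "closed states" unfolding states_def by (intro closed_Collect_all)
  moreover have "norm x \<le> (\<Sum>k\<in>UNIV. radius k)" if "x \<in> states" for x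
    by (rule order_trans[OF norm_vec_le_sum], rule sum_mono) (use that in \<open>auto simp: states_def score_set_def\<close>)
  ultimately show ?thesis by (auto simp: compact_eq_bounded_closed bounded_iff)
qed

lemma states_herm: "x \<in> states \<Longrightarrow> x $ k \<in> herm (A k)"
  by (simp add: states_def score_set_def)

lemma choice_profiles: "x \<in> states \<Longrightarrow> choice x \<in> profiles A"
  using exp_normalized_density[OF states_herm A_nonempty] by (simp add: profiles_def choice_def)

lemma field_continuous: "continuous_on states field"
proof -
  have "continuous_on states choice"
    unfolding choice_def
    by (intro continuous_intros continuous_on_compose2[OF continuous_exp_normalized[OF A_nonempty]])
      (use states_herm in auto)
  then show ?thesis
    unfolding field_def
    by (intro continuous_intros continuous_on_compose2[OF linear_continuous_on[OF linear_conv_bounded_linear[THEN iffD1, OF linear_traceless], of UNIV]]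
        continuous_on_compose2[OF V_mean_continuous]) (use choice_profiles in auto)
qed

lemma iterate_in_profiles: "iterate A T Y n w \<in> profiles A"
  by (simp add: iterate_eq profiles_def exp_normalized_density Y_herm A_nonempty)

lemma past_field_bounded: "norm (past_field k j) \<le> gain_bound"
  unfolding past_field_def
  using traceless_norm_le[OF A_nonempty] V_mean_bounded[OF iterate_in_profiles] order_trans by blast

sublocale async_path "\<lambda>k j. T k j w" score past_field noise_at \<tau> "C + gain_bound" states
proof
  show "score k j = score k (j - 1) + (1 / (real j + 1)) *\<^sub>R (past_field k j + noise_at k j - \<tau> *\<^sub>R score k (j - 1))"
    if "j \<ge> 1" for k j
    using score_recursion[OF that, of k] by (simp add: noise_at_def)
  show "norm (past_field k j) \<le> C + gain_bound" for k j using past_field_bounded[of k j] C_nonneg by simp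
  show "norm (noise_at k j) \<le> C + gain_bound" if "j \<ge> 1" for k j
    using norm_triangle_ineq4[of "traceless (A k) (Vh k j)" "past_field k j"] traceless_Vh_bounded[OF that, of k]
      past_field_bounded[of k j] by (simp add: noise_at_def)
  show "(\<chi> k. score k (tick_count (\<lambda>j. T k j w) t)) \<in> states" for t
    by (simp add: states_def score_in_score_set)
qed (use \<tau> ticks states_compact in auto)

lemma iterate_choice: "iterate A T Y n w = choice (state (epoch T n w))"
  by (simp add: iterate_eq choice_def state_def score_def exp_normalized_traceless[OF Y_herm A_nonempty])

text \<open>A user ticks at most once per epoch.\<close>

lemma epoch_of_ge: "j \<ge> 1 \<Longrightarrow> j \<le> epoch_of k j"
proof -
  assume j: "j \<ge> 1"
  have c: "j - 1 = count k (epoch_of k j)"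
    using tick_count_at_tick[OF ticks j, of k] by (simp only: epoch_of[OF j])
  have "epoch_of k j \<noteq> 0"
  proof
    assume "epoch_of k j = 0"
    then have "T k j w = -1" using epoch_of[OF j, of k] by simp
    then show False using ticks_nonneg[OF j, of k] by simp
  qed
  then obtain n where n: "epoch_of k j = 1 + n" by (metis Suc_pred' neq0_conv plus_1_eq_Suc)
  have "count k 1 = 0" using count_Suc[of k 0] no_update_at_0 by (simp only: One_nat_def count_0 if_False)
  then show ?thesis using c count_lag[of k 1 n] n by simp
qed

lemma past_at_top: "filterlim (past k) at_top sequentially"
  unfolding filterlim_at_top eventually_sequentially
proof (intro allI exI impI)
  fix m j :: nat assume "m + N + 1 \<le> j"
  then show "m \<le> past k j" using epoch_of_ge[of j k] epoch_of_le[of j k] by simp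
qed

text \<open>At most \<open>N\<close> updates of vanishing size separate the outdated profiles from the current ones.\<close>

lemma lag_vanishes: "(\<lambda>j. state (epoch T (past k j) w) - state (T k j w)) \<longlonglongrightarrow> 0"
proof (rule Lim_null_comparison)
  let ?d = "\<lambda>l j. speed * (real N * (1 / (real (count l (past k j)) + 1)))"
  have "(\<lambda>j. ?d l j) \<longlonglongrightarrow> speed * (real N * 0)" for l
  proof (intro tendsto_mult tendsto_const)
    have "filterlim (\<lambda>j. 1 + real (count l (past k j))) at_top sequentially"
      by (intro filterlim_tendsto_add_at_top[OF tendsto_const]
          filterlim_compose[OF filterlim_real_sequentially] filterlim_compose[OF count_at_top] past_at_top)
    then have "filterlim (\<lambda>j. real (count l (past k j)) + 1) at_top sequentially"
      by (simp only: add.commute)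
    then show "(\<lambda>j. 1 / (real (count l (past k j)) + 1)) \<longlonglongrightarrow> 0"
      by (rule real_tendsto_divide_at_top[OF tendsto_const])
  qed
  then have "(\<lambda>j. \<Sum>l\<in>UNIV. ?d l j) \<longlonglongrightarrow> (\<Sum>l\<in>(UNIV::'k set). speed * (real N * 0))"
    by (intro tendsto_sum)
  then show "(\<lambda>j. \<Sum>l\<in>UNIV. ?d l j) \<longlonglongrightarrow> 0" by simp
  show "\<forall>\<^sub>F j in sequentially. norm (state (epoch T (past k j) w) - state (T k j w))
      \<le> (\<Sum>l\<in>UNIV. ?d l j)"
    using eventually_ge_at_top[of 1]
  proof eventually_elim
    fix j :: nat assume j: "1 \<le> j"
    have e: "epoch T (past k j) w \<le> T k j w"
      using monoD[OF strict_mono_mono[OF epoch_strict_mono] past_le[OF j, of k]] by (simp only: epoch_of[OF j])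
    have "tick_count (\<lambda>j. T l j w) (T k j w) \<le> count l (past k j) + N" for l
    proof -
      have "tick_count (\<lambda>j. T l j w) (T k j w) = count l (past k j + (epoch_of k j - past k j))"
        using past_le[OF j, of k] by (simp only: epoch_of[OF j] le_add_diff_inverse)
      also have "\<dots> \<le> count l (past k j) + (epoch_of k j - past k j)" by (rule count_lag)
      also have "\<dots> \<le> count l (past k j) + N" using epoch_of_le[OF j, of k] by simp
      finally show ?thesis .
    qed
    from state_difference_le[OF e this]
    show "norm (state (epoch T (past k j) w) - state (T k j w))
      \<le> (\<Sum>l\<in>UNIV. ?d l j)"
      by (subst norm_minus_commute)
  qed
qed

lemma past_field_tracks_field: "(\<lambda>j. past_field k j - field (state (T k j w)) $ k) \<longlonglongrightarrow> 0"
proof (rule tendstoI)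
  fix e :: real assume e: "e > 0"
  have "uniformly_continuous_on states field"
    by (rule compact_uniformly_continuous[OF field_continuous states_compact])
  then obtain d where d: "d > 0" "\<And>x y. x \<in> states \<Longrightarrow> y \<in> states \<Longrightarrow> dist y x < d \<Longrightarrow> dist (field y) (field x) < e"
    using e unfolding uniformly_continuous_on_def by blast
  have "\<forall>\<^sub>F j in sequentially. dist (state (epoch T (past k j) w) - state (T k j w)) 0 < d"
    by (rule tendstoD[OF lag_vanishes d(1)])
  then show "\<forall>\<^sub>F j in sequentially. dist (past_field k j - field (state (T k j w)) $ k) 0 < e"
  proof eventually_elim
    fix j assume "dist (state (epoch T (past k j) w) - state (T k j w)) 0 < d"
    then have "dist (field (state (epoch T (past k j) w))) (field (state (T k j w))) < e"
      using d(2)[OF K(2) K(2)] by (simp add: dist_norm)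
    then have "norm ((field (state (epoch T (past k j) w)) - field (state (T k j w))) $ k) < e"
      unfolding dist_norm by (rule le_less_trans[OF vec_norm_nth_le])
    moreover have "past_field k j = field (state (epoch T (past k j) w)) $ k"
      by (simp add: past_field_def field_def iterate_choice)
    ultimately show "dist (past_field k j - field (state (T k j w)) $ k) 0 < e" by simp
  qed
qed

sublocale async_recursion "\<lambda>k j. T k j w" score past_field noise_at \<tau> "C + gain_bound" states field
proof
  show "(\<lambda>J. (1 / real J) *\<^sub>R (\<Sum>j\<in>{1..J}. noise_at k j)) \<longlonglongrightarrow> 0" for k
    using averaged_noise[of k] by (simp add: noise_at_def past_field_def linear_diff[OF linear_traceless])
qed (rule field_continuous past_field_tracks_field)+

text \<open>The scores follow the dynamics \<open>Y' = V(X) - \<tau> Y\<close> on the logarithmic time scale. The divergence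
  of the profile from the entropic equilibrium is a Lyapunov function of rate \<open>\<tau>\<close>: the scores of
  the equilibrium are \<open>V(X) / \<tau>\<close>, the field \<open>V\<close> is monotone, and the relaxation term contributes
  the symmetrized divergence.\<close>

theorem iterates_converge:
  assumes eq: "entropic_equilibrium \<tau> X"
  shows "(\<lambda>n. iterate A T Y n w) \<longlonglongrightarrow> X"
proof -
  have XP: "X \<in> profiles A" using eq by (simp add: entropic_equilibrium_def)
  define y0 where "y0 k = traceless (A k) ((1 / \<tau>) *\<^sub>R V_mean P L k X)" for k
  have VX: "(1 / \<tau>) *\<^sub>R V_mean P L k X \<in> herm (A k)" for k
    using V_mean_herm[OF XP] subspace_herm by (auto intro: subspace_scale)
  have y0: "y0 k \<in> herm (A k)" for k unfolding y0_def by (rule traceless_herm[OF VX])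
  have y0X: "exp_normalized (A k) (y0 k) = X $ k" for k
    unfolding y0_def using eq by (simp add: exp_normalized_traceless[OF VX A_nonempty] entropic_equilibrium_def)
  define D where "D x = (\<Sum>k\<in>UNIV. P k * bregman (A k) (x $ k) (y0 k))" for x :: "complex^'m^'m^'k"
  define G :: "complex^'m^'m^'k \<Rightarrow> complex^'m^'m^'k" where "G x = (\<chi> k. P k *\<^sub>R (exp_normalized (A k) (x $ k) - X $ k))" for x
  have P0: "P k \<ge> 0" for k using P_pos[of k] by simp
  have breg0: "bregman (A k) (x $ k) (y0 k) \<ge> 0" if "x \<in> states" for x k
    by (rule bregman_nonneg[OF y0 states_herm[OF that] A_nonempty])
  have "((\<lambda>t. D (state t)) \<longlongrightarrow> 0) at_top"
  proof (rule lyapunov_tendsto_0)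
    show "D x \<ge> 0" if "x \<in> states" for x
      unfolding D_def using breg0[OF that] P0 by (intro sum_nonneg) auto
    show "continuous_on states G"
      unfolding G_def
      by (intro continuous_intros continuous_on_compose2[OF continuous_exp_normalized[OF A_nonempty]])
        (use states_herm in auto)
    show "D y - D x \<le> G y \<bullet> (y - x)" if "x \<in> states" "y \<in> states" for x y
    proof -
      have "D y - D x = (\<Sum>k\<in>UNIV. P k * (bregman (A k) (y $ k) (y0 k) - bregman (A k) (x $ k) (y0 k)))"
        by (simp add: D_def sum_subtractf right_diff_distrib)
      also have "\<dots> \<le> (\<Sum>k\<in>UNIV. P k * ((exp_normalized (A k) (y $ k) - X $ k) \<bullet> (y $ k - x $ k)))"
        using bregman_increment[OF states_herm[OF that(1)] states_herm[OF that(2)] y0 A_nonempty] P0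
        by (intro sum_mono mult_left_mono) (auto simp: y0X)
      also have "\<dots> = G y \<bullet> (y - x)" by (simp only: G_def inner_vec_lambda) simp
      finally show ?thesis .
    qed
    show "G x \<bullet> (field x - \<tau> *\<^sub>R x) \<le> - \<tau> * D x" if x: "x \<in> states" for x
    proof -
      have dens: "exp_normalized (A k) (x $ k) \<in> density_mats (A k)" "X $ k \<in> density_mats (A k)" for k
        using profilesD[OF choice_profiles[OF x]] profilesD[OF XP] by (auto simp: choice_def)
      have summand: "(exp_normalized (A k) (x $ k) - X $ k) \<bullet> (field x $ k - \<tau> *\<^sub>R x $ k) =
          (choice x $ k - X $ k) \<bullet> (V_mean P L k (choice x) - V_mean P L k X)
          - \<tau> * ((exp_normalized (A k) (x $ k) - X $ k) \<bullet> (x $ k - y0 k))" for k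
      proof -
        have "\<tau> * ((exp_normalized (A k) (x $ k) - X $ k) \<bullet> y0 k) = (exp_normalized (A k) (x $ k) - X $ k) \<bullet> V_mean P L k X"
          unfolding y0_def density_diff_traceless[OF dens] using \<tau> by simp
        moreover have "(exp_normalized (A k) (x $ k) - X $ k) \<bullet> field x $ k = (exp_normalized (A k) (x $ k) - X $ k) \<bullet> V_mean P L k (choice x)"
          unfolding field_def vec_lambda_beta by (rule density_diff_traceless[OF dens])
        ultimately show ?thesis by (simp add: choice_def inner_diff_right algebra_simps)
      qed
      have "G x \<bullet> (field x - \<tau> *\<^sub>R x) = (\<Sum>k\<in>UNIV. P k * ((exp_normalized (A k) (x $ k) - X $ k) \<bullet> (field x $ k - \<tau> *\<^sub>R x $ k)))"
        by (simp only: G_def inner_vec_lambda) simp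
      also have "\<dots> = (\<Sum>k\<in>UNIV. P k * ((choice x $ k - X $ k) \<bullet> (V_mean P L k (choice x) - V_mean P L k X)))
          - \<tau> * (\<Sum>k\<in>UNIV. P k * ((exp_normalized (A k) (x $ k) - X $ k) \<bullet> (x $ k - y0 k)))"
        unfolding summand by (simp add: right_diff_distrib sum_subtractf sum_distrib_left mult_ac)
      also have "\<dots> \<le> 0 - \<tau> * D x"
      proof (rule diff_mono)
        show "(\<Sum>k\<in>UNIV. P k * ((choice x $ k - X $ k) \<bullet> (V_mean P L k (choice x) - V_mean P L k X))) \<le> 0"
          by (rule V_mean_monotone[OF XP choice_profiles[OF x]])
        have "D x \<le> (\<Sum>k\<in>UNIV. P k * ((exp_normalized (A k) (x $ k) - X $ k) \<bullet> (x $ k - y0 k)))"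
          unfolding D_def using bregman_le_symmetrized[OF y0 states_herm[OF x] A_nonempty] P0
          by (intro sum_mono mult_left_mono) (auto simp: y0X)
        then show "\<tau> * D x \<le> \<tau> * (\<Sum>k\<in>UNIV. P k * ((exp_normalized (A k) (x $ k) - X $ k) \<bullet> (x $ k - y0 k)))"
          using \<tau> by simp
      qed
      finally show ?thesis by simp
    qed
  qed
  then have D0: "(\<lambda>n. D (state (epoch T n w))) \<longlonglongrightarrow> 0" by (rule filterlim_compose[OF _ epoch_at_top])
  have "(\<lambda>n. exp_normalized (A k) (state (epoch T n w) $ k)) \<longlonglongrightarrow> exp_normalized (A k) (y0 k)" for k
  proof (rule bregman_tendsto_0D[OF A_nonempty score_set_compact[of k]])
    show "score_set k \<subseteq> herm (A k)" by (auto simp: score_set_def)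
    show "state (epoch T n w) $ k \<in> score_set k" for n using K(2) by (simp add: states_def)
    show "y0 k \<in> herm (A k)" by (rule y0)
    have le: "P k * bregman (A k) (state t $ k) (y0 k) \<le> D (state t)" for t
      unfolding D_def using breg0[OF K(2)] P0
      by (intro member_le_sum[of k UNIV "\<lambda>k. P k * bregman (A k) (state t $ k) (y0 k)"]) auto
    have "(\<lambda>n. P k * bregman (A k) (state (epoch T n w) $ k) (y0 k)) \<longlonglongrightarrow> 0"
      by (rule tendsto_sandwich[OF _ _ tendsto_const D0])
        (use breg0[OF K(2)] P0 le in \<open>auto intro!: always_eventually mult_nonneg_nonneg\<close>)
    then have "(\<lambda>n. (1 / P k) * (P k * bregman (A k) (state (epoch T n w) $ k) (y0 k))) \<longlonglongrightarrow> (1 / P k) * 0"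
      by (intro tendsto_mult tendsto_const)
    then show "(\<lambda>n. bregman (A k) (state (epoch T n w) $ k) (y0 k)) \<longlonglongrightarrow> 0"
      using P_pos[of k] by simp
  qed
  then have "(\<lambda>n. choice (state (epoch T n w)) $ k) \<longlonglongrightarrow> X $ k" for k by (simp add: choice_def y0X)
  then show ?thesis unfolding iterate_choice by (rule vec_tendstoI)
qed

end

section \<open>Measurability of the epochs, the profiles and the delays\<close>

text \<open>No exceptional null sets may be discarded here, since the \<open>\<sigma>\<close>-algebra need not be complete. The
  infimum of the empty set is a fixed real number, so the case distinction stays measurable.\<close>

lemma borel_measurable_Inf_family:
  fixes f :: "'i::countable \<Rightarrow> 'w \<Rightarrow> real"
  assumes f: "\<And>i. i \<in> I \<Longrightarrow> f i \<in> borel_measurable M" and p: "\<And>i. i \<in> I \<Longrightarrow> {w \<in> space M. p i w} \<in> sets M"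
    and bdd: "\<And>i w. w \<in> space M \<Longrightarrow> i \<in> I \<Longrightarrow> c \<le> f i w"
  shows "(\<lambda>w. Inf {f i w | i. i \<in> I \<and> p i w}) \<in> borel_measurable M"
  unfolding borel_measurable_iff_less
proof
  fix a
  have less: "Inf {f i w | i. i \<in> I \<and> p i w} < a \<longleftrightarrow>
      (\<exists>i\<in>I. p i w \<and> f i w < a) \<or> ((\<forall>i\<in>I. \<not> p i w) \<and> Inf ({}::real set) < a)" if w: "w \<in> space M" for w
  proof (cases "\<exists>i\<in>I. p i w")
    case True
    then have "{f i w | i. i \<in> I \<and> p i w} \<noteq> {}" by auto
    moreover have "bdd_below {f i w | i. i \<in> I \<and> p i w}" using bdd[OF w] by (auto intro!: bdd_belowI)
    ultimately show ?thesis using True by (subst cInf_less_iff) auto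
  next
    case False
    then have "{f i w | i. i \<in> I \<and> p i w} = {}" by auto
    then show ?thesis using False by (simp only:) auto
  qed
  have "{w \<in> space M. Inf {f i w | i. i \<in> I \<and> p i w} < a} =
      {w \<in> space M. (\<exists>i\<in>I. p i w \<and> f i w < a) \<or> ((\<forall>i\<in>I. \<not> p i w) \<and> Inf ({}::real set) < a)}"
    using less by blast
  also have "\<dots> \<in> sets M"
  proof -
    have [measurable]: "Measurable.pred M (\<lambda>w. p i w)" if "i \<in> I" for i
      using p[OF that] by (simp add: pred_def)
    have [measurable]: "Measurable.pred M (\<lambda>w. f i w < a)" if "i \<in> I" for i
      using borel_measurable_iff_less[THEN iffD1, OF f[OF that]] by (simp add: pred_def)
    have "Measurable.pred M (\<lambda>w. \<exists>i\<in>I. p i w \<and> f i w < a)" "Measurable.pred M (\<lambda>w. \<forall>i\<in>I. \<not> p i w)"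
      by (intro pred_intros_countable_bounded countableI_type; measurable)+
    then show ?thesis unfolding pred_def[symmetric] by measurable
  qed
  finally show "{w \<in> space M. Inf {f i w | i. i \<in> I \<and> p i w} < a} \<in> sets M" .
qed

lemma measurable_tick_count:
  assumes T: "\<And>j. j \<ge> 1 \<Longrightarrow> T j \<in> borel_measurable M" and t: "t \<in> borel_measurable M"
  shows "(\<lambda>w. tick_count (\<lambda>j. T j w) (t w)) \<in> measurable M (count_space UNIV)"
  unfolding tick_count_def
proof (rule measurable_card)
  fix j :: nat
  show "{w \<in> space M. j \<in> {j. 1 \<le> j \<and> T j w < t w}} \<in> sets M"
  proof (cases "j \<ge> 1")
    case True
    then show ?thesis using borel_measurable_less[OF T[OF True] t] by simp
  qed simp
qed

lemma borel_measurable_vec_lambda: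
  fixes f :: "'k::finite \<Rightarrow> 'w \<Rightarrow> 'e::euclidean_space"
  assumes "\<And>k. f k \<in> borel_measurable M"
  shows "(\<lambda>w. \<chi> k. f k w) \<in> borel_measurable M"
proof (rule borel_measurable_euclidean_space[THEN iffD2], rule ballI)
  fix i :: "'e^'k" assume "i \<in> Basis"
  then obtain k b where i: "i = axis k b" by (auto simp: Basis_vec_def)
  show "(\<lambda>w. (\<chi> k. f k w) \<bullet> i) \<in> borel_measurable M"
    unfolding i inner_axis using assms[of k] by simp
qed

lemma borel_measurable_vec_nth:
  fixes f :: "'w \<Rightarrow> 'e::euclidean_space^'k"
  shows "f \<in> borel_measurable M \<Longrightarrow> (\<lambda>w. f w $ k) \<in> borel_measurable M"
  by (rule measurable_compose[of f M borel "\<lambda>x. x $ k"])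
    (auto intro!: borel_measurable_continuous_onI continuous_intros)

lemma borel_measurable_exp_normalized:
  fixes S :: "'n::finite set"
  shows "exp_normalized S \<in> borel_measurable borel"
proof -
  have m: "mexp S \<in> borel_measurable borel" by (rule borel_measurable_continuous_onI[OF continuous_mexp])
  have "(\<lambda>B. mexp S B $ i $ j / trace (mexp S B)) \<in> borel_measurable borel" for i j
    unfolding trace_def
    by (intro borel_measurable_divide borel_measurable_sum borel_measurable_vec_nth m)
  then show ?thesis unfolding exp_normalized_def by (intro borel_measurable_vec_lambda)
qed

lemma timerD:
  assumes "timer M T"
  shows "\<And>j. j \<ge> 1 \<Longrightarrow> T j \<in> borel_measurable M"
    and "\<And>w. w \<in> space M \<Longrightarrow> strict_mono_on {1..} (\<lambda>j. T j w)"
    and "\<And>w j. w \<in> space M \<Longrightarrow> j \<ge> 1 \<Longrightarrow> T j w \<ge> 0"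
  using assms by (auto simp: timer_def)

lemma measurable_epoch:
  fixes T :: "'k::finite \<Rightarrow> nat \<Rightarrow> 'w \<Rightarrow> real"
  assumes T: "\<And>k. timer M (T k)"
  shows "epoch T n \<in> borel_measurable M"
proof (induct n)
  case (Suc n)
  have "(\<lambda>w. Inf {(\<lambda>(k, j). T k j) i w | i. i \<in> {(k, j). j \<ge> 1} \<and> epoch T n w < (\<lambda>(k, j). T k j) i w}) \<in> borel_measurable M"
  proof (rule borel_measurable_Inf_family)
    fix i :: "'k \<times> nat" assume i: "i \<in> {(k, j). j \<ge> 1}"
    show m: "(\<lambda>(k, j). T k j) i \<in> borel_measurable M"
      using i timerD(1)[OF T] by auto
    show "{w \<in> space M. epoch T n w < (\<lambda>(k, j). T k j) i w} \<in> sets M"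
      by (rule borel_measurable_less[OF Suc m])
    show "0 \<le> (\<lambda>(k, j). T k j) i w" if "w \<in> space M" for w
      using i timerD(3)[OF T that] by auto
  qed
  moreover have "{(\<lambda>(k, j). T k j) i w | i. i \<in> {(k, j). j \<ge> 1} \<and> epoch T n w < (\<lambda>(k, j). T k j) i w}
      = {t \<in> update_times T w. epoch T n w < t}" for w
    unfolding update_times_def by auto
  ultimately show ?case by simp
qed simp

lemma measurable_update_set_mem:
  fixes T :: "'k::finite \<Rightarrow> nat \<Rightarrow> 'w \<Rightarrow> real"
  assumes T: "\<And>k. timer M (T k)"
  shows "{w \<in> space M. k \<in> update_set T n w} \<in> sets M"
proof -
  have e: "epoch T n \<in> borel_measurable M" by (rule measurable_epoch) (rule T)
  have "{w \<in> space M. T k j w = epoch T n w} \<in> sets M" if "j \<ge> 1" for j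
    using borel_measurable_eq[OF timerD(1)[OF T[of k] that] e] by simp
  then have "(\<Union>j\<in>{1..}. {w \<in> space M. T k j w = epoch T n w}) \<in> sets M" by (intro sets.countable_UN') auto
  moreover have "(\<Union>j\<in>{1..}. {w \<in> space M. T k j w = epoch T n w}) = {w \<in> space M. k \<in> update_set T n w}"
    by (auto simp: update_set_def)
  ultimately show ?thesis by simp
qed

lemma measurable_update_set:
  fixes T :: "'k::finite \<Rightarrow> nat \<Rightarrow> 'w \<Rightarrow> real"
  assumes T: "\<And>k. timer M (T k)"
  shows "update_set T n \<in> measurable M (count_space UNIV)"
proof -
  have c: "countable (UNIV :: 'k set set)" by (rule countable_finite) simp
  show ?thesis
    unfolding measurable_count_space_eq_countable[OF c]
  proof (intro conjI ballI)
    fix s :: "'k set"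
    have mem: "{w \<in> space M. k \<in> update_set T n w} \<in> sets M" for k
      by (rule measurable_update_set_mem) (rule T)
    have "{w \<in> space M. k \<in> update_set T n w \<longleftrightarrow> k \<in> s} \<in> sets M" for k
    proof (cases "k \<in> s")
      case False
      then have "{w \<in> space M. k \<in> update_set T n w \<longleftrightarrow> k \<in> s} = space M - {w \<in> space M. k \<in> update_set T n w}" by auto
      then show ?thesis using mem[of k] by auto
    qed (use mem in simp)
    then have "(\<Inter>k. {w \<in> space M. k \<in> update_set T n w \<longleftrightarrow> k \<in> s}) \<in> sets M"
      by (intro sets.countable_INT') (auto intro: countable_finite)
    moreover have "(\<Inter>k. {w \<in> space M. k \<in> update_set T n w \<longleftrightarrow> k \<in> s})
        = {w \<in> space M. \<forall>k. k \<in> update_set T n w \<longleftrightarrow> k \<in> s}" by auto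
    ultimately have "{w \<in> space M. \<forall>k. k \<in> update_set T n w \<longleftrightarrow> k \<in> s} \<in> sets M" by simp
    moreover have "update_set T n -` {s} \<inter> space M = {w \<in> space M. \<forall>k. k \<in> update_set T n w \<longleftrightarrow> k \<in> s}" by auto
    ultimately show "update_set T n -` {s} \<inter> space M \<in> sets M" by simp
  qed simp
qed

lemma measurable_latest_broadcast_le:
  assumes T0: "timer M T0" and t: "t \<in> borel_measurable M" and s: "s \<in> borel_measurable M"
  shows "{w \<in> space M. latest_broadcast T0 (t w) w \<le> s w} \<in> sets M"
proof -
  note [measurable] = t s
  have Tm [measurable]: "T0 (Suc i) \<in> borel_measurable M" for i using timerD(1)[OF T0] by simp
  have le: "latest_broadcast T0 (t w) w \<le> s w \<longleftrightarrow>
      (if \<exists>i. T0 (Suc i) w \<le> t w then \<forall>i. T0 (Suc i) w \<le> t w \<longrightarrow> T0 (Suc i) w \<le> s w else Sup {} \<le> s w)" for w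
  proof -
    have eq: "{T0 i w | i. i \<ge> 1 \<and> T0 i w \<le> t w} = {T0 (Suc i) w | i. T0 (Suc i) w \<le> t w}"
      by (auto simp: Suc_le_eq) (metis Suc_pred)
    show ?thesis
    proof (cases "\<exists>i. T0 (Suc i) w \<le> t w")
      case True
      then have ne: "{T0 (Suc i) w | i. T0 (Suc i) w \<le> t w} \<noteq> {}" by auto
      have "bdd_above {T0 (Suc i) w | i. T0 (Suc i) w \<le> t w}" by (rule bdd_aboveI[of _ "t w"]) auto
      then show ?thesis unfolding latest_broadcast_def eq using True by (subst cSup_le_iff[OF ne]) auto
    next
      case False
      then have "{T0 (Suc i) w | i. T0 (Suc i) w \<le> t w} = {}" by auto
      then show ?thesis unfolding latest_broadcast_def eq using False by (simp only: if_False)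
    qed
  qed
  show ?thesis unfolding le by measurable
qed

lemma measurable_delay:
  fixes T :: "'k::finite \<Rightarrow> nat \<Rightarrow> 'w \<Rightarrow> real"
  assumes T0: "timer M T0" and T: "\<And>k. timer M (T k)"
  shows "delay T0 T n \<in> measurable M (count_space UNIV)"
  unfolding delay_def
proof (rule measurable_card)
  fix m
  have e: "epoch T n \<in> borel_measurable M" for n by (rule measurable_epoch) (rule T)
  have "{w \<in> space M. m \<in> {m. 1 \<le> m \<and> m < n \<and> latest_broadcast T0 (epoch T n w) w \<le> epoch T m w}}
      = (if 1 \<le> m \<and> m < n then {w \<in> space M. latest_broadcast T0 (epoch T n w) w \<le> epoch T m w} else {})" by auto
  then show "{w \<in> space M. m \<in> {m. 1 \<le> m \<and> m < n \<and> latest_broadcast T0 (epoch T n w) w \<le> epoch T m w}} \<in> sets M"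
    using measurable_latest_broadcast_le[OF T0 e[of n] e[of m]] by simp
qed

lemma measurable_iterate:
  fixes T :: "'k::finite \<Rightarrow> nat \<Rightarrow> 'w \<Rightarrow> real" and A :: "'k \<Rightarrow> 'm::finite set"
  assumes T: "\<And>k. timer M (T k)" and Y: "\<And>k j. Y k j \<in> borel_measurable M"
  shows "iterate A T Y n \<in> borel_measurable M"
proof -
  have e: "epoch T n \<in> borel_measurable M" by (rule measurable_epoch) (rule T)
  have "(\<lambda>w. exp_normalized (A k) (Y k (tick_count (\<lambda>j. T k j w) (epoch T n w)) w)) \<in> borel_measurable M" for k
    by (rule measurable_compose[OF measurable_compose_countable[OF Y[of k] measurable_tick_count[OF timerD(1)[OF T[of k]] e]]
        borel_measurable_exp_normalized])
  then have "(\<lambda>w. \<chi> k. exp_normalized (A k) (Y k (tick_count (\<lambda>j. T k j w) (epoch T n w)) w)) \<in> borel_measurable M"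
    by (rule borel_measurable_vec_lambda)
  then show ?thesis by (simp add: iterate_eq[abs_def])
qed

section \<open>A strong law of large numbers from second moments\<close>

lemma square_sandwich:
  fixes J :: nat
  defines "m \<equiv> floor_sqrt J"
  shows "m\<^sup>2 \<le> J" "J \<le> m\<^sup>2 + 2 * m"
proof -
  show "m\<^sup>2 \<le> J" unfolding m_def by (rule floor_sqrt_power2_le)
  have "J < (Suc m)\<^sup>2" unfolding m_def by (rule Suc_floor_sqrt_power2_gt)
  then show "J \<le> m\<^sup>2 + 2 * m" by (simp add: power2_eq_square)
qed

text \<open>Along the squares the averages tend to zero since their second moments are summable; between
  two consecutive squares the sums cannot change by more than a multiple of the square root.\<close>

lemma (in prob_space) averages_tendsto_0:
  fixes B :: "nat \<Rightarrow> 'a \<Rightarrow> real" and c :: real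
  assumes B: "\<And>J. B J \<in> borel_measurable M"
    and var: "\<And>J. integrable M (\<lambda>w. (B J w)\<^sup>2)" "\<And>J. (\<integral>w. (B J w)\<^sup>2 \<partial>M) \<le> c\<^sup>2 * J"
    and incr: "AE w in M. \<forall>J. \<bar>B (Suc J) w - B J w\<bar> \<le> c"
  shows "AE w in M. (\<lambda>J. B J w / J) \<longlonglongrightarrow> 0"
proof -
  define Q where "Q m w = (B ((Suc m)\<^sup>2) w / (Suc m)\<^sup>2)\<^sup>2" for m w
  have Qm: "Q m \<in> borel_measurable M" for m unfolding Q_def using B by measurable
  have Qint: "integrable M (Q m)" for m
    unfolding Q_def power_divide by (intro integrable_divide_zero var)
  have Q0: "Q m w \<ge> 0" for m w by (simp add: Q_def)
  have Qle: "(\<integral>w. Q m w \<partial>M) \<le> c\<^sup>2 * (1 / (real (Suc m))\<^sup>2)" for m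
  proof -
    have "(\<integral>w. Q m w \<partial>M) = (\<integral>w. (B ((Suc m)\<^sup>2) w)\<^sup>2 \<partial>M) / ((real (Suc m))\<^sup>2)\<^sup>2"
      unfolding Q_def power_divide by simp
    also have "\<dots> \<le> (c\<^sup>2 * real ((Suc m)\<^sup>2)) / ((real (Suc m))\<^sup>2)\<^sup>2"
      by (intro divide_right_mono var) simp
    also have "\<dots> = c\<^sup>2 * (1 / (real (Suc m))\<^sup>2)"
      unfolding of_nat_power by (simp add: power2_eq_square del: of_nat_Suc)
    finally show ?thesis .
  qed
  have "summable (\<lambda>m. c\<^sup>2 * (1 / (real (Suc m))\<^sup>2))"
    using inverse_squares_sums by (intro summable_mult) (auto simp: sums_iff add.commute)
  then have sm: "summable (\<lambda>m. \<integral>w. Q m w \<partial>M)"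
    by (rule summable_comparison_test'[where N = 0]) (use Qle Q0 in \<open>simp add: integral_nonneg_AE\<close>)
  have "(\<integral>\<^sup>+w. (\<Sum>m. ennreal (Q m w)) \<partial>M) = (\<Sum>m. \<integral>\<^sup>+w. ennreal (Q m w) \<partial>M)"
    by (intro nn_integral_suminf) (use Qm in measurable)
  also have "\<dots> = (\<Sum>m. ennreal (\<integral>w. Q m w \<partial>M))"
    using nn_integral_eq_integral[OF Qint] Q0 by (intro suminf_cong) simp
  also have "\<dots> < \<infinity>"
    using sm by (subst suminf_ennreal2) (auto intro!: integral_nonneg_AE simp: Q0 less_top)
  finally have "AE w in M. (\<Sum>m. ennreal (Q m w)) \<noteq> \<infinity>"
    using Qm by (intro nn_integral_PInf_AE) (auto simp: less_top)
  then have sq: "AE w in M. (\<lambda>m. Q m w) \<longlonglongrightarrow> 0"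
  proof eventually_elim
    fix w assume "(\<Sum>m. ennreal (Q m w)) \<noteq> \<infinity>"
    then have "summable (\<lambda>m. Q m w)" using Q0 by (intro summable_suminf_not_top) auto
    then show "(\<lambda>m. Q m w) \<longlonglongrightarrow> 0" by (rule summable_LIMSEQ_zero)
  qed
  from sq incr show ?thesis
  proof eventually_elim
    fix w assume Q: "(\<lambda>m. Q m w) \<longlonglongrightarrow> 0" and inc: "\<forall>J. \<bar>B (Suc J) w - B J w\<bar> \<le> c"
    let ?u = "\<lambda>J. \<bar>B ((floor_sqrt J)\<^sup>2) w\<bar> / (floor_sqrt J)\<^sup>2 + 2 * c * (1 / real (floor_sqrt J))"
    have c: "c \<ge> 0" using inc by (metis abs_ge_zero order_trans)
    have mono: "\<bar>B (n + d) w - B n w\<bar> \<le> c * real d" for n d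
    proof (induct d)
      case (Suc d)
      have "\<bar>B (Suc (n + d)) w - B (n + d) w\<bar> \<le> c" using inc by blast
      then show ?case using Suc by (simp add: algebra_simps)
    qed simp
    have "(\<lambda>m. sqrt (Q m w)) \<longlonglongrightarrow> sqrt 0" by (intro tendsto_real_sqrt Q)
    then have "(\<lambda>m. \<bar>B ((Suc m)\<^sup>2) w / (Suc m)\<^sup>2\<bar>) \<longlonglongrightarrow> 0" by (simp add: Q_def)
    then have s1: "(\<lambda>m. \<bar>B (m\<^sup>2) w\<bar> / m\<^sup>2) \<longlonglongrightarrow> 0"
      by (subst filterlim_sequentially_Suc[symmetric]) (simp add: abs_divide)
    have fs: "filterlim floor_sqrt at_top sequentially"
      unfolding filterlim_at_top eventually_sequentially
    proof (intro allI exI impI)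
      fix Z n :: nat assume "Z\<^sup>2 \<le> n"
      then show "Z \<le> floor_sqrt n" by (simp add: le_floor_sqrt_iff)
    qed
    have "(\<lambda>m::nat. 1 / real m) \<longlonglongrightarrow> 0" by (rule lim_1_over_n)
    then have "(\<lambda>m::nat. \<bar>B (m\<^sup>2) w\<bar> / m\<^sup>2 + 2 * c * (1 / real m)) \<longlonglongrightarrow> 0 + 2 * c * 0"
      by (intro tendsto_add tendsto_mult tendsto_const s1)
    then have lim: "(\<lambda>m::nat. \<bar>B (m\<^sup>2) w\<bar> / m\<^sup>2 + 2 * c * (1 / real m)) \<longlonglongrightarrow> 0" by simp
    have lim2: "?u \<longlonglongrightarrow> 0"
      by (rule filterlim_compose[OF lim fs])
    show "(\<lambda>J. B J w / J) \<longlonglongrightarrow> 0"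
    proof (rule Lim_null_comparison[OF _ lim2])
      show "\<forall>\<^sub>F J in sequentially. norm (B J w / real J) \<le> ?u J"
        using eventually_ge_at_top[of 1]
      proof eventually_elim
        fix J :: nat assume J: "1 \<le> J"
        define m where "m = floor_sqrt J"
        have m: "m\<^sup>2 \<le> J" "J \<le> m\<^sup>2 + 2 * m" using square_sandwich[of J] by (auto simp: m_def)
        then have m0: "m > 0" using J by (cases m) auto
        have "\<bar>B J w\<bar> \<le> \<bar>B (m\<^sup>2) w\<bar> + c * real (J - m\<^sup>2)"
          using mono[of "m\<^sup>2" "J - m\<^sup>2"] m(1) by simp
        also have "\<dots> \<le> \<bar>B (m\<^sup>2) w\<bar> + c * (2 * m)"
          using m c by (intro add_left_mono mult_left_mono) linarith+
        finally have "\<bar>B J w\<bar> / real J \<le> (\<bar>B (m\<^sup>2) w\<bar> + c * (2 * m)) / real (m\<^sup>2)"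
          using m m0 c by (intro frac_le) auto
        also have "\<dots> = \<bar>B (m\<^sup>2) w\<bar> / m\<^sup>2 + 2 * c * (1 / real m)"
          using m0 by (simp add: add_divide_distrib power2_eq_square)
        finally show "norm (B J w / real J) \<le> ?u J"
          by (simp add: m_def)
      qed
    qed
  qed
qed

section \<open>The noise of the gradient estimates averages out\<close>

text \<open>On a compact set of traceless Hermitian matrices, the normalized exponential is injective and
  continuous, so its inverse is continuous on the compact image.\<close>

lemma score_measurable_in_density:
  fixes S :: "'n::finite set"
  assumes S: "S \<noteq> {}"
  obtains s where "s \<in> borel_measurable borel"
    "\<And>Y. Y \<in> herm S \<Longrightarrow> idmat S \<bullet> Y = 0 \<Longrightarrow> norm Y \<le> R \<Longrightarrow> s (exp_normalized S Y) = Y"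
proof -
  define K where "K = herm S \<inter> {Y. idmat S \<bullet> Y = 0} \<inter> cball 0 R"
  have K: "compact K"
    unfolding K_def by (intro closed_Int_compact closed_Int closed_herm closed_Collect_eq continuous_intros compact_cball)
  have cont: "continuous_on K (exp_normalized S)"
    by (rule continuous_on_subset[OF continuous_exp_normalized[OF S]]) (auto simp: K_def)
  have inj: "inj_on (exp_normalized S) K"
    by (rule inj_onI) (rule exp_normalized_inj[OF S], auto simp: K_def)
  define s where "s X = indicator (exp_normalized S ` K) X *\<^sub>R inv_into K (exp_normalized S) X" for X
  have "continuous_on (exp_normalized S ` K) (inv_into K (exp_normalized S))"
    using continuous_on_inv[OF cont K] inj by simp
  moreover have "exp_normalized S ` K \<in> sets borel"
    by (intro borel_closed compact_imp_closed compact_continuous_image cont K)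
  ultimately have "s \<in> borel_measurable borel"
    unfolding s_def by (intro borel_measurable_continuous_on_indicator)
  moreover have "s (exp_normalized S Y) = Y" if "Y \<in> herm S" "idmat S \<bullet> Y = 0" "norm Y \<le> R" for Y
  proof -
    have "Y \<in> K" using that by (simp add: K_def)
    then show ?thesis using inj by (simp add: s_def)
  qed
  ultimately show ?thesis using that by blast
qed

lemma inner_entries: "V \<bullet> G = (\<Sum>i\<in>UNIV. \<Sum>j\<in>UNIV. Re (V $ i $ j) * Re (G $ i $ j) + Im (V $ i $ j) * Im (G $ i $ j))"
  for V G :: "complex^'m^'n"
  by (simp add: inner_vec_def inner_complex_def)

lemma norm_entry_le: "\<bar>Re (V $ i $ j)\<bar> \<le> norm V" "\<bar>Im (V $ i $ j)\<bar> \<le> norm V" for V :: "complex^'m^'n"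
proof -
  have "cmod (V $ i $ j) \<le> norm V"
    using vec_norm_nth_le[of "V $ i" j] vec_norm_nth_le[of V i] by simp
  then show "\<bar>Re (V $ i $ j)\<bar> \<le> norm V" "\<bar>Im (V $ i $ j)\<bar> \<le> norm V"
    using abs_Re_le_cmod abs_Im_le_cmod order_trans by blast+
qed

text \<open>Mapping a hit to the number of hits before it is injective.\<close>

lemma card_first_hits_le:
  fixes q :: "nat \<Rightarrow> bool"
  shows "card {n \<in> {1..N}. q n \<and> card {m \<in> {1..<n}. q m} < J} \<le> J"
proof -
  define c where "c n = card {m \<in> {1..<n}. q m}" for n :: nat
  let ?B = "{n \<in> {1..N}. q n \<and> c n < J}"
  have less: "c n < c n'" if "n < n'" "q n" "n \<ge> 1" for n n'
    unfolding c_def by (rule psubset_card_mono) (use that in auto)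
  have "inj_on c ?B"
  proof (rule inj_onI)
    fix n n' assume "n \<in> ?B" "n' \<in> ?B" "c n = c n'"
    then show "n = n'" using less[of n n'] less[of n' n] by (cases n n' rule: linorder_cases) auto
  qed
  moreover have "c ` ?B \<subseteq> {..<J}" by auto
  ultimately have "card ?B \<le> card {..<J}" by (metis card_inj_on_le finite_lessThan)
  then show ?thesis by (simp add: c_def)
qed

locale learning_process = channel_law L A P b + M: prob_space M
  for L :: "('k::finite, 'n::finite, 'm::finite) channel measure" and A P b and M :: "'w measure" +
  fixes H :: "real \<Rightarrow> 'w \<Rightarrow> ('k, 'n, 'm) channel" and T0 :: "nat \<Rightarrow> 'w \<Rightarrow> real" and T :: "'k \<Rightarrow> nat \<Rightarrow> 'w \<Rightarrow> real"
    and Y0 :: "'k \<Rightarrow> complex^'m^'m" and Y :: "'k \<Rightarrow> nat \<Rightarrow> 'w \<Rightarrow> complex^'m^'m" and \<tau> :: real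
  assumes \<tau>: "\<tau> > 0"
    and H_bounded: "AE w in M. \<forall>t\<ge>0. norm (H t w) \<le> b"
    and H_supported: "\<And>t w k. t \<ge> 0 \<Longrightarrow> w \<in> space M \<Longrightarrow> supported UNIV (A k) (H t w $ k)"
    and T0_timer: "timer M T0" and T_timer: "\<And>k. timer M (T k)"
    and T_rate: "\<And>k. positive_finite_rate M (T k)"
    and run: "learning_run A P \<tau> M H T0 T Y0 Y"
    and delays: "bounded_delays M T0 T"
    and unbiased: "unbiased_estimates A P L M H T0 T Y"
begin

lemma Y0_herm: "Y0 k \<in> herm (A k)"
  and Y_measurable: "Y k j \<in> borel_measurable M"
  and first_broadcast: "w \<in> space M \<Longrightarrow> T0 1 w \<le> T k 1 w"
  and Y_0: "w \<in> space M \<Longrightarrow> Y k 0 w = Y0 k"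
  and Y_recursion: "w \<in> space M \<Longrightarrow> j \<ge> 1 \<Longrightarrow> Y k j w = Y k (j - 1) w + (1 / (real j + 1)) *\<^sub>R
           (V_hat A P H T0 T Y k (T k j w) w - \<tau> *\<^sub>R Y k (j - 1) w)"
  using run unfolding learning_run_def herm_def by blast+

text \<open>Almost all paths satisfy these conditions, and along such paths the algebraic properties of the
  scores, profiles and estimates hold without exception.\<close>

definition good :: "'w \<Rightarrow> bool" where
  "good w \<longleftrightarrow> w \<in> space M \<and> (\<forall>k. regular_ticks (\<lambda>j. T k j w)) \<and> (\<forall>t\<ge>0. norm (H t w) \<le> b)"

lemma goodD: "good w \<Longrightarrow> w \<in> space M" "good w \<Longrightarrow> t \<ge> 0 \<Longrightarrow> norm (H t w) \<le> b"
  by (auto simp: good_def)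

lemma AE_good: "AE w in M. good w"
proof -
  have "AE w in M. \<forall>k. \<exists>c>0. (\<lambda>j. T k j w / real j) \<longlonglongrightarrow> c"
    unfolding AE_all_countable using T_rate by (simp add: positive_finite_rate_def)
  with H_bounded AE_space show ?thesis
    by eventually_elim (use timerD(2)[OF T_timer] in \<open>auto simp: good_def regular_ticks_def\<close>)
qed

lemma good_epochs: "good w \<Longrightarrow> regular_epochs T w"
  by standard (use timerD(3)[OF T_timer] in \<open>auto simp: good_def\<close>)

lemma V_hat_props:
  assumes w: "good w" and j: "j \<ge> 1"
    and Y: "\<And>l i. i \<le> tick_count (\<lambda>j. T l j w) (T k j w) \<Longrightarrow> Y l i w \<in> herm (A l)"
  shows "V_hat A P H T0 T Y k (T k j w) w \<in> herm (A k)"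
    "norm (V_hat A P H T0 T Y k (T k j w) w) \<le> gain_bound"
proof -
  interpret regular_epochs T w by (rule good_epochs[OF w])
  let ?t = "T k j w"
  let ?s = "latest_broadcast T0 ?t w"
  have t0: "?t \<ge> 0" by (rule ticks_nonneg[OF j])
  have wM: "w \<in> space M" by (rule goodD(1)[OF w])
  have "T k 1 w \<le> T k j w"
    using strict_ticks_less_iff[OF timerD(2)[OF T_timer[of k] wM], of 1 j] j by (cases "j = 1") auto
  then have "T0 1 w \<le> ?t" using first_broadcast[OF wM, of k] by simp
  then have "T0 1 w \<in> {T0 i w | i. i \<ge> 1 \<and> T0 i w \<le> ?t}" by force
  then have "?s \<le> ?t" unfolding latest_broadcast_def by (intro cSup_least) auto
  then have "profile_before A T Y ?s w $ l \<in> density_mats (A l)" for l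
    unfolding profile_before_def tick_count_def[symmetric] vec_lambda_beta
    by (intro exp_normalized_density A_nonempty Y tick_count_mono ticks)
  then have "profile_before A T Y ?s w \<in> profiles A" by (simp add: profiles_def)
  then have W: "broadcast A P H T Y ?s w \<in> above_id" unfolding broadcast_def by (rule W_above)
  show "V_hat A P H T0 T Y k ?t w \<in> herm (A k)"
    unfolding V_hat_def by (rule gain_herm[OF W H_supported[OF t0 wM]])
  show "norm (V_hat A P H T0 T Y k ?t w) \<le> gain_bound"
    unfolding V_hat_def gain_bound_def
    by (rule norm_gain_le[OF W order_trans[OF vec_norm_nth_le goodD(2)[OF w t0]]])
qed

text \<open>By induction over the epochs: an update uses a broadcast that was measured at scores which were
  formed at earlier epochs.\<close>

lemma Y_herm:
  assumes w: "good w"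
  shows "Y k j w \<in> herm (A k)"
proof -
  interpret regular_epochs T w by (rule good_epochs[OF w])
  have wM: "w \<in> space M" by (rule goodD(1)[OF w])
  have "\<forall>k. \<forall>j \<le> count k n. Y k j w \<in> herm (A k)" for n
  proof (induct n)
    case 0
    show ?case using Y0_herm Y_0[OF wM] by (simp only: count_0) simp
  next
    case (Suc n)
    show ?case
    proof (intro allI impI)
      fix k j assume j: "j \<le> count k (Suc n)"
      show "Y k j w \<in> herm (A k)"
      proof (cases "j \<le> count k n")
        case False
        then have jn: "j = Suc (count k n)" and k: "k \<in> update_set T n w"
          using j unfolding count_Suc by (auto split: if_splits)
        have t: "T k j w = epoch T n w" unfolding jn by (rule updating_user_tick[OF k])
        have V: "V_hat A P H T0 T Y k (T k j w) w \<in> herm (A k)"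
          by (rule V_hat_props(1)[OF w]) (use Suc t jn in auto)
        have "Y k (j - 1) w \<in> herm (A k)" using Suc jn by simp
        then show ?thesis
          using V Y_recursion[OF wM, of j k] jn subspace_herm
          by (simp del: One_nat_def) (intro subspace_add subspace_scale subspace_diff subspace_herm)
      qed (use Suc in blast)
    qed
  qed
  moreover obtain n where "j \<le> count k n"
    using count_at_top[of k] unfolding filterlim_at_top eventually_sequentially by blast
  ultimately show ?thesis by blast
qed

lemma V_hat_bounded: "good w \<Longrightarrow> j \<ge> 1 \<Longrightarrow> norm (V_hat A P H T0 T Y k (T k j w) w) \<le> gain_bound"
  by (rule V_hat_props) (simp_all add: Y_herm)

lemma iterate_profiles: "good w \<Longrightarrow> iterate A T Y n w \<in> profiles A"
  by (simp add: iterate_eq profiles_def exp_normalized_density Y_herm A_nonempty)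

abbreviation hist :: "nat \<Rightarrow> 'w measure" where "hist n \<equiv> history A M T0 T Y n"

abbreviation Vh :: "'k \<Rightarrow> nat \<Rightarrow> 'w \<Rightarrow> complex^'m^'m" where "Vh \<equiv> V_hat_epoch A P H T0 T Y"

definition cond_V :: "'k \<Rightarrow> nat \<Rightarrow> 'w \<Rightarrow> complex^'m^'m" where
  "cond_V k n = matrix_cond_exp M (hist n) (Vh k n)"

definition ticks_before :: "'k \<Rightarrow> nat \<Rightarrow> 'w \<Rightarrow> nat" where
  "ticks_before k n w = card {m \<in> {1..<n}. k \<in> update_set T m w}"

lemma ticks_before_eq:
  assumes "good w"
  shows "ticks_before k n w = tick_count (\<lambda>j. T k j w) (epoch T n w)"
proof -
  interpret regular_epochs T w by (rule good_epochs[OF assms])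
  have "{m. m < n \<and> k \<in> update_set T m w} = {m \<in> {1..<n}. k \<in> update_set T m w}"
    using no_update_at_0 by (auto simp: Suc_le_eq) (metis gr0I)
  then show ?thesis unfolding count_eq_card ticks_before_def by simp
qed

lemma V_hat_epoch_at_tick:
  assumes "good w" "k \<in> update_set T n w"
  shows "Vh k n w = V_hat A P H T0 T Y k (T k (Suc (ticks_before k n w)) w) w"
proof -
  interpret regular_epochs T w by (rule good_epochs[OF assms(1)])
  show ?thesis
    unfolding ticks_before_eq[OF assms(1)] updating_user_tick[OF assms(2)]
    using assms(2) by (simp add: V_hat_epoch_def)
qed

lemma AE_Vh_bounded: "AE w in M. norm (Vh k n w) \<le> gain_bound"
  using AE_good
proof eventually_elim
  fix w assume w: "good w"
  show "norm (Vh k n w) \<le> gain_bound"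
  proof (cases "k \<in> update_set T n w")
    case True
    then show ?thesis using V_hat_bounded[OF w] by (simp add: V_hat_epoch_at_tick[OF w])
  next
    case False
    then show ?thesis by (simp add: V_hat_epoch_def gain_bound_def)
  qed
qed

lemma epoch_measurable: "epoch T n \<in> borel_measurable M"
  by (rule measurable_epoch) (rule T_timer)

text \<open>The channel is only known to be measurable at deterministic times; the estimate at a random
  update time is measurable because it can be read off from the change of the score.\<close>

lemma Vh_measurable: "Vh k n \<in> borel_measurable M"
proof -
  let ?c = "\<lambda>w. tick_count (\<lambda>j. T k j w) (epoch T n w)"
  have c: "?c \<in> measurable M (count_space UNIV)"
    by (rule measurable_tick_count[OF timerD(1)[OF T_timer] epoch_measurable])
  define R where "R i w = (real i + 2) *\<^sub>R (Y k (Suc i) w - Y k i w) + \<tau> *\<^sub>R Y k i w" for i w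
  have R: "R i \<in> borel_measurable M" for i unfolding R_def using Y_measurable by measurable
  have Rc: "(\<lambda>w. R (?c w) w) \<in> borel_measurable M" by (rule measurable_compose_countable[OF R c])
  have eq: "Vh k n w = (if k \<in> update_set T n w then R (?c w) w else 0)" if w: "w \<in> space M" for w
  proof (cases "k \<in> update_set T n w")
    case True
    then obtain j where j: "j \<ge> 1" "T k j w = epoch T n w" by (auto simp: update_set_def)
    note sm = timerD(2)[OF T_timer[of k] w]
    have "?c w = j - 1"
      unfolding j(2)[symmetric]
      by (rule strict_ticks_count_eq(2)[OF sm strict_ticks_pred[OF sm j(1)]]) (use j in simp)
    then have cj: "Suc (?c w) = j" "real (?c w) + 2 = real j + 1" "?c w = j - 1" using j(1) by auto
    have "Vh k n w = V_hat A P H T0 T Y k (T k j w) w" using True j by (simp add: V_hat_epoch_def)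
    also have "\<dots> = (real j + 1) *\<^sub>R (Y k j w - Y k (j - 1) w) + \<tau> *\<^sub>R Y k (j - 1) w"
      using Y_recursion[OF w j(1), of k] by simp
    finally show ?thesis using True cj by (simp add: R_def)
  qed (simp add: V_hat_epoch_def)
  have "(\<lambda>w. if k \<in> update_set T n w then R (?c w) w else 0) \<in> borel_measurable M"
    by (rule measurable_If[OF Rc]) (simp_all add: measurable_update_set_mem[OF T_timer])
  then show ?thesis using eq by (subst measurable_cong) auto
qed

lemma space_hist [simp]: "space (hist n) = space M"
  by (simp add: history_def)

lemma delay_measurable: "delay T0 T n \<in> measurable M (count_space UNIV)"
  by (rule measurable_delay[OF T0_timer]) (rule T_timer)

lemma subalgebra_history:
  assumes N: "space N = space M"
    and m: "\<And>m. m \<in> {1..n} \<Longrightarrow> (\<lambda>w. (iterate A T Y m w, update_set T m w, delay T0 T m w))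
      \<in> measurable N (borel \<Otimes>\<^sub>M count_space UNIV \<Otimes>\<^sub>M count_space UNIV)"
  shows "subalgebra N (hist n)"
proof -
  have "(\<lambda>w. \<lambda>m\<in>{1..n}. (iterate A T Y m w, update_set T m w, delay T0 T m w))
      \<in> measurable N (PiM {1..n} (\<lambda>_. borel \<Otimes>\<^sub>M count_space UNIV \<Otimes>\<^sub>M count_space UNIV))"
    by (rule measurable_restrict[OF m])
  then show ?thesis
    unfolding measurable_iff_sets history_def subalgebra_def N by simp
qed

lemma hist_subalgebra: "subalgebra M (hist n)"
proof (rule subalgebra_history[OF refl])
  fix m
  have "iterate A T Y m \<in> borel_measurable M" by (rule measurable_iterate[OF T_timer Y_measurable])
  moreover have "update_set T m \<in> measurable M (count_space UNIV)" by (rule measurable_update_set) (rule T_timer)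
  ultimately show "(\<lambda>w. (iterate A T Y m w, update_set T m w, delay T0 T m w))
      \<in> measurable M (borel \<Otimes>\<^sub>M count_space UNIV \<Otimes>\<^sub>M count_space UNIV)"
    using delay_measurable by (intro measurable_Pair) 
qed

lemma hist_component:
  assumes "m \<in> {1..n}"
  shows "(\<lambda>w. (iterate A T Y m w, update_set T m w, delay T0 T m w))
      \<in> measurable (hist n) (borel \<Otimes>\<^sub>M count_space UNIV \<Otimes>\<^sub>M count_space UNIV)"
proof -
  let ?N = "borel \<Otimes>\<^sub>M count_space UNIV \<Otimes>\<^sub>M count_space UNIV :: (('k, 'm) profile \<times> 'k set \<times> nat) measure"
  let ?f = "\<lambda>w. \<lambda>m\<in>{1..n}. (iterate A T Y m w, update_set T m w, delay T0 T m w)"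
  have "?f \<in> measurable (hist n) (PiM {1..n} (\<lambda>_. ?N))"
    unfolding history_def
    by (rule measurable_vimage_algebra1) (auto simp: space_PiM space_pair_measure)
  from measurable_compose[OF this measurable_component_singleton[OF assms]]
  show ?thesis using assms by simp
qed

lemma hist_mono: "n \<le> n' \<Longrightarrow> subalgebra (hist n') (hist n)"
  by (rule subalgebra_history) (auto intro!: hist_component)

lemma hist_iterate: "m \<in> {1..n} \<Longrightarrow> iterate A T Y m \<in> borel_measurable (hist n)"
  using measurable_compose[OF hist_component measurable_fst] by simp

lemma hist_update_set:
  assumes "m \<in> {1..n}"
  shows "{w \<in> space M. k \<in> update_set T m w} \<in> sets (hist n)"
proof -
  have "update_set T m \<in> measurable (hist n) (count_space UNIV)"
    using measurable_compose[OF measurable_compose[OF hist_component[OF assms] measurable_snd] measurable_fst] by simp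
  then have "update_set T m -` {s. k \<in> s} \<inter> space (hist n) \<in> sets (hist n)" by (rule measurable_sets) simp
  moreover have "update_set T m -` {s. k \<in> s} \<inter> space (hist n) = {w \<in> space M. k \<in> update_set T m w}" by auto
  ultimately show ?thesis by simp
qed

lemma hist_ticks_before:
  assumes "n \<le> Suc n'"
  shows "ticks_before k n \<in> measurable (hist n') (count_space UNIV)"
  unfolding ticks_before_def
proof (rule measurable_card)
  fix m
  show "{w \<in> space (hist n'). m \<in> {m \<in> {1..<n}. k \<in> update_set T m w}} \<in> sets (hist n')"
  proof (cases "m \<in> {1..<n}")
    case True
    then have "m \<in> {1..n'}" using assms by simp
    moreover have "{w \<in> space (hist n'). m \<in> {m \<in> {1..<n}. k \<in> update_set T m w}} = {w \<in> space M. k \<in> update_set T m w}"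
      using True by simp
    ultimately show ?thesis by (simp only: hist_update_set)
  next
    case False
    then have "{w \<in> space (hist n'). m \<in> {m \<in> {1..<n}. k \<in> update_set T m w}} = {}" by blast
    then show ?thesis by (simp only: sets.empty_sets)
  qed
qed

lemma cond_V_measurable: "cond_V k n \<in> borel_measurable (hist n)"
proof -
  have "(\<lambda>w. Complex (real_cond_exp M (hist n) (\<lambda>w. Re (Vh k n w $ i $ j)) w)
      (real_cond_exp M (hist n) (\<lambda>w. Im (Vh k n w $ i $ j)) w)) \<in> borel_measurable (hist n)" for i j
    unfolding borel_measurable_complex_iff by simp
  then show ?thesis
    unfolding cond_V_def matrix_cond_exp_def[abs_def] by (intro borel_measurable_vec_lambda)
qed

text \<open>The defining property of the conditional expectation, for the pairing with a matrix \<open>G\<close>.\<close>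

lemma cond_V_pairing:
  assumes g: "g \<in> borel_measurable (hist n)" and gb: "AE w in M. \<bar>g w\<bar> \<le> c"
  shows "integrable M (\<lambda>w. g w * (Vh k n w \<bullet> G))" "integrable M (\<lambda>w. g w * (cond_V k n w \<bullet> G))"
    "(\<integral>w. g w * (cond_V k n w \<bullet> G) \<partial>M) = (\<integral>w. g w * (Vh k n w \<bullet> G) \<partial>M)"
proof -
  interpret F: finite_measure_subalgebra M "hist n" by standard (rule hist_subalgebra)
  have gM: "g \<in> borel_measurable M" by (rule measurable_from_subalg[OF hist_subalgebra g])
  have pair: "integrable M (\<lambda>w. g w * h w)" "integrable M (\<lambda>w. g w * real_cond_exp M (hist n) h w)"
      "(\<integral>w. g w * real_cond_exp M (hist n) h w \<partial>M) = (\<integral>w. g w * h w \<partial>M)"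
    if h: "h \<in> borel_measurable M" and hb: "AE w in M. \<bar>h w\<bar> \<le> gain_bound" for h
  proof -
    show int: "integrable M (\<lambda>w. g w * h w)"
    proof (rule M.integrable_const_bound[where B = "c * gain_bound"])
      show "AE w in M. norm (g w * h w) \<le> c * gain_bound"
        using gb hb
      proof eventually_elim
        fix w assume "\<bar>g w\<bar> \<le> c" "\<bar>h w\<bar> \<le> gain_bound"
        then have "\<bar>g w\<bar> * \<bar>h w\<bar> \<le> c * gain_bound" by (intro mult_mono) auto
        then show "norm (g w * h w) \<le> c * gain_bound" by (simp add: abs_mult)
      qed
    qed (use gM h in measurable)
    show "integrable M (\<lambda>w. g w * real_cond_exp M (hist n) h w)"
      "(\<integral>w. g w * real_cond_exp M (hist n) h w \<partial>M) = (\<integral>w. g w * h w \<partial>M)"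
      using F.real_cond_exp_intg[OF int g h] by auto
  qed
  have m: "(\<lambda>w. Vh k n w $ i $ j) \<in> borel_measurable M" for i j
    by (intro borel_measurable_vec_nth Vh_measurable)
  have re: "(\<lambda>w. Re (Vh k n w $ i $ j)) \<in> borel_measurable M" "AE w in M. \<bar>Re (Vh k n w $ i $ j)\<bar> \<le> gain_bound" for i j
    using m[of i j] AE_Vh_bounded[of k n]
    by (auto simp: borel_measurable_complex_iff elim!: eventually_mono intro: order_trans[OF norm_entry_le(1)])
  have im: "(\<lambda>w. Im (Vh k n w $ i $ j)) \<in> borel_measurable M" "AE w in M. \<bar>Im (Vh k n w $ i $ j)\<bar> \<le> gain_bound" for i j
    using m[of i j] AE_Vh_bounded[of k n]
    by (auto simp: borel_measurable_complex_iff elim!: eventually_mono intro: order_trans[OF norm_entry_le(2)])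
  note pr = pair[OF re] and pi = pair[OF im]
  have V: "(\<lambda>w. g w * (Vh k n w \<bullet> G)) = (\<lambda>w. \<Sum>i\<in>UNIV. \<Sum>j\<in>UNIV. Re (G $ i $ j) * (g w * Re (Vh k n w $ i $ j))
      + Im (G $ i $ j) * (g w * Im (Vh k n w $ i $ j)))"
    unfolding inner_entries by (simp add: sum_distrib_left algebra_simps)
  have C: "(\<lambda>w. g w * (cond_V k n w \<bullet> G)) = (\<lambda>w. \<Sum>i\<in>UNIV. \<Sum>j\<in>UNIV.
      Re (G $ i $ j) * (g w * real_cond_exp M (hist n) (\<lambda>w. Re (Vh k n w $ i $ j)) w)
      + Im (G $ i $ j) * (g w * real_cond_exp M (hist n) (\<lambda>w. Im (Vh k n w $ i $ j)) w))"
    unfolding inner_entries by (simp add: cond_V_def matrix_cond_exp_def sum_distrib_left algebra_simps)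
  show "integrable M (\<lambda>w. g w * (Vh k n w \<bullet> G))"
    unfolding V by (intro Bochner_Integration.integrable_sum Bochner_Integration.integrable_add integrable_mult_right pr pi)
  show "integrable M (\<lambda>w. g w * (cond_V k n w \<bullet> G))"
    unfolding C by (intro Bochner_Integration.integrable_sum Bochner_Integration.integrable_add integrable_mult_right pr pi)
  show "(\<integral>w. g w * (cond_V k n w \<bullet> G) \<partial>M) = (\<integral>w. g w * (Vh k n w \<bullet> G) \<partial>M)"
    unfolding V C using pr pi by simp
qed

lemma AE_unbiased: "AE w in M. \<forall>n\<ge>1. \<forall>k. k \<in> update_set T n w \<longrightarrow>
    cond_V k n w = V_mean P L k (iterate A T Y (n - delay T0 T n w) w)"
proof -
  have "AE w in M. \<forall>n. \<forall>k. n \<ge> 1 \<longrightarrow> k \<in> update_set T n w \<longrightarrow>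
    cond_V k n w = V_mean P L k (iterate A T Y (n - delay T0 T n w) w)"
    unfolding AE_all_countable using unbiased by (auto simp: unbiased_estimates_def cond_V_def)
  then show ?thesis by eventually_elim blast
qed

text \<open>Epoch \<open>n\<close> carries one of the first \<open>J\<close> ticks of user \<open>k\<close>. Since there are at most \<open>J\<close> such epochs,
  sums over them have bounds that do not involve the random rates of the timers.\<close>

definition active :: "'k \<Rightarrow> nat \<Rightarrow> nat \<Rightarrow> 'w \<Rightarrow> bool" where
  "active k J n w \<longleftrightarrow> k \<in> update_set T n w \<and> ticks_before k n w < J"

text \<open>The traceless part of the estimation error, tested against a matrix \<open>G\<close>.\<close>

definition noise_term :: "'k \<Rightarrow> complex^'m^'m \<Rightarrow> nat \<Rightarrow> nat \<Rightarrow> 'w \<Rightarrow> real" where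
  "noise_term k G J n w = (if active k J n w then (Vh k n w - cond_V k n w) \<bullet> traceless (A k) G else 0)"

definition noise_bound :: "'k \<Rightarrow> complex^'m^'m \<Rightarrow> real" where
  "noise_bound k G = 2 * gain_bound * norm (traceless (A k) G)"

lemma hist_active: "1 \<le> n \<Longrightarrow> n \<le> n' \<Longrightarrow> {w \<in> space M. active k J n w} \<in> sets (hist n')"
proof -
  assume n: "1 \<le> n" "n \<le> n'"
  have "ticks_before k n -` {..<J} \<inter> space (hist n') \<in> sets (hist n')"
    by (rule measurable_sets[OF hist_ticks_before]) (use n in auto)
  moreover have "{w \<in> space M. k \<in> update_set T n w} \<in> sets (hist n')"
    by (rule hist_update_set) (use n in auto)
  moreover have "{w \<in> space M. active k J n w} =
      {w \<in> space M. k \<in> update_set T n w} \<inter> (ticks_before k n -` {..<J} \<inter> space (hist n'))"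
    by (auto simp: active_def)
  ultimately show ?thesis by auto
qed

lemma noise_difference_le:
  assumes w: "good w" and k: "k \<in> update_set T n w"
    and u: "cond_V k n w = V_mean P L k (iterate A T Y (n - delay T0 T n w) w)"
  shows "\<bar>(Vh k n w - cond_V k n w) \<bullet> traceless (A k) G\<bar> \<le> noise_bound k G"
proof -
  have "norm (Vh k n w) \<le> gain_bound"
    using V_hat_bounded[OF w] by (simp add: V_hat_epoch_at_tick[OF w k])
  moreover have "norm (cond_V k n w) \<le> gain_bound"
    unfolding u by (rule V_mean_bounded[OF iterate_profiles[OF w]])
  ultimately have "norm (Vh k n w - cond_V k n w) \<le> 2 * gain_bound"
    using norm_triangle_ineq4[of "Vh k n w" "cond_V k n w"] by simp
  then have "norm (Vh k n w - cond_V k n w) * norm (traceless (A k) G) \<le> noise_bound k G"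
    unfolding noise_bound_def by (rule mult_right_mono) simp
  then show ?thesis by (rule order_trans[OF Cauchy_Schwarz_ineq2])
qed

lemma noise_bound_nonneg: "noise_bound k G \<ge> 0"
  by (simp add: noise_bound_def gain_bound_def)

lemma AE_noise_term_le: "n \<ge> 1 \<Longrightarrow> AE w in M. \<bar>noise_term k G J n w\<bar> \<le> noise_bound k G"
  using AE_good AE_unbiased
proof eventually_elim
  fix w assume n: "1 \<le> n" and w: "good w" and u: "\<forall>n\<ge>1. \<forall>k. k \<in> update_set T n w \<longrightarrow>
    cond_V k n w = V_mean P L k (iterate A T Y (n - delay T0 T n w) w)"
  show "\<bar>noise_term k G J n w\<bar> \<le> noise_bound k G"
  proof (cases "active k J n w")
    case True
    then have "k \<in> update_set T n w" by (simp add: active_def)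
    then show ?thesis using True noise_difference_le[OF w] u n by (simp only: noise_term_def if_True)
  qed (simp add: noise_term_def noise_bound_nonneg)
qed

lemma noise_term_measurable:
  assumes "n \<ge> 1"
  shows "noise_term k G J n \<in> borel_measurable M"
proof -
  have "cond_V k n \<in> borel_measurable M" by (rule measurable_from_subalg[OF hist_subalgebra cond_V_measurable])
  then have "(\<lambda>w. (Vh k n w - cond_V k n w) \<bullet> traceless (A k) G) \<in> borel_measurable M"
    using Vh_measurable[of k n] by measurable
  moreover have "{w \<in> space M. active k J n w} \<in> sets M"
    using hist_active[OF assms order_refl] hist_subalgebra by (auto simp: subalgebra_def)
  ultimately show ?thesis unfolding noise_term_def[abs_def] by (intro measurable_If) auto
qed

text \<open>The traceless scores are bounded, hence measurable functions of the profile, and so is the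
  estimate between two successive profiles. In this sense the traceless part of the noise at epoch
  \<open>n\<close> belongs to the history at epoch \<open>n + 1\<close>; the trace of the estimate is invisible in the
  profiles, but it does not influence them either.\<close>

lemma noise_term_adapted:
  assumes n: "n \<ge> 1"
  obtains g where "g \<in> borel_measurable (hist (Suc n))" "AE w in M. g w = noise_term k G J n w"
proof -
  define c where "c = max gain_bound (norm (traceless (A k) (Y0 k)))"
  have c0: "c \<ge> 0" by (simp add: c_def le_max_iff_disj)
  obtain R where R: "\<forall>(z :: nat \<Rightarrow> complex^'m^'m) v. norm (z 0) \<le> c \<and> (\<forall>j\<ge>1. norm (v j) \<le> c) \<and>
        (\<forall>j\<ge>1. z j = z (j - 1) + (1 / (real j + 1)) *\<^sub>R (v j - \<tau> *\<^sub>R z (j - 1))) \<longrightarrow> (\<forall>j. norm (z j) \<le> R)"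
    using relaxed_recursion_bounded[OF \<tau> c0] by (rule exE)
  obtain s where s: "s \<in> borel_measurable borel"
    "\<And>Y. Y \<in> herm (A k) \<Longrightarrow> idmat (A k) \<bullet> Y = 0 \<Longrightarrow> norm Y \<le> R \<Longrightarrow> s (exp_normalized (A k) Y) = Y"
    using score_measurable_in_density[OF A_nonempty] by metis
  have tl: "linear (traceless (A k))" by (rule linear_traceless)
  have score: "s (exp_normalized (A k) (Y k j w)) = traceless (A k) (Y k j w)" if w: "good w" for j w
  proof -
    let ?z = "\<lambda>j. traceless (A k) (Y k j w)"
    let ?v = "\<lambda>j. traceless (A k) (V_hat A P H T0 T Y k (T k j w) w)"
    note wM = goodD(1)[OF w]
    have "\<forall>j. norm (?z j) \<le> R"
    proof (rule R[rule_format, of ?z ?v, THEN allI], intro conjI allI impI)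
      show "norm (?z 0) \<le> c" by (simp add: Y_0[OF wM] c_def)
      show "norm (?v j) \<le> c" if "1 \<le> j" for j
        using order_trans[OF traceless_norm_le[OF A_nonempty] V_hat_bounded[OF w that]] by (simp add: c_def le_max_iff_disj)
      show "?z j = ?z (j - 1) + (1 / (real j + 1)) *\<^sub>R (?v j - \<tau> *\<^sub>R ?z (j - 1))" if "1 \<le> j" for j
        unfolding linear_scale[OF tl, symmetric] linear_diff[OF tl, symmetric] linear_add[OF tl, symmetric]
        using Y_recursion[OF wM that, of k] by (rule arg_cong)
    qed
    then have "s (exp_normalized (A k) (?z j)) = ?z j"
      by (intro s(2) traceless_herm Y_herm[OF w] traceless_idmat_inner A_nonempty) auto
    then show ?thesis by (simp add: exp_normalized_traceless[OF Y_herm[OF w] A_nonempty])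
  qed
  define X where "X m w = s (iterate A T Y m w $ k)" for m w
  have X: "X m \<in> borel_measurable (hist (Suc n))" if "m \<in> {1..Suc n}" for m
    unfolding X_def
    by (rule measurable_compose[OF borel_measurable_vec_nth[OF hist_iterate[OF that]] s(1)])
  define g where "g w = (if active k J n w then
      ((real (ticks_before k n w) + 2) *\<^sub>R (X (Suc n) w - X n w) + \<tau> *\<^sub>R X n w) \<bullet> G
      - cond_V k n w \<bullet> traceless (A k) G else 0)" for w
  have "g \<in> borel_measurable (hist (Suc n))"
    unfolding g_def[abs_def]
  proof (rule measurable_If)
    have tb: "(\<lambda>w. real (ticks_before k n w)) \<in> borel_measurable (hist (Suc n))"
      by (rule measurable_compose[OF hist_ticks_before]) (use n in auto)
    have cv: "cond_V k n \<in> borel_measurable (hist (Suc n))"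
      by (rule measurable_from_subalg[OF hist_mono cond_V_measurable]) simp

    show "(\<lambda>w. ((real (ticks_before k n w) + 2) *\<^sub>R (X (Suc n) w - X n w) + \<tau> *\<^sub>R X n w) \<bullet> G
      - cond_V k n w \<bullet> traceless (A k) G) \<in> borel_measurable (hist (Suc n))"
      by (intro borel_measurable_diff borel_measurable_inner borel_measurable_add borel_measurable_scaleR
          borel_measurable_const tb cv X) (use n in auto)
    show "{w \<in> space (hist (Suc n)). active k J n w} \<in> sets (hist (Suc n))"
      using hist_active[OF n, of "Suc n" k J] by simp
  qed simp
  moreover have "AE w in M. g w = noise_term k G J n w"
    using AE_good
  proof eventually_elim
    fix w assume w: "good w"
    interpret regular_epochs T w by (rule good_epochs[OF w])
    show "g w = noise_term k G J n w"
    proof (cases "active k J n w")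
      case True
      then have k: "k \<in> update_set T n w" by (simp add: active_def)
      define j where "j = Suc (count k n)"
      have j: "j \<ge> 1" "real (ticks_before k n w) + 2 = real j + 1" "j - 1 = count k n"
        by (auto simp: ticks_before_eq[OF w] j_def)
      have "Y k j w = Y k (j - 1) w + (1 / (real j + 1)) *\<^sub>R (Vh k n w - \<tau> *\<^sub>R Y k (j - 1) w)"
        using Y_recursion[OF goodD(1)[OF w] j(1), of k] V_hat_epoch_at_tick[OF w k]
        by (simp add: ticks_before_eq[OF w] j_def)
      then have "Vh k n w = (real j + 1) *\<^sub>R (Y k j w - Y k (j - 1) w) + \<tau> *\<^sub>R Y k (j - 1) w"
        by simp
      then have "traceless (A k) (Vh k n w) = (real j + 1) *\<^sub>R (traceless (A k) (Y k j w) - traceless (A k) (Y k (j - 1) w))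
          + \<tau> *\<^sub>R traceless (A k) (Y k (j - 1) w)"
        by (simp only: linear_add[OF tl] linear_diff[OF tl] linear_scale[OF tl])
      moreover have "X n w = traceless (A k) (Y k (j - 1) w)"
        unfolding X_def iterate_eq vec_lambda_beta score[OF w] j(3) ..
      moreover have "X (Suc n) w = traceless (A k) (Y k j w)"
        unfolding X_def iterate_eq vec_lambda_beta score[OF w] count_Suc using k by (simp add: j_def)
      ultimately have "((real (ticks_before k n w) + 2) *\<^sub>R (X (Suc n) w - X n w) + \<tau> *\<^sub>R X n w) \<bullet> G
          = traceless (A k) (Vh k n w) \<bullet> G"
        by (simp only: j(2))
      then show ?thesis using True by (simp add: g_def noise_term_def inner_diff_left traceless_inner)
    qed (simp add: g_def noise_term_def)
  qed
  ultimately show ?thesis using that by blast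
qed

lemma noise_products_integrable:
  assumes "n \<ge> 1" "n' \<ge> 1"
  shows "integrable M (\<lambda>w. noise_term k G J n w * noise_term k G J n' w)"
proof (rule M.integrable_const_bound[where B = "noise_bound k G * noise_bound k G"])
  show "AE w in M. norm (noise_term k G J n w * noise_term k G J n' w) \<le> noise_bound k G * noise_bound k G"
    using AE_noise_term_le[OF assms(1), of k G J] AE_noise_term_le[OF assms(2), of k G J]
  proof eventually_elim
    fix w assume "\<bar>noise_term k G J n w\<bar> \<le> noise_bound k G" "\<bar>noise_term k G J n' w\<bar> \<le> noise_bound k G"
    then have "\<bar>noise_term k G J n w\<bar> * \<bar>noise_term k G J n' w\<bar> \<le> noise_bound k G * noise_bound k G"
      using noise_bound_nonneg by (intro mult_mono) auto
    then show "norm (noise_term k G J n w * noise_term k G J n' w) \<le> noise_bound k G * noise_bound k G"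
      by (simp add: abs_mult)
  qed
qed (intro borel_measurable_times noise_term_measurable assms)

text \<open>The earlier term belongs to the history of the later one, whose conditional mean vanishes.\<close>

lemma noise_terms_orthogonal:
  assumes n: "1 \<le> n" "n < n'"
  shows "(\<integral>w. noise_term k G J n w * noise_term k G J n' w \<partial>M) = 0"
proof -
  obtain g where g: "g \<in> borel_measurable (hist (Suc n))" "AE w in M. g w = noise_term k G J n w"
    using noise_term_adapted[OF n(1)] by metis
  define h where "h w = (if active k J n' w then g w else 0)" for w
  have h: "h \<in> borel_measurable (hist n')"
    unfolding h_def[abs_def]
  proof (rule measurable_If)
    show "g \<in> borel_measurable (hist n')" by (rule measurable_from_subalg[OF hist_mono g(1)]) (use n in simp)
    show "{w \<in> space (hist n'). active k J n' w} \<in> sets (hist n')"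
      using hist_active[of n' n' k J] n by simp
  qed simp
  have hb: "AE w in M. \<bar>h w\<bar> \<le> noise_bound k G"
    using g(2) AE_noise_term_le[OF n(1), of k G J]
    by eventually_elim (auto simp: h_def noise_bound_nonneg)
  note pair = cond_V_pairing[OF h hb, of k "traceless (A k) G"]
  have "(\<integral>w. noise_term k G J n w * noise_term k G J n' w \<partial>M)
      = (\<integral>w. h w * (Vh k n' w \<bullet> traceless (A k) G) - h w * (cond_V k n' w \<bullet> traceless (A k) G) \<partial>M)"
  proof (rule integral_cong_AE)
    show "AE w in M. noise_term k G J n w * noise_term k G J n' w
        = h w * (Vh k n' w \<bullet> traceless (A k) G) - h w * (cond_V k n' w \<bullet> traceless (A k) G)"
      using g(2) by eventually_elim
        (auto simp: h_def noise_term_def[of k G J n'] inner_diff_left right_diff_distrib)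
    show "(\<lambda>w. noise_term k G J n w * noise_term k G J n' w) \<in> borel_measurable M"
      by (intro borel_measurable_times noise_term_measurable) (use n in auto)
    show "(\<lambda>w. h w * (Vh k n' w \<bullet> traceless (A k) G) - h w * (cond_V k n' w \<bullet> traceless (A k) G)) \<in> borel_measurable M"
      by (intro borel_measurable_diff borel_measurable_integrable pair)
  qed
  also have "\<dots> = 0" using pair by simp
  finally show ?thesis .
qed

text \<open>By orthogonality the second moment of the sum of the first \<open>J\<close> noise terms of a user grows
  only linearly in \<open>J\<close>.\<close>

lemma noise_variance:
  "(\<integral>w. (\<Sum>n\<in>{1..N}. noise_term k G J n w)\<^sup>2 \<partial>M) \<le> (noise_bound k G)\<^sup>2 * J"
proof -
  let ?t = "noise_term k G J"
  have "(\<integral>w. (\<Sum>n\<in>{1..N}. ?t n w)\<^sup>2 \<partial>M) = (\<integral>w. (\<Sum>n\<in>{1..N}. \<Sum>n'\<in>{1..N}. ?t n w * ?t n' w) \<partial>M)"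
    by (simp add: power2_eq_square sum_product)
  also have "\<dots> = (\<Sum>n\<in>{1..N}. \<Sum>n'\<in>{1..N}. \<integral>w. ?t n w * ?t n' w \<partial>M)"
  proof -
    have "(\<integral>w. (\<Sum>n\<in>{1..N}. \<Sum>n'\<in>{1..N}. ?t n w * ?t n' w) \<partial>M) = (\<Sum>n\<in>{1..N}. \<integral>w. (\<Sum>n'\<in>{1..N}. ?t n w * ?t n' w) \<partial>M)"
      by (intro Bochner_Integration.integral_sum Bochner_Integration.integrable_sum noise_products_integrable) auto
    also have "\<dots> = (\<Sum>n\<in>{1..N}. \<Sum>n'\<in>{1..N}. \<integral>w. ?t n w * ?t n' w \<partial>M)"
      by (intro sum.cong refl Bochner_Integration.integral_sum noise_products_integrable) auto
    finally show ?thesis .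
  qed
  also have "\<dots> = (\<Sum>n\<in>{1..N}. \<Sum>n'\<in>{1..N}. if n = n' then \<integral>w. ?t n w * ?t n w \<partial>M else 0)"
  proof (intro sum.cong refl)
    fix n n' assume n: "n \<in> {1..N}" "n' \<in> {1..N}"
    show "(\<integral>w. ?t n w * ?t n' w \<partial>M) = (if n = n' then \<integral>w. ?t n w * ?t n w \<partial>M else 0)"
      using noise_terms_orthogonal[of n n' k G J] noise_terms_orthogonal[of n' n k G J] n
      by (cases n n' rule: linorder_cases) (auto simp: mult.commute)
  qed
  also have "\<dots> = (\<Sum>n\<in>{1..N}. \<integral>w. ?t n w * ?t n w \<partial>M)" by simp
  also have "\<dots> = (\<integral>w. (\<Sum>n\<in>{1..N}. ?t n w * ?t n w) \<partial>M)"
    by (intro Bochner_Integration.integral_sum[symmetric] noise_products_integrable) auto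
  also have "\<dots> \<le> (noise_bound k G)\<^sup>2 * J"
  proof (rule M.integral_le_const)
    show "integrable M (\<lambda>w. \<Sum>n\<in>{1..N}. ?t n w * ?t n w)"
      by (intro Bochner_Integration.integrable_sum noise_products_integrable) auto
    have "AE w in M. \<forall>n\<in>{1..N}. \<bar>?t n w\<bar> \<le> noise_bound k G"
      by (intro AE_ball_countable' AE_noise_term_le) auto
    then show "AE w in M. (\<Sum>n\<in>{1..N}. ?t n w * ?t n w) \<le> (noise_bound k G)\<^sup>2 * J"
    proof eventually_elim
      fix w assume b: "\<forall>n\<in>{1..N}. \<bar>?t n w\<bar> \<le> noise_bound k G"
      have "(\<Sum>n\<in>{1..N}. ?t n w * ?t n w) = (\<Sum>n\<in>{n \<in> {1..N}. active k J n w}. ?t n w * ?t n w)"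
        by (intro sum.mono_neutral_right) (auto simp: noise_term_def)
      also have "\<dots> \<le> of_nat (card {n \<in> {1..N}. active k J n w}) * (noise_bound k G)\<^sup>2"
      proof (rule sum_bounded_above)
        fix n assume "n \<in> {n \<in> {1..N}. active k J n w}"
        then have "\<bar>?t n w\<bar>\<^sup>2 \<le> (noise_bound k G)\<^sup>2" using b by (intro power_mono) auto
        then show "?t n w * ?t n w \<le> (noise_bound k G)\<^sup>2" by (simp add: power2_eq_square)
      qed
      also have "\<dots> \<le> J * (noise_bound k G)\<^sup>2"
        using card_first_hits_le[of N "\<lambda>n. k \<in> update_set T n w" J]
        by (intro mult_right_mono) (auto simp: active_def ticks_before_def)
      finally show "(\<Sum>n\<in>{1..N}. ?t n w * ?t n w) \<le> (noise_bound k G)\<^sup>2 * J" by (simp add: mult.commute)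
    qed
  qed
  finally show ?thesis .
qed

definition tick_epoch :: "'k \<Rightarrow> nat \<Rightarrow> 'w \<Rightarrow> nat" where
  "tick_epoch k j w = (SOME n. n \<ge> 1 \<and> epoch T n w = T k j w)"

lemma tick_epoch:
  assumes w: "good w" and j: "j \<ge> 1"
  shows "tick_epoch k j w \<ge> 1" "epoch T (tick_epoch k j w) w = T k j w" "k \<in> update_set T (tick_epoch k j w) w"
    "ticks_before k (tick_epoch k j w) w = j - 1"
proof -
  interpret regular_epochs T w by (rule good_epochs[OF w])
  have "\<exists>n. n \<ge> 1 \<and> epoch T n w = T k j w"
    using update_time_is_epoch[of "T k j w"] j by (auto simp: update_times_def)
  from someI_ex[OF this] show 1: "tick_epoch k j w \<ge> 1" "epoch T (tick_epoch k j w) w = T k j w"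
    by (auto simp: tick_epoch_def)
  show "k \<in> update_set T (tick_epoch k j w) w" using 1(2) j by (auto simp: update_set_def)
  show "ticks_before k (tick_epoch k j w) w = j - 1"
    unfolding ticks_before_eq[OF w] 1(2) by (rule tick_count_at_tick[OF ticks j])
qed

definition tick_noise :: "'k \<Rightarrow> complex^'m^'m \<Rightarrow> nat \<Rightarrow> 'w \<Rightarrow> real" where
  "tick_noise k G j w = (let n = tick_epoch k j w in (Vh k n w - cond_V k n w) \<bullet> traceless (A k) G)"

lemma noise_sum_by_ticks:
  assumes w: "good w" and N: "\<And>j. j \<in> {1..J} \<Longrightarrow> tick_epoch k j w \<le> N"
  shows "(\<Sum>n\<in>{1..N}. noise_term k G J n w) = (\<Sum>j\<in>{1..J}. tick_noise k G j w)"
proof -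
  interpret regular_epochs T w by (rule good_epochs[OF w])
  have "(\<Sum>n\<in>{1..N}. noise_term k G J n w) = (\<Sum>n\<in>{n \<in> {1..N}. active k J n w}. (Vh k n w - cond_V k n w) \<bullet> traceless (A k) G)"
    by (rule sum.mono_neutral_cong_right) (auto simp: noise_term_def)
  also have "\<dots> = (\<Sum>j\<in>{1..J}. tick_noise k G j w)"
  proof (rule sum.reindex_bij_witness[where i = "\<lambda>j. tick_epoch k j w" and j = "\<lambda>n. Suc (ticks_before k n w)"])
    fix n assume n: "n \<in> {n \<in> {1..N}. active k J n w}"
    then have k: "k \<in> update_set T n w" and l: "ticks_before k n w < J" by (auto simp: active_def)
    show "Suc (ticks_before k n w) \<in> {1..J}" using l by simp
    have "epoch T (tick_epoch k (Suc (ticks_before k n w)) w) w = T k (Suc (ticks_before k n w)) w"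
      by (rule tick_epoch(2)[OF w]) simp
    also have "\<dots> = epoch T n w" unfolding ticks_before_eq[OF w] by (rule updating_user_tick[OF k])
    finally show e: "tick_epoch k (Suc (ticks_before k n w)) w = n"
      using strict_mono_eq[OF epoch_strict_mono] by blast
    show "tick_noise k G (Suc (ticks_before k n w)) w = (Vh k n w - cond_V k n w) \<bullet> traceless (A k) G"
      unfolding tick_noise_def e by simp
  next
    fix j assume j: "j \<in> {1..J}"
    then have "j \<ge> 1" by simp
    note t = tick_epoch[OF w this, of k]
    show "tick_epoch k j w \<in> {n \<in> {1..N}. active k J n w}"
      using t N[OF j] j by (auto simp: active_def)
    show "Suc (ticks_before k (tick_epoch k j w) w) = j" using t(4) j by simp
  qed
  finally show ?thesis .
qed

text \<open>The epochs that carry the first \<open>J\<close> ticks are not bounded by a constant, so the second moment of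
  the sum over these ticks is reached as a limit over the epochs, by dominated convergence.\<close>

lemma AE_tick_noise_average:
  "AE w in M. (\<lambda>J. (\<Sum>j\<in>{1..J}. tick_noise k G j w) / J) \<longlonglongrightarrow> 0"
proof -
  let ?c = "noise_bound k G"
  define S where "S J N w = (\<Sum>n\<in>{1..N}. noise_term k G J n w)" for J N w
  define B where "B J w = lim (\<lambda>N. S J N w)" for J w
  have S: "S J N \<in> borel_measurable M" for J N
    unfolding S_def by (intro borel_measurable_sum noise_term_measurable) simp
  have B: "B J \<in> borel_measurable M" for J
    unfolding B_def using S by (rule borel_measurable_lim_metric)
  have conv: "(\<lambda>N. S J N w) \<longlonglongrightarrow> (\<Sum>j\<in>{1..J}. tick_noise k G j w)" if w: "good w" for J w
  proof (rule tendsto_eventually)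
    define N0 where "N0 = (\<Sum>j\<in>{1..J}. tick_epoch k j w)"
    have le: "tick_epoch k j w \<le> N0" if "j \<in> {1..J}" for j
      unfolding N0_def using that by (intro member_le_sum) auto
    show "\<forall>\<^sub>F N in sequentially. S J N w = (\<Sum>j\<in>{1..J}. tick_noise k G j w)"
      using eventually_ge_at_top[of N0]
    proof eventually_elim
      fix N assume "N0 \<le> N"
      then show "S J N w = (\<Sum>j\<in>{1..J}. tick_noise k G j w)"
        unfolding S_def by (intro noise_sum_by_ticks[OF w]) (use le in force)
    qed
  qed
  have BS: "B J w = (\<Sum>j\<in>{1..J}. tick_noise k G j w)" if "good w" for J w
    unfolding B_def by (rule limI[OF conv[OF that]])

  have dom: "AE w in M. norm ((S J N w)\<^sup>2) \<le> (real J * ?c)\<^sup>2" for J N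
  proof -
    have "AE w in M. \<forall>n\<in>{1..N}. \<bar>noise_term k G J n w\<bar> \<le> ?c"
      by (intro AE_ball_countable' AE_noise_term_le) auto
    then show ?thesis
    proof eventually_elim
      fix w assume b: "\<forall>n\<in>{1..N}. \<bar>noise_term k G J n w\<bar> \<le> ?c"
      have "S J N w = (\<Sum>n\<in>{n \<in> {1..N}. active k J n w}. noise_term k G J n w)"
        unfolding S_def by (intro sum.mono_neutral_right) (auto simp: noise_term_def)
      then have "\<bar>S J N w\<bar> \<le> (\<Sum>n\<in>{n \<in> {1..N}. active k J n w}. \<bar>noise_term k G J n w\<bar>)" by simp
      also have "\<dots> \<le> of_nat (card {n \<in> {1..N}. active k J n w}) * ?c"
        by (rule sum_bounded_above) (use b in auto)
      also have "\<dots> \<le> real J * ?c"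
        using card_first_hits_le[of N "\<lambda>n. k \<in> update_set T n w" J] noise_bound_nonneg
        by (intro mult_right_mono) (auto simp: active_def ticks_before_def)
      finally have "\<bar>S J N w\<bar>\<^sup>2 \<le> (real J * ?c)\<^sup>2" by (intro power_mono) auto
      then show "norm ((S J N w)\<^sup>2) \<le> (real J * ?c)\<^sup>2" by simp
    qed
  qed
  have lim: "AE w in M. (\<lambda>N. (S J N w)\<^sup>2) \<longlonglongrightarrow> (B J w)\<^sup>2" for J
    using AE_good by eventually_elim (simp only: BS, intro tendsto_power conv)
  have m2: "(\<lambda>w. (B J w)\<^sup>2) \<in> borel_measurable M" "(\<lambda>w. (S J N w)\<^sup>2) \<in> borel_measurable M" for J N
    using B S by measurable
  have "AE w in M. (\<lambda>J. B J w / J) \<longlonglongrightarrow> 0"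
  proof (rule M.averages_tendsto_0[OF B])
    show "integrable M (\<lambda>w. (B J w)\<^sup>2)" for J
      by (rule integrable_dominated_convergence[OF m2 _ lim dom]) simp
    show "(\<integral>w. (B J w)\<^sup>2 \<partial>M) \<le> ?c\<^sup>2 * J" for J
    proof (rule LIMSEQ_le_const2)
      show "(\<lambda>N. \<integral>w. (S J N w)\<^sup>2 \<partial>M) \<longlonglongrightarrow> (\<integral>w. (B J w)\<^sup>2 \<partial>M)"
        by (rule integral_dominated_convergence[OF m2 _ lim dom]) simp
      show "\<exists>N. \<forall>n\<ge>N. (\<integral>w. (S J n w)\<^sup>2 \<partial>M) \<le> ?c\<^sup>2 * J"
        unfolding S_def using noise_variance by blast
    qed
    show "AE w in M. \<forall>J. \<bar>B (Suc J) w - B J w\<bar> \<le> ?c"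
      using AE_good AE_unbiased
    proof eventually_elim
      fix w assume w: "good w" and u: "\<forall>n\<ge>1. \<forall>k. k \<in> update_set T n w \<longrightarrow>
        cond_V k n w = V_mean P L k (iterate A T Y (n - delay T0 T n w) w)"
      show "\<forall>J. \<bar>B (Suc J) w - B J w\<bar> \<le> ?c"
      proof
        fix J
        have j: "Suc J \<ge> 1" by simp
        have "B (Suc J) w - B J w = tick_noise k G (Suc J) w" by (simp add: BS[OF w])
        then show "\<bar>B (Suc J) w - B J w\<bar> \<le> ?c"
          unfolding tick_noise_def Let_def
          using noise_difference_le[OF w tick_epoch(3)[OF w j, of k]] u tick_epoch(1,3)[OF w j, of k] by simp
      qed
    qed
  qed
  with AE_good show ?thesis by eventually_elim (simp add: BS)
qed

section \<open>Almost sure convergence\<close>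

theorem learning_converges:
  assumes eq: "entropic_equilibrium \<tau> X"
  shows "AE w in M. (\<lambda>n. iterate A T Y n w) \<longlonglongrightarrow> X"
proof -
  have "AE w in M. \<forall>k. \<forall>G\<in>Basis. (\<lambda>J. (\<Sum>j\<in>{1..J}. tick_noise k G j w) / J) \<longlonglongrightarrow> 0"
    unfolding AE_all_countable
    by (intro allI AE_ball_countable' AE_tick_noise_average countable_finite finite_Basis)
  moreover have "AE w in M. \<exists>D. \<forall>n\<ge>1. delay T0 T n w \<le> D"
    using delays by (simp add: bounded_delays_def)
  ultimately show ?thesis
    using AE_good AE_unbiased
  proof eventually_elim
    fix w assume noise: "\<forall>k. \<forall>G\<in>Basis. (\<lambda>J. (\<Sum>j\<in>{1..J}. tick_noise k G j w) / J) \<longlonglongrightarrow> 0"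
      and "\<exists>D. \<forall>n\<ge>1. delay T0 T n w \<le> D" and w: "good w"
      and u: "\<forall>n\<ge>1. \<forall>k. k \<in> update_set T n w \<longrightarrow>
        cond_V k n w = V_mean P L k (iterate A T Y (n - delay T0 T n w) w)"
    then obtain D where D: "\<And>n. n \<ge> 1 \<Longrightarrow> delay T0 T n w \<le> D" by blast
    let ?e = "\<lambda>k j. tick_epoch k j w"
    let ?p = "\<lambda>k j. ?e k j - delay T0 T (?e k j) w"
    let ?V = "\<lambda>k j. V_hat A P H T0 T Y k (T k j w) w"
    let ?D = "\<lambda>k j. traceless (A k) (?V k j - V_mean P L k (iterate A T Y (?p k j) w))"
    interpret regular_epochs T w by (rule good_epochs[OF w])
    interpret learning_path L A P b T w Y \<tau> ?V gain_bound ?e ?p D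
    proof
      show "Y k j w \<in> herm (A k)" for k j by (rule Y_herm[OF w])
      show "Y k j w = Y k (j - 1) w + (1 / (real j + 1)) *\<^sub>R (?V k j - \<tau> *\<^sub>R Y k (j - 1) w)" if "1 \<le> j" for k j
        by (rule Y_recursion[OF goodD(1)[OF w] that])
      show "norm (?V k j) \<le> gain_bound" if "1 \<le> j" for k j by (rule V_hat_bounded[OF w that])
      show "epoch T (?e k j) w = T k j w" if "1 \<le> j" for k j by (rule tick_epoch(2)[OF w that])
      show "?p k j \<le> ?e k j" if "1 \<le> j" for k j by simp
      show "?e k j \<le> ?p k j + D" if "1 \<le> j" for k j
        using D[OF tick_epoch(1)[OF w that, of k]] by simp
      show "(\<lambda>J. (1 / real J) *\<^sub>R (\<Sum>j\<in>{1..J}. ?D k j)) \<longlonglongrightarrow> 0" for k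
      proof (rule tendsto_componentwise_iff[THEN iffD2], rule ballI)
        fix G :: "complex^'m^'m" assume G: "G \<in> Basis"
        have "?D k j \<bullet> G = tick_noise k G j w"
          if j: "j \<ge> 1" for j
        proof -
          note t = tick_epoch[OF w j, of k]
          have "Vh k (?e k j) w = ?V k j" using V_hat_epoch_at_tick[OF w t(3)] t(4) j by simp
          moreover have "cond_V k (?e k j) w = V_mean P L k (iterate A T Y (?p k j) w)" using u t(1,3) by blast
          ultimately show ?thesis by (simp add: tick_noise_def traceless_inner Let_def)
        qed
        then have sum: "((1 / real J) *\<^sub>R (\<Sum>j\<in>{1..J}. ?D k j)) \<bullet> G
            = (\<Sum>j\<in>{1..J}. tick_noise k G j w) / J" for J
          by (simp add: inner_sum_left)
        show "(\<lambda>J. ((1 / real J) *\<^sub>R (\<Sum>j\<in>{1..J}. ?D k j)) \<bullet> G) \<longlonglongrightarrow> 0 \<bullet> G"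
          unfolding sum inner_zero_left using noise G by blast
      qed
    qed (rule \<tau>)
    show "(\<lambda>n. iterate A T Y n w) \<longlonglongrightarrow> X" by (rule iterates_converge[OF eq])
  qed
qed

end

text \<open>The bounds on the channels of a process carry over to their law at time 0.\<close>

lemma channel_process_law:
  fixes A :: "'k::finite \<Rightarrow> 'm::finite set" and L :: "('k, 'n::finite, 'm) channel measure"
  assumes A: "\<forall>k. A k \<noteq> {}" and P: "\<forall>k. P k > 0" and M: "prob_space M" and H: "channel_process A L M H"
  shows "\<exists>b. channel_law L A P b \<and> (AE w in M. \<forall>t\<ge>0. norm (H t w) \<le> b)"
proof -
  interpret M: prob_space M by (rule M)
  have supp: "\<And>t w k. t \<ge> 0 \<Longrightarrow> w \<in> space M \<Longrightarrow> supported UNIV (A k) (H t w $ k)"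
    and H0: "H 0 \<in> borel_measurable M" and L: "L = distr M borel (H 0)"
    using H by (auto simp: channel_process_def stationary_ergodic_def)
  obtain b where b: "AE w in M. \<forall>t\<ge>0. norm (H t w) \<le> b" using H by (auto simp: channel_process_def)
  have "channel_law L A P b"
  proof (intro channel_law.intro channel_law_axioms.intro)
    show "prob_space L" unfolding L by (rule M.prob_space_distr[OF H0])
    show "sets L = sets borel" by (simp add: L)
    have "{x::('k,'n,'m) channel. norm x \<le> b} \<in> sets borel"
      by (intro borel_closed closed_Collect_le continuous_intros)
    then show "AE x in L. norm x \<le> b"
      unfolding L by (subst AE_distr_iff[OF H0]) (use b in \<open>auto elim: eventually_mono\<close>)
    have "closed {x::('k,'n,'m) channel. \<forall>k. \<forall>i j. j \<notin> A k \<longrightarrow> x $ k $ i $ j = 0}"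
      by (intro closed_Collect_all closed_Collect_imp closed_Collect_eq continuous_intros open_Collect_const)
    moreover have "{x::('k,'n,'m) channel. \<forall>k. \<forall>i j. j \<notin> A k \<longrightarrow> x $ k $ i $ j = 0} = {x. \<forall>k. supported UNIV (A k) (x $ k)}"
      by (auto simp: supported_def)
    ultimately have "{x::('k,'n,'m) channel. \<forall>k. supported UNIV (A k) (x $ k)} \<in> sets borel"
      by (simp only: borel_closed)
    then show "AE x in L. \<forall>k. supported UNIV (A k) (x $ k)"
      unfolding L by (subst AE_distr_iff[OF H0]) (use supp in \<open>auto intro!: AE_I2\<close>)
  qed (use A P in auto)
  then show ?thesis using b by blast
qed
section \<open>Convergence to an approximate Nash equilibrium\<close>

theorem corollary4p2:
  fixes A :: "'k::finite \<Rightarrow> 'm::finite set"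
    and P :: "'k \<Rightarrow> real"
    and L :: "('k, 'n::finite, 'm) channel measure"
  assumes "\<And>k. A k \<noteq> {}"
    and "\<And>k. P k > 0"
  shows "\<exists>\<epsilon> :: real \<Rightarrow> real. (\<epsilon> \<longlongrightarrow> 0) (at_right 0) \<and>
    (\<forall>\<tau>>0. \<forall>(M :: 'w measure) H T0 T Y0 Y.
       prob_space M \<and>
       channel_process A L M H \<and>
       timer M T0 \<and> positive_finite_rate M T0 \<and>
       (\<forall>k. timer M (T k) \<and> positive_finite_rate M (T k)) \<and>
       learning_run A P \<tau> M H T0 T Y0 Y \<and>
       bounded_delays M T0 T \<and>
       unbiased_estimates A P L M H T0 T Y \<longrightarrow>
       (\<exists>Xlim Xstar.
          (AE w in M. (\<lambda>n. iterate A T Y n w) \<longlonglongrightarrow> Xlim) \<and>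
          nash_equilibrium A P L Xstar \<and> dist Xlim Xstar \<le> \<epsilon> \<tau>))"
proof -
  have A: "\<forall>k. A k \<noteq> {}" and P: "\<forall>k. P k > 0" using assms by auto
  show ?thesis
  proof (cases "\<exists>b. channel_law L A P b")
    case True
    then obtain b where "channel_law L A P b" by blast
    then interpret channel_law L A P b .
    define Xt where "Xt \<tau> = (SOME X. entropic_equilibrium \<tau> X)" for \<tau>
    have Xt: "entropic_equilibrium \<tau> (Xt \<tau>)" for \<tau>
      unfolding Xt_def using entropic_equilibrium_exists by (rule someI_ex)
    obtain \<epsilon> where \<epsilon>: "(\<epsilon> \<longlongrightarrow> 0) (at_right 0)"
      "\<And>\<tau>. \<tau> > 0 \<Longrightarrow> \<exists>Xs. nash_equilibrium A P L Xs \<and> dist (Xt \<tau>) Xs \<le> \<epsilon> \<tau>"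
      using entropic_equilibria_approach_nash[OF Xt] by blast
    show ?thesis
    proof (intro exI[of _ \<epsilon>] conjI \<epsilon>(1) allI impI)
      fix \<tau> :: real and M :: "'w measure" and H T0 T Y0 Y
      assume \<tau>: "0 < \<tau>" and run: "prob_space M \<and>
         channel_process A L M H \<and>
         timer M T0 \<and> positive_finite_rate M T0 \<and>
         (\<forall>k. timer M (T k) \<and> positive_finite_rate M (T k)) \<and>
         learning_run A P \<tau> M H T0 T Y0 Y \<and>
         bounded_delays M T0 T \<and>
         unbiased_estimates A P L M H T0 T Y"
      \<comment> \<open>Every process comes with its own bound on the channels.\<close>
      obtain b' where b': "channel_law L A P b'" "AE w in M. \<forall>t\<ge>0. norm (H t w) \<le> b'"
        using channel_process_law[OF A P, of M L H] run by blast
      have "learning_process L A P b' M H T0 T Y0 Y \<tau>"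
      proof (intro learning_process.intro learning_process_axioms.intro b' \<tau>)
        show "supported UNIV (A k) (H t w $ k)" if "0 \<le> t" "w \<in> space M" for t w k
          using run that unfolding channel_process_def by blast
      qed (use run in blast)+
      then have "AE w in M. (\<lambda>n. iterate A T Y n w) \<longlonglongrightarrow> Xt \<tau>"
        using Xt by (rule learning_process.learning_converges)
      then show "\<exists>Xlim Xstar. (AE w in M. (\<lambda>n. iterate A T Y n w) \<longlonglongrightarrow> Xlim) \<and>
          nash_equilibrium A P L Xstar \<and> dist Xlim Xstar \<le> \<epsilon> \<tau>"
        using \<epsilon>(2)[OF \<tau>] by blast
    qed
  next
    case False
    \<comment> \<open>Then \<open>L\<close> is the stationary law of no channel process.\<close>
    have "((\<lambda>_. 0) \<longlongrightarrow> (0::real)) (at_right 0)" by (rule tendsto_const)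
    moreover have "\<not> channel_process A L M H" if "prob_space M" for M :: "'w measure" and H
      using channel_process_law[OF A P that, of L H] False by blast
    ultimately show ?thesis by (intro exI[of _ "\<lambda>_. 0"]) blast
  qed
qed

end
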